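(* Let $\Phi:T\times\mathbb{R}^n\times\mathbb{R}^q\rightrightarrows\mathbb{R}^m$ be a set-valued normal integrand, let $\mathcal{K}\subseteq\mathbb{R}^m$ and $\mathcal{O}\subseteq\mathbb{R}^n\times\mathbb{R}^q$ be nonempty closed sets, and let $F:\mathbb{R}^n\rightrightarrows\mathbb{R}^q$ be $$F(x):=\{z\in\mathbb{R}^q:\ \mathrm{E}_\Phi(x,z)\cap\mathcal{K}\neq\emptyset,\ (x,z)\in\mathcal{O}\}.$$ Let $(\bar x,\bar z)\in\operatorname{gph}F$, and suppose that $\operatorname{gph}F$ is normally regular at $(\bar x,\bar z)$ and that there exists $\rho>0$ such that $\Phi_t(x,z)$ is convex for all $(x,z)\in\mathbb{B}_\rho(\bar x,\bar z)$ and all $t\in T$, and $\Phi_t(\bar x,\bar z)$ is single-valued for all $t\in T$, say $\Phi_t(\bar x,\bar z)=\{\bar{\mathsf y}(t)\}$. Let $\bar y\in\mathrm{E}_\Phi(\bar x,\bar z)\cap\mathcal{K}$, and assume that $\Phi$ is integrably Lipschitz-like around $(\bar x,\bar z,\bar{\mathsf y})$. Suppose the qualification conditions $$\Big[0\in\int_T D^*\Phi_t(\bar x,\bar z)(y^* )\,\mu(dt),\ y^*\in N(\bar y;\mathcal{K})\Big]\Longrightarrow y^*=0,$$ $$\bigcup_{y^*\in N(\bar y;\mathcal{K})}\Big[\int_T D^*\Phi_t(\bar x,\bar z)(y^* )\,\mu(dt)\Big]\cap\big(-N((\bar x,\bar z);\mathcal{O})\big)=\{0\}.$$ Then for all $z^*\in\mathbb{R}^q$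 and $x^*\in D^*F(\bar x,\bar z)(z^* )$ there exists $y^*\in N(\bar y;\mathcal{K})$ such that $$\begin{pmatrix}x^*\\-z^*\end{pmatrix}\in\int_T D^*\Phi_t(\bar x,\bar z)(y^* )\,\mu(dt)+N\big((\bar x,\bar z);\mathcal{O}\big).$$
   Context: $(T,\mathcal{A},\mu)$ is a complete finite measure space. $\mathbb{B}$ is the closed unit ball and $\mathbb{B}_r(u)$ the closed ball of radius $r$ centered at $u$. Set-valued normal integrand: each $\Phi_t:=\Phi(t,\cdot,\cdot)$ has closed graph and $\operatorname{gph}\Phi\in\mathcal{A}\otimes\mathcal{B}(\mathbb{R}^n\times\mathbb{R}^q\times\mathbb{R}^m)$. $\mathrm{E}_\Phi(x,z):=\int_T\Phi_t(x,z)\,\mu(dt)$; integrals of multifunctions are Aumann integrals (sets of integrals of integrable a.e. selections). Normal cones: for $C\subseteq\mathbb{R}^d$ and $x\in C$, $\hat N(x;C):=\{x^*:\limsup_{u\to x,\,u\in C}\langle x^*,u-x\rangle/\|u-x\|\le0\}$ (empty if $x\notin C$), and $N(x;C)$ is the set of all limits of sequences $x_k^*\in\hat N(x_k;C)$ with $x_k\to x$. $C$ is normally regular at $x\in C$ if $\hat N(x;C)=N(x;C)$. Coderivative: $D^*M(u,y)(y^* ):=\{u^*:(u^*,-y^* )\in N((u,y);\operatorname{gph}M)\}$ for $(u,y)\in\operatorname{gph}M$; $y$ is omitted when $M(u)=\{y\}$, so $D^*\Phi_t(\bar x,\bar z):=D^*\Phi_t(\bar x,\bar z,\bar{\mathsf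 y}(t))$, with values in subsets of $\mathbb{R}^n\times\mathbb{R}^q$. $\Phi$ is integrably Lipschitz-like around $(\bar x,\bar z,\bar{\mathsf y})$ if there exist positive constants $\ell,\eta,\gamma$ and $\hat T\in\mathcal{A}$ with $\mu(T\setminus\hat T)=0$ such that $\Phi_t(u)\cap\mathbb{B}_\gamma(\bar{\mathsf y}(t))\subseteq\Phi_t(u')+\ell\|u-u'\|\mathbb{B}$ for all $t\in\hat T$ and $u,u'\in\mathbb{B}_\eta(\bar x,\bar z)$. *)

theory Defs
  imports "HOL-Analysis.Analysis" "HOL-Library.Set_Algebras"
begin

text \<open>
  The upper limit is taken in the extended reals, so that it exists for every set \<open>C\<close>;
  at an isolated point of \<open>C\<close> it is \<open>-\<infinity>\<close> and every vector is a regular normal.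
\<close>

definition regular_normal_cone :: "'a::euclidean_space \<Rightarrow> 'a set \<Rightarrow> 'a set" where
  "regular_normal_cone x C =
     {xs. x \<in> C \<and> Limsup (at x within C) (\<lambda>u. ereal (inner xs (u - x) / norm (u - x))) \<le> 0}"

definition normal_cone :: "'a::euclidean_space \<Rightarrow> 'a set \<Rightarrow> 'a set" where
  "normal_cone x C =
     {xs. \<exists>X XS. (\<forall>k::nat. XS k \<in> regular_normal_cone (X k) C) \<and>
            X \<longlonglongrightarrow> x \<and> XS \<longlonglongrightarrow> xs}"

definition normally_regular :: "'a::euclidean_space set \<Rightarrow> 'a \<Rightarrow> bool" where
  "normally_regular C x \<longleftrightarrow> x \<in> C \<and> regular_normal_cone x C = normal_cone x C"

definition gph :: "('a \<Rightarrow> 'b set) \<Rightarrow> ('a \<times> 'b) set" where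
  "gph G = {(u, y). y \<in> G u}"

definition coderivative ::
  "('a::euclidean_space \<Rightarrow> 'b::euclidean_space set) \<Rightarrow> 'a \<Rightarrow> 'b \<Rightarrow> 'b \<Rightarrow> 'a set" where
  "coderivative G u y ys = {us. (us, - ys) \<in> normal_cone (u, y) (gph G)}"

definition set_valued_normal_integrand ::
  "'t measure \<Rightarrow> ('t \<Rightarrow> 'u::euclidean_space \<Rightarrow> 'v::euclidean_space set) \<Rightarrow> bool" where
  "set_valued_normal_integrand M \<Phi> \<longleftrightarrow>
     (\<forall>t \<in> space M. closed (gph (\<Phi> t))) \<and>
     {(t, u, y). t \<in> space M \<and> y \<in> \<Phi> t u} \<in> sets (M \<Otimes>\<^sub>M (borel :: ('u \<times> 'v) measure))"

definition aumann_integral :: "'t measure \<Rightarrow> ('t \<Rightarrow> 'v::euclidean_space set) \<Rightarrow> 'v set" where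
  "aumann_integral M G = {integral\<^sup>L M f | f. integrable M f \<and> (AE t in M. f t \<in> G t)}"

definition expected_multifunction ::
  "'t measure \<Rightarrow> ('t \<Rightarrow> 'u \<Rightarrow> 'v::euclidean_space set) \<Rightarrow> 'u \<Rightarrow> 'v set" where
  "expected_multifunction M \<Phi> u = aumann_integral M (\<lambda>t. \<Phi> t u)"

definition integrably_Lipschitz_like ::
  "'t measure \<Rightarrow> ('t \<Rightarrow> 'u::euclidean_space \<Rightarrow> 'v::euclidean_space set) \<Rightarrow> 'u \<Rightarrow> ('t \<Rightarrow> 'v) \<Rightarrow> bool"
where
  "integrably_Lipschitz_like M \<Phi> ubar y \<longleftrightarrow>
     (\<exists>l > 0. \<exists>\<eta> > 0. \<exists>\<gamma> > 0. \<exists>T' \<in> sets M. emeasure M (space M - T') = 0 \<and>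
        (\<forall>t \<in> T'. \<forall>u \<in> cball ubar \<eta>. \<forall>u' \<in> cball ubar \<eta>.
           \<Phi> t u \<inter> cball (y t) \<gamma> \<subseteq> \<Phi> t u' + (\<lambda>b. (l * norm (u - u')) *\<^sub>R b) ` cball 0 1))"

end

theory Submission
  imports Defs "HOL-Library.Diagonal_Subsequence"
begin

text \<open>
Write \<open>u = (x, z)\<close>, so that \<open>gph F\<close> is the set of all \<open>u \<in> Om\<close> for which some integrable selection of
\<open>t \<mapsto> \<Phi> t u\<close> has its integral in \<open>K\<close>. Normal regularity turns an element of the coderivative of \<open>F\<close> into
a regular normal \<open>us\<close> of this set at \<open>ubar = (xbar, zbar)\<close>, that is, for every \<open>e > 0\<close> the point \<open>ubar\<close>
minimises \<open>- us \<bullet> (u - ubar) + 2 * e * norm (u - ubar)\<close> locally over the set.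

The constraint is decoupled by giving every \<open>t\<close> its own copy of \<open>u\<close>: the unknowns are \<open>u\<close> and measurable
\<open>v\<close>, \<open>f\<close> with \<open>f t \<in> \<Phi> t (v t)\<close>, and the squared distances from \<open>u\<close> to \<open>Om\<close>, from \<open>\<integral>f\<close> to \<open>K\<close> and, in
the mean, from \<open>v\<close> to \<open>u\<close> are added with a large factor \<open>n\<close> (\<open>penalty\<close>). Since \<open>\<Phi> t ubar\<close> is the single
point \<open>y t\<close>, the Lipschitz condition keeps \<open>f t\<close> within \<open>l * norm (v t - ubar)\<close> of \<open>y t\<close>; so all competitors
are bounded, minimisers exist (\<open>penalty_minimiser\<close>), and they approach \<open>ubar\<close> as \<open>n\<close> grows
(\<open>penalty_minimisers_converge\<close>).

At a minimiser put \<open>ys = n (\<integral>f - \<kappa>)\<close> and \<open>ws = n (u - w)\<close>, where \<open>\<kappa>\<close> and \<open>w\<close> are nearest points of \<open>K\<close> and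
\<open>Om\<close>. If an inequality of second order failed on a set of positive measure, a measurable selection of
violating points would improve the objective; hence it holds almost everywhere (\<open>pointwise_optimality\<close>), and
it says that \<open>(p t, - ys)\<close> with \<open>p t = c n (u - v t)\<close> is a regular normal to \<open>gph (\<Phi> t)\<close>, with one \<open>ys\<close> for
all \<open>t\<close>. The Lipschitz condition bounds \<open>p t\<close> by a multiple of \<open>norm ys\<close>, and stationarity in \<open>u\<close> reads
\<open>norm (us - ws - \<integral>p) \<le> 2 * e\<close>. The result is \<open>approximate_normals\<close>; its passage to the limit is
\<open>normals_of_constraint_system\<close>, where the two qualification conditions exclude unbounded \<open>ys\<close>.

The existence of minimisers and the passage to the limit need the same compactness theorem, the finite
dimensional Fatou lemma of Schmeidler and Aumann: if a bounded sequence of functions has convergent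
integrals, then the limit is the integral of a measurable selection of the pointwise cluster points
(\<open>selection_integrals_closed\<close>). On the atoms a diagonal subsequence converges. The non-atomic part
is governed by a weak form of Lyapunov's theorem (\<open>continuous_approximate_mixing\<close>): a partition by a uniformly
distributed variable mixes finitely many functions so that the integral varies continuously and is
approximately a convex combination. Hence the integrals of cluster selections have a convex closure. A
fixed point argument shows that they contain the relative interior of the closure, and a limit on the
relative boundary is reached by induction on the affine dimension, because the sequence then concentrates
on a supporting face.

Measurable selections of violating points require that the projection to \<open>T\<close> of a product measurable set
is measurable. Completeness of the measure guarantees this: such sets are analytic, and the projections of
analytic sets are approximated from inside in measure (\<open>analytic_projection_measurable\<close>).
\<close>

section \<open>Analytic sets over a measure space and measurable projections\<close>

text \<open>
Cantor's diagonal argument for countably many compact sets. It is applied to sequences of codes and to the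
values of functions on countably many atoms.
\<close>

lemma diagonal_convergent_subsequence:
  fixes x :: "nat \<Rightarrow> nat \<Rightarrow> 'a::metric_space"
  assumes "\<And>i. compact (C i)" and "\<And>n i. x n i \<in> C i"
  shows "\<exists>r :: nat \<Rightarrow> nat. strict_mono r \<and> (\<forall>i. \<exists>l\<in>C i. (\<lambda>n. x (r n) i) \<longlonglongrightarrow> l)"
proof -
  interpret subseqs "\<lambda>i r. \<exists>l\<in>C i. (\<lambda>n. x (r n) i) \<longlonglongrightarrow> l"
  proof
    fix i and s :: "nat \<Rightarrow> nat"
    have "seq_compact (C i)"
      using assms(1) compact_imp_seq_compact by blast
    moreover have "\<forall>n. x (s n) i \<in> C i"
      using assms(2) by blast
    ultimately obtain l r where "l \<in> C i" "strict_mono r" "((\<lambda>n. x (s n) i) \<circ> r) \<longlonglongrightarrow> l"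
      using seq_compactE[of "C i" "\<lambda>n. x (s n) i"] by metis
    then show "\<exists>r'. strict_mono r' \<and> (\<exists>l\<in>C i. (\<lambda>n. x ((s \<circ> r') n) i) \<longlonglongrightarrow> l)"
      by (auto simp: o_def)
  qed
  have "\<exists>l\<in>C i. (\<lambda>n. x (diagseq n) i) \<longlonglongrightarrow> l" for i
  proof -
    obtain l where l: "l \<in> C i" "(\<lambda>n. x (seqseq (Suc i) n) i) \<longlonglongrightarrow> l"
      using seqseq_holds[of i] by blast
    have "((\<lambda>n. x (seqseq (Suc i) n) i) \<circ> (\<lambda>n. fold_reduce (Suc i) n (Suc i + n))) \<longlonglongrightarrow> l"
      by (rule LIMSEQ_subseq_LIMSEQ[OF l(2) subseq_diagonal_rest])
    moreover have "(\<lambda>n. x (seqseq (Suc i) n) i) \<circ> (\<lambda>n. fold_reduce (Suc i) n (Suc i + n))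
        = (\<lambda>n. x (diagseq (n + Suc i)) i)"
      using diagseq_seqseq[of "Suc i"] by (simp add: fun_eq_iff o_def add.commute)
    ultimately have "(\<lambda>n. x (diagseq (n + Suc i)) i) \<longlonglongrightarrow> l" by simp
    then have "(\<lambda>n. x (diagseq n) i) \<longlonglongrightarrow> l"
      by (rule LIMSEQ_offset)
    with l(1) show ?thesis by blast
  qed
  with subseq_diagseq show ?thesis by blast
qed

text \<open>
This is Souslin's operation in the following normal form. A code \<open>\<sigma>\<close> selects the set \<open>A n (\<sigma> n)\<close> at stage \<open>n\<close>,
and everything that ties the code to the point \<open>y\<close>, or its entries to each other, is put into the one closed
set \<open>F\<close>. Countable unions and intersections are then obtained by renumbering the entries of the code.
\<close>

definition souslin_set ::
  "'t measure \<Rightarrow> (nat \<Rightarrow> nat \<Rightarrow> 't set) \<Rightarrow> ('y \<times> (nat \<Rightarrow> nat)) set \<Rightarrow> ('t \<times> 'y) set" where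
  "souslin_set M A F = {(t, y). t \<in> space M \<and> (\<exists>\<sigma>. (y, \<sigma>) \<in> F \<and> (\<forall>n. t \<in> A n (\<sigma> n)))}"

definition analytic_over :: "'t measure \<Rightarrow> ('t \<times> 'y::topological_space) set \<Rightarrow> bool" where
  "analytic_over M G \<longleftrightarrow>
     (\<exists>A F. (\<forall>n k. A n k \<in> sets M) \<and> closed F \<and> G = souslin_set M A F)"

lemma analytic_overI:
  fixes A :: "nat \<Rightarrow> nat \<Rightarrow> 't set"
  assumes "\<And>n k. A n k \<in> sets M" and "closed F"
    and "\<And>t y. (t, y) \<in> G \<longleftrightarrow> t \<in> space M \<and> (\<exists>\<sigma>. (y, \<sigma>) \<in> F \<and> (\<forall>n. t \<in> A n (\<sigma> n)))"
  shows "analytic_over M G"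
proof -
  have "G = souslin_set M A F" using assms(3) by (auto simp: souslin_set_def)
  with assms(1,2) show ?thesis unfolding analytic_over_def by blast
qed

lemma continuous_on_nat_fun: "continuous_on UNIV (c :: nat \<Rightarrow> 'a::topological_space)"
  by (simp add: continuous_on_open_vimage open_discrete)

lemma continuous_on_reindex:
  fixes p :: "nat \<Rightarrow> nat" and c :: "nat \<Rightarrow> nat"
  shows "continuous_on UNIV (\<lambda>(y::'y::topological_space, \<sigma>::nat \<Rightarrow> nat). (y, \<lambda>n. c (\<sigma> (p n)))) "
proof -
  have "continuous_on UNIV (\<lambda>z::'y \<times> (nat \<Rightarrow> nat). c (snd z (p n)))" for n
  proof -
    have "continuous_on UNIV (c \<circ> ((\<lambda>\<sigma>. \<sigma> (p n)) \<circ> (snd :: 'y \<times> (nat \<Rightarrow> nat) \<Rightarrow> _)))"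
      by (intro continuous_on_compose continuous_on_snd continuous_on_id
            continuous_on_subset[OF continuous_on_product_coordinates[of "p n"]]
            continuous_on_subset[OF continuous_on_nat_fun]) auto
    then show ?thesis by (simp add: o_def)
  qed
  then show ?thesis
    unfolding case_prod_beta
    by (intro continuous_on_Pair continuous_on_fst continuous_on_id
          continuous_on_coordinatewise_then_product)
qed

lemma tendsto_fun_coordinatewise:
  fixes f :: "'a \<Rightarrow> 'i \<Rightarrow> 'b::topological_space"
  assumes "\<And>i. ((\<lambda>n. f n i) \<longlongrightarrow> l i) F"
  shows "(f \<longlongrightarrow> l) F"
proof -
  have "limitin (product_topology (\<lambda>i. euclidean) UNIV) f l F"
    using assms by (simp add: limitin_componentwise)
  then show ?thesis by (metis euclidean_product_topology limitin_canonical_iff)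
qed

lemma closed_vimage_reindex:
  fixes F :: "('y::topological_space \<times> (nat \<Rightarrow> nat)) set" and p c :: "nat \<Rightarrow> nat"
  assumes "closed F"
  shows "closed {(y, \<sigma>). (y, \<lambda>n. c (\<sigma> (p n))) \<in> F}"
proof -
  have "closed ((\<lambda>(y, \<sigma>). (y, \<lambda>n. c (\<sigma> (p n)))) -` F)"
    using continuous_on_reindex[of c p] assms closed_vimage by blast
  moreover have "(\<lambda>(y, \<sigma>). (y, \<lambda>n. c (\<sigma> (p n)))) -` F = {(y, \<sigma>). (y, \<lambda>n. c (\<sigma> (p n))) \<in> F}"
    by auto
  ultimately show ?thesis by simp
qed

lemma closed_coordinate:
  "closed {(y::'y::topological_space, \<sigma>::nat \<Rightarrow> nat). P (\<sigma> i)}"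
proof -
  have "continuous_on UNIV (\<lambda>z::'y \<times> (nat \<Rightarrow> nat). snd z i)"
    using continuous_on_compose2[OF continuous_on_product_coordinates[of i] continuous_on_snd[OF continuous_on_id]]
    by auto
  then have "closed ((\<lambda>z::'y \<times> (nat \<Rightarrow> nat). snd z i) -` Collect P)"
    by (intro closed_vimage) (auto simp: closed_def open_discrete)
  moreover have "(\<lambda>z::'y \<times> (nat \<Rightarrow> nat). snd z i) -` Collect P = {(y, \<sigma>). P (\<sigma> i)}"
    by auto
  ultimately show ?thesis by simp
qed

lemma analytic_over_subset: "analytic_over M G \<Longrightarrow> G \<subseteq> space M \<times> UNIV"
  by (auto simp: analytic_over_def souslin_set_def)

lemma analytic_over_Times:
  assumes "A \<in> sets M" "closed C"
  shows "analytic_over M (A \<times> C)"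
proof (rule analytic_overI)
  show "closed (C \<times> (UNIV :: (nat \<Rightarrow> nat) set))"
    using assms(2) by (intro closed_Times) auto
qed (use assms sets.sets_into_space[OF assms(1)] in auto)

text \<open>
A point of the intersection has one code for each \<open>G i\<close>. The pairing function interleaves them into a single
code, whose entry number \<open>(i, n)\<close> is entry \<open>n\<close> of the code for \<open>G i\<close>; the conditions on the codes stay closed.
\<close>

lemma analytic_over_INT:
  assumes "\<And>i::nat. analytic_over M (G i)"
  shows "analytic_over M (\<Inter>i. G i)"
proof -
  from assms obtain A F where
    A: "\<And>i n k. A i n k \<in> sets M" and F: "\<And>i. closed (F i)" and
    G': "\<And>i. G i = souslin_set M (A i) (F i)"
    unfolding analytic_over_def by metis
  have G: "G i = {(t, y). t \<in> space M \<and> (\<exists>\<sigma>. (y, \<sigma>) \<in> F i \<and> (\<forall>n. t \<in> A i n (\<sigma> n)))}" for i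
    using G' by (simp add: souslin_set_def)
  define F' where "F' = (\<Inter>i. {(y, \<sigma>). (y, \<lambda>n. id (\<sigma> (prod_encode (i, n)))) \<in> F i})"
  define A' where "A' m = (case prod_decode m of (i, n) \<Rightarrow> A i n)" for m
  have "closed F'"
    unfolding F'_def by (intro closed_INT ballI closed_vimage_reindex F)
  moreover have "\<And>n k. A' n k \<in> sets M"
    using A by (simp add: A'_def case_prod_beta)
  moreover have "(\<Inter>i. G i) = {(t, y). t \<in> space M \<and> (\<exists>\<sigma>. (y, \<sigma>) \<in> F' \<and> (\<forall>n. t \<in> A' n (\<sigma> n)))}"
  proof (intro set_eqI iffI)
    fix w assume w: "w \<in> (\<Inter>i. G i)"
    obtain t y where wt: "w = (t, y)" by (cases w)
    from w have "\<forall>i. t \<in> space M \<and> (\<exists>\<sigma>. (y, \<sigma>) \<in> F i \<and> (\<forall>n. t \<in> A i n (\<sigma> n)))"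
      by (auto simp: G wt)
    then obtain s where t: "t \<in> space M" and s: "\<And>i. (y, s i) \<in> F i" "\<And>i n. t \<in> A i n (s i n)"
      by metis
    define \<sigma> where "\<sigma> m = (case prod_decode m of (i, n) \<Rightarrow> s i n)" for m
    have "(y, \<sigma>) \<in> F'"
      using s by (simp add: F'_def \<sigma>_def)
    moreover have "\<forall>n. t \<in> A' n (\<sigma> n)"
      using s by (simp add: A'_def \<sigma>_def case_prod_beta)
    ultimately show "w \<in> {(t, y). t \<in> space M \<and> (\<exists>\<sigma>. (y, \<sigma>) \<in> F' \<and> (\<forall>n. t \<in> A' n (\<sigma> n)))}"
      using t wt by auto
  next
    fix w assume "w \<in> {(t, y). t \<in> space M \<and> (\<exists>\<sigma>. (y, \<sigma>) \<in> F' \<and> (\<forall>n. t \<in> A' n (\<sigma> n)))}"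
    then obtain t y \<sigma> where wt: "w = (t, y)" and t: "t \<in> space M" and
      s: "(y, \<sigma>) \<in> F'" "\<forall>n. t \<in> A' n (\<sigma> n)"
      by auto
    have "(t, y) \<in> G i" for i
    proof -
      have "(y, \<lambda>n. \<sigma> (prod_encode (i, n))) \<in> F i"
        using s(1) by (simp add: F'_def)
      moreover have "\<forall>n. t \<in> A i n (\<sigma> (prod_encode (i, n)))"
        using s(2)[rule_format, of "prod_encode (i, _)"] by (simp add: A'_def)
      ultimately show ?thesis using t by (auto simp: G)
    qed
    then show "w \<in> (\<Inter>i. G i)" by (simp add: wt)
  qed
  ultimately show ?thesis by (intro analytic_overI[of A' M F']) auto
qed

lemma analytic_over_UN:
  assumes "\<And>i::nat. analytic_over M (G i)"
  shows "analytic_over M (\<Union>i. G i)"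
proof -
  from assms obtain A F where
    A: "\<And>i n k. A i n k \<in> sets M" and F: "\<And>i. closed (F i)" and
    G': "\<And>i. G i = souslin_set M (A i) (F i)"
    unfolding analytic_over_def by metis
  have G: "G i = {(t, y). t \<in> space M \<and> (\<exists>\<sigma>. (y, \<sigma>) \<in> F i \<and> (\<forall>n. t \<in> A i n (\<sigma> n)))}" for i
    using G' by (simp add: souslin_set_def)
  define fs where "fs m = fst (prod_decode m)" for m
  define sn where "sn m = snd (prod_decode m)" for m
  define A' where "A' n m = A (fs m) n (sn m)" for n m
  \<comment> \<open>Every entry of the code carries the index of the set that is met; the branches lie in
     disjoint open pieces, so their union is closed.\<close>
  define F' where "F' = (\<Inter>i. {(y, \<sigma>). fs (\<sigma> 0) \<noteq> i} \<union> {(y, \<sigma>). (y, \<lambda>n. sn (\<sigma> n)) \<in> F i}) \<inter>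
     {(y, \<sigma>). \<forall>n. fs (\<sigma> n) = fs (\<sigma> 0)}"
  have "closed {(y::'b, \<sigma>::nat \<Rightarrow> nat). \<forall>n. fs (\<sigma> n) = fs (\<sigma> 0)}"
  proof -
    have "closed (\<Inter>n. \<Inter>i. {(y::'b, \<sigma>::nat\<Rightarrow>nat). fs (\<sigma> 0) \<noteq> i} \<union> {(y, \<sigma>). fs (\<sigma> n) = i})"
      by (intro closed_INT ballI closed_Un closed_coordinate)
    moreover have "(\<Inter>n. \<Inter>i. {(y::'b, \<sigma>::nat\<Rightarrow>nat). fs (\<sigma> 0) \<noteq> i} \<union> {(y, \<sigma>). fs (\<sigma> n) = i})
        = {(y, \<sigma>). \<forall>n. fs (\<sigma> n) = fs (\<sigma> 0)}"
      by auto
    ultimately show ?thesis by simp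
  qed
  then have "closed F'"
    unfolding F'_def
    using closed_vimage_reindex[of _ sn "\<lambda>n. n"] F
    by (intro closed_INT closed_Int ballI closed_Un closed_coordinate) auto
  moreover have "\<And>n k. A' n k \<in> sets M"
    using A by (simp add: A'_def)
  moreover have "(\<Union>i. G i) = {(t, y). t \<in> space M \<and> (\<exists>\<sigma>. (y, \<sigma>) \<in> F' \<and> (\<forall>n. t \<in> A' n (\<sigma> n)))}"
  proof (intro set_eqI iffI)
    fix w assume "w \<in> (\<Union>i. G i)"
    then obtain i t y s where wt: "w = (t, y)" and t: "t \<in> space M" and
      s: "(y, s) \<in> F i" "\<forall>n. t \<in> A i n (s n)"
      by (auto simp: G)
    define \<sigma> where "\<sigma> n = prod_encode (i, s n)" for n
    have "(y, \<sigma>) \<in> F'" "\<forall>n. t \<in> A' n (\<sigma> n)"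
      using s by (simp_all add: F'_def A'_def \<sigma>_def fs_def sn_def)
    then show "w \<in> {(t, y). t \<in> space M \<and> (\<exists>\<sigma>. (y, \<sigma>) \<in> F' \<and> (\<forall>n. t \<in> A' n (\<sigma> n)))}"
      using t wt by auto
  next
    fix w assume "w \<in> {(t, y). t \<in> space M \<and> (\<exists>\<sigma>. (y, \<sigma>) \<in> F' \<and> (\<forall>n. t \<in> A' n (\<sigma> n)))}"
    then obtain t y \<sigma> where wt: "w = (t, y)" and t: "t \<in> space M" and
      s: "(y, \<sigma>) \<in> F'" "\<forall>n. t \<in> A' n (\<sigma> n)"
      by auto
    have "(y, \<lambda>n. sn (\<sigma> n)) \<in> F (fs (\<sigma> 0))"
      using s(1) by (auto simp: F'_def)
    moreover have "\<forall>n. t \<in> A (fs (\<sigma> 0)) n (sn (\<sigma> n))"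
    proof
      fix n
      have "fs (\<sigma> n) = fs (\<sigma> 0)" using s(1) by (simp add: F'_def)
      then show "t \<in> A (fs (\<sigma> 0)) n (sn (\<sigma> n))"
        using s(2) unfolding A'_def by metis
    qed
    ultimately have "(t, y) \<in> G (fs (\<sigma> 0))"
      using t by (auto simp: G)
    then show "w \<in> (\<Union>i. G i)" using wt by blast
  qed
  ultimately show ?thesis by (intro analytic_overI[of A' M F']) auto
qed

lemma analytic_over_Int:
  assumes "analytic_over M G" "analytic_over M H"
  shows "analytic_over M (G \<inter> H)"
proof -
  have "analytic_over M (\<Inter>i::nat. if i = 0 then G else H)"
    by (rule analytic_over_INT) (use assms in auto)
  moreover have "(\<Inter>i::nat. if i = 0 then G else H) = G \<inter> H"
    by (auto split: if_splits)
  ultimately show ?thesis by simp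
qed

lemma analytic_over_Un:
  assumes "analytic_over M G" "analytic_over M H"
  shows "analytic_over M (G \<union> H)"
proof -
  have "analytic_over M (\<Union>i::nat. if i = 0 then G else H)"
    by (rule analytic_over_UN) (use assms in auto)
  moreover have "(\<Union>i::nat. if i = 0 then G else H) = G \<union> H"
    by (auto split: if_splits)
  ultimately show ?thesis by simp
qed

lemma analytic_over_Times_open:
  fixes U :: "'y::metric_space set"
  assumes "A \<in> sets M" "open U"
  shows "analytic_over M (A \<times> U)"
proof (cases "U = UNIV")
  case True
  then show ?thesis using assms(1) analytic_over_Times[of A M UNIV] by simp
next
  case False
  define C where "C n = {y. 1 / real (Suc n) \<le> infdist y (- U)}" for n
  have "U = (\<Union>n. C n)"
  proof (intro set_eqI iffI)
    fix y assume "y \<in> U"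
    then have "infdist y (- U) > 0"
      using in_closed_iff_infdist_zero[of "- U" y] assms(2) False infdist_nonneg[of y "- U"]
      by (auto simp: closed_def less_le)
    then obtain n where "1 / real (Suc n) < infdist y (- U)"
      using nat_approx_posE by blast
    then show "y \<in> (\<Union>n. C n)"
      by (auto simp: C_def intro!: less_imp_le exI[of _ n])
  next
    fix y assume "y \<in> (\<Union>n. C n)"
    then obtain n where "1 / real (Suc n) \<le> infdist y (- U)"
      by (auto simp: C_def)
    moreover have "0 < 1 / real (Suc n)" by simp
    ultimately have "infdist y (- U) \<noteq> 0" by linarith
    then show "y \<in> U" by (metis ComplI infdist_zero)
  qed
  then have eq: "A \<times> U = (\<Union>n. A \<times> C n)" by auto
  have "closed (C n)" for n
    unfolding C_def by (intro closed_Collect_le continuous_intros)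
  then show ?thesis
    unfolding eq by (intro analytic_over_UN analytic_over_Times assms(1))
qed

text \<open>
The analytic sets are closed under countable unions and intersections but not under complements. So the
induction over the \<open>\<sigma>\<close>-algebra is carried out for the sets whose complement is analytic as well, and the
rectangles with open and closed second factor provide its start.
\<close>

lemma analytic_over_sets_pair:
  fixes G :: "('t \<times> 'y::metric_space) set"
  assumes "G \<in> sets (M \<Otimes>\<^sub>M borel)"
  shows "analytic_over M G"
proof -
  \<comment> \<open>The sets that are analytic together with their complements form a \<open>\<sigma>\<close>-algebra.\<close>
  define bi where "bi G \<longleftrightarrow> analytic_over M G \<and> analytic_over M (space M \<times> (UNIV :: 'y set) - G)" for G
  have bi_compl: "bi (space M \<times> UNIV - G)" if "bi G" for G
  proof -
    have "space M \<times> UNIV - (space M \<times> UNIV - G) = G"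
      using that analytic_over_subset unfolding bi_def by blast
    then show ?thesis using that unfolding bi_def by simp
  qed
  have bi_UN: "bi (\<Union>i. H i)" if "\<And>i::nat. bi (H i)" for H
  proof -
    have "space M \<times> UNIV - (\<Union>i. H i) = (\<Inter>i. space M \<times> UNIV - H i)" by auto
    then show ?thesis
      using that analytic_over_UN[of M H] analytic_over_INT[of M "\<lambda>i. space M \<times> UNIV - H i"]
      unfolding bi_def by simp
  qed
  have bi_empty: "bi {}"
    unfolding bi_def
    using analytic_over_Times[of "{}" M UNIV] analytic_over_Times[of "space M" M UNIV] by auto
  have bi_right: "bi (space M \<times> B)" if "B \<in> sets borel" for B
    using that unfolding sets_borel
  proof (induction rule: sigma_sets.induct)
    case (Basic U)
    have "space M \<times> UNIV - space M \<times> U = space M \<times> (- U)" by auto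
    moreover have "analytic_over M (space M \<times> U)" "analytic_over M (space M \<times> (- U))"
      using Basic by (auto intro!: analytic_over_Times_open analytic_over_Times[of _ M "- U"])
    ultimately show ?case unfolding bi_def by simp
  next
    case Empty
    then show ?case using bi_empty by simp
  next
    case (Compl B)
    have "space M \<times> (UNIV - B) = space M \<times> UNIV - space M \<times> B" by auto
    then show ?case using bi_compl[OF Compl.IH] by simp
  next
    case (Union B)
    have "space M \<times> (\<Union>i. B i) = (\<Union>i. space M \<times> B i)" by auto
    then show ?case using bi_UN[of "\<lambda>i. space M \<times> B i"] Union.IH by simp
  qed
  have "bi G"
    using assms unfolding sets_pair_measure
  proof (induction rule: sigma_sets.induct)
    case (Basic R)
    then obtain A B where R: "R = A \<times> B" and A: "A \<in> sets M" and B: "B \<in> sets (borel :: 'y measure)"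
      by auto
    have A': "A \<subseteq> space M" using A sets.sets_into_space by blast
    have 1: "R = (A \<times> UNIV) \<inter> (space M \<times> B)" using R A' by auto
    have 2: "space M \<times> UNIV - R = ((space M - A) \<times> UNIV) \<union> (space M \<times> UNIV - space M \<times> B)"
      using R A' by auto
    have "analytic_over M (A \<times> (UNIV::'y set))" "analytic_over M ((space M - A) \<times> (UNIV::'y set))"
      using A by (auto intro!: analytic_over_Times)
    moreover have "analytic_over M (space M \<times> B)" "analytic_over M (space M \<times> UNIV - space M \<times> B)"
      using bi_right[OF B] unfolding bi_def by auto
    ultimately show ?case
      unfolding bi_def 2 unfolding 1 by (simp add: analytic_over_Int analytic_over_Un)
  next
    case Empty
    then show ?case using bi_empty by simp
  next
    case (Compl B)
    then show ?case using bi_compl by (simp add: space_borel)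
  next
    case (Union B)
    then show ?case using bi_UN by blast
  qed
  then show ?thesis unfolding bi_def by simp
qed

text \<open>
A measurable hull and the union of measurable subsets of almost full outer measure enclose \<open>S\<close> between two
measurable sets of equal measure, which suffices for a complete measure.
\<close>

lemma (in finite_measure) sets_if_inner_approximation:
  assumes "complete_measure M" and S: "S \<subseteq> space M"
    and inner: "\<And>c. c < outer_measure_of M S \<Longrightarrow> \<exists>D\<in>sets M. D \<subseteq> S \<and> c \<le> emeasure M D"
  shows "S \<in> sets M"
proof -
  interpret complete_measure M by fact
  obtain B where B: "B \<in> sets M" "S \<subseteq> B" "outer_measure_of M S = emeasure M B"
    using outer_measure_of_attain[OF S] by blast
  have fin: "emeasure M B < \<infinity>" by (simp add: emeasure_eq_measure)
  have "\<exists>D\<in>sets M. D \<subseteq> S \<and> measure M B - 1 / real (Suc n) \<le> measure M D" for n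
  proof (cases "measure M B - 1 / real (Suc n) < 0")
    case True
    then show ?thesis by (intro bexI[of _ "{}"]) auto
  next
    case False
    have "ennreal (measure M B - 1 / real (Suc n)) < ennreal (measure M B)"
    proof (rule ennreal_lessI)
      have "0 < 1 / real (Suc n)" by simp
      then show "0 < measure M B" "measure M B - 1 / real (Suc n) < measure M B"
        using False by linarith+
    qed
    then have "ennreal (measure M B - 1 / real (Suc n)) < outer_measure_of M S"
      unfolding B(3) emeasure_eq_measure .
    from inner[OF this] obtain D where "D \<in> sets M" "D \<subseteq> S"
      "ennreal (measure M B - 1 / real (Suc n)) \<le> ennreal (measure M D)"
      unfolding emeasure_eq_measure by blast
    then show ?thesis by (intro bexI[of _ D]) (simp_all add: ennreal_le_iff)
  qed
  then have "\<forall>n. \<exists>D. D \<in> sets M \<and> D \<subseteq> S \<and> measure M B - 1 / real (Suc n) \<le> measure M D"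
    by blast
  from choice[OF this] obtain D where D: "\<And>n. D n \<in> sets M" "\<And>n. D n \<subseteq> S"
    "\<And>n. measure M B - 1 / real (Suc n) \<le> measure M (D n)"
    by blast
  have "measure M B \<le> measure M (\<Union>n. D n)"
  proof (rule field_le_epsilon)
    fix e :: real assume "0 < e"
    then obtain n where "1 / real (Suc n) < e" using nat_approx_posE by blast
    moreover have "measure M (D n) \<le> measure M (\<Union>n. D n)"
      using D(1) by (intro finite_measure_mono) auto
    ultimately show "measure M B \<le> measure M (\<Union>n. D n) + e" using D(3)[of n] by linarith
  qed
  moreover have "measure M (\<Union>n. D n) \<le> measure M B"
    using D(2) B(1,2) by (intro finite_measure_mono) blast+
  ultimately have eq: "emeasure M (\<Union>n. D n) = emeasure M B"
    by (simp add: emeasure_eq_measure)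
  show "S \<in> sets M"
  proof (rule complete_sets_sandwich[of "\<Union>n. D n" B])
    show "(\<Union>n. D n) \<in> sets M" using D(1) by blast
    show "(\<Union>n. D n) \<subseteq> S" using D(2) by blast
  qed (use B eq fin in simp_all)
qed

text \<open>
By inner approximation it is enough to find, for every \<open>c\<close> below the outer measure of the projection, a
measurable subset of measure at least \<open>c\<close>. Outer measure is continuous along increasing sequences, so bounds
\<open>\<tau> 0\<close>, \<open>\<tau> 1\<close>, ... for the size of the point \<open>y\<close> and the entries of its code can be chosen one after the
other such that the points of \<open>T\<close> that satisfy the first \<open>n\<close> of them still have outer measure above \<open>c\<close>
(Choquet's argument). If moreover only finitely many of the conditions \<open>t \<in> A i (\<sigma> i)\<close> are kept, a measurable
set \<open>D n\<close> results, since only finite pieces of codes matter. The intersection of the \<open>D n\<close> has measure at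
least \<open>c\<close>, and it lies in the projection because bounded points and codes form a compact set.
\<close>

theorem (in finite_measure) analytic_projection_measurable:
  fixes G :: "('a \<times> 'y::heine_borel) set"
  assumes "complete_measure M" and "analytic_over M G"
  shows "fst ` G \<in> sets M"
proof -
  interpret complete_measure M by fact
  obtain A F where A: "\<And>n k. A n k \<in> sets M" and F: "closed F" and G: "G = souslin_set M A F"
    using assms(2) unfolding analytic_over_def by blast
  fix a :: 'y
  \<comment> \<open>The coordinates that have to be bounded: the size of the point, then the entries of the code.\<close>
  define b :: "'y \<Rightarrow> (nat \<Rightarrow> nat) \<Rightarrow> nat \<Rightarrow> nat"
    where "b y \<sigma> i = (case i of 0 \<Rightarrow> nat \<lceil>dist a y\<rceil> | Suc j \<Rightarrow> \<sigma> j)" for y \<sigma> i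
  define W where "W \<tau> n = {t \<in> space M. \<exists>y \<sigma>. (y, \<sigma>) \<in> F \<and> (\<forall>i<n. b y \<sigma> i \<le> \<tau> i) \<and> (\<forall>i. t \<in> A i (\<sigma> i))}"
    for \<tau> :: "nat \<Rightarrow> nat" and n
  have W_I: "t \<in> W \<tau> n"
    if "t \<in> space M" "(y, \<sigma>) \<in> F" "\<And>i. i < n \<Longrightarrow> b y \<sigma> i \<le> \<tau> i" "\<And>i. t \<in> A i (\<sigma> i)"
    for t \<tau> n y \<sigma>
    using that unfolding W_def by blast
  have W_E: "\<exists>y \<sigma>. (y, \<sigma>) \<in> F \<and> (\<forall>i<n. b y \<sigma> i \<le> \<tau> i) \<and> (\<forall>i. t \<in> A i (\<sigma> i))"
    if "t \<in> W \<tau> n" for t \<tau> n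
    using that unfolding W_def by blast
  have W_mono: "W \<tau> n \<subseteq> W \<tau>' n'"
    if "n' \<le> n" "\<And>i. i < n' \<Longrightarrow> \<tau> i \<le> \<tau>' i" for \<tau> \<tau>' n n'
  proof
    fix t assume t: "t \<in> W \<tau> n"
    from W_E[OF t] obtain y \<sigma> where y: "(y, \<sigma>) \<in> F" "\<And>i. i < n \<Longrightarrow> b y \<sigma> i \<le> \<tau> i" "\<And>i. t \<in> A i (\<sigma> i)"
      by blast
    have "b y \<sigma> i \<le> \<tau>' i" if "i < n'" for i
      using y(2)[of i] \<open>n' \<le> n\<close> that \<open>\<And>i. i < n' \<Longrightarrow> \<tau> i \<le> \<tau>' i\<close>[of i] by linarith
    then show "t \<in> W \<tau>' n'"
      using t y by (intro W_I[of t y \<sigma>]) (simp_all add: W_def)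
  qed
  define S where "S = fst ` G"
  have S: "S = W \<tau> 0" for \<tau>
    unfolding S_def G souslin_set_def W_def by (auto simp: image_iff; blast)
  have W_space: "W \<tau> n \<subseteq> space M" for \<tau> n by (auto simp: W_def)
  have W_cong: "W \<tau> n = W \<tau>' n" if "\<And>i. i < n \<Longrightarrow> \<tau> i = \<tau>' i" for \<tau> \<tau>' n
    using that by (intro equalityI W_mono) simp_all
  have W_UN: "W \<tau> n = (\<Union>k. W (\<tau>(n := k)) (Suc n))" for \<tau> n
  proof (intro set_eqI iffI)
    fix t assume "t \<in> W \<tau> n"
    then obtain y \<sigma> where "t \<in> space M" "(y, \<sigma>) \<in> F" "\<forall>i<n. b y \<sigma> i \<le> \<tau> i" "\<forall>i. t \<in> A i (\<sigma> i)"
      unfolding W_def by blast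
    then have "t \<in> W (\<tau>(n := b y \<sigma> n)) (Suc n)"
      by (intro W_I[of t y \<sigma>]) (auto simp: less_Suc_eq)
    then show "t \<in> (\<Union>k. W (\<tau>(n := k)) (Suc n))" by blast
  next
    fix t assume "t \<in> (\<Union>k. W (\<tau>(n := k)) (Suc n))"
    then obtain k where "t \<in> W (\<tau>(n := k)) (Suc n)" by blast
    moreover have "W (\<tau>(n := k)) (Suc n) \<subseteq> W \<tau> n" by (rule W_mono) simp_all
    ultimately show "t \<in> W \<tau> n" by blast
  qed
  have inner: "\<exists>D\<in>sets M. D \<subseteq> S \<and> c \<le> emeasure M D" if c: "c < outer_measure_of M S" for c
  proof -
    have "\<exists>\<tau>s. \<forall>n. c < outer_measure_of M (W (\<tau>s n) n) \<and> (\<exists>k. \<tau>s (Suc n) = (\<tau>s n)(n := k))"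
    proof (rule dependent_nat_choice)
      show "\<exists>\<tau>. c < outer_measure_of M (W \<tau> 0)" using c S by auto
    next
      fix \<tau> n assume "c < outer_measure_of M (W \<tau> n)"
      also have "outer_measure_of M (W \<tau> n) = (SUP k. outer_measure_of M (W (\<tau>(n := k)) (Suc n)))"
        unfolding W_UN[of \<tau> n]
      proof (rule SUP_outer_measure_of_incseq[symmetric])
        show "incseq (\<lambda>k. W (\<tau>(n := k)) (Suc n))"
          by (intro incseq_SucI W_mono) simp_all
      qed (rule W_space)
      finally show "\<exists>\<tau>'. c < outer_measure_of M (W \<tau>' (Suc n)) \<and> (\<exists>k. \<tau>' = \<tau>(n := k))"
        by (auto simp: less_SUP_iff)
    qed
    then obtain \<tau>s where \<tau>s: "\<And>n. c < outer_measure_of M (W (\<tau>s n) n)"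
      and upd: "\<And>n. \<exists>k. \<tau>s (Suc n) = (\<tau>s n)(n := k)" by blast
    define \<tau> where "\<tau> i = \<tau>s (Suc i) i" for i
    have agree: "\<tau>s n i = \<tau> i" if "i < n" for i n
      using that
    proof (induction n)
      case (Suc n)
      obtain k where "\<tau>s (Suc n) = (\<tau>s n)(n := k)" using upd by blast
      then show ?case using Suc by (cases "i = n") (auto simp: \<tau>_def)
    qed simp
    have c_W: "c < outer_measure_of M (W \<tau> n)" for n
      using \<tau>s[of n] W_cong[of n "\<tau>s n" \<tau>] agree by auto
    \<comment> \<open>The bounds up to index \<open>n\<close> control \<open>y\<close> and the first \<open>n\<close> entries of the code.\<close>
    define D where "D n = {t \<in> space M. \<exists>y \<sigma>. (y, \<sigma>) \<in> F \<and> (\<forall>i<Suc n. b y \<sigma> i \<le> \<tau> i) \<and> (\<forall>i<n. t \<in> A i (\<sigma> i))}" for n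
    have D_sets: "D n \<in> sets M" for n
    proof -
      define L where "L = {w. length w = n \<and> (\<exists>y \<sigma>. (y, \<sigma>) \<in> F \<and> (\<forall>i<Suc n. b y \<sigma> i \<le> \<tau> i) \<and> (\<forall>i<n. \<sigma> i = w ! i))}"
      have eq: "D n = (\<Union>w\<in>L. {t \<in> space M. \<forall>i<n. t \<in> A i (w ! i)})"
      proof (intro set_eqI iffI)
        fix t assume "t \<in> D n"
        then obtain y \<sigma> where *: "t \<in> space M" "(y, \<sigma>) \<in> F" "\<forall>i<Suc n. b y \<sigma> i \<le> \<tau> i" "\<forall>i<n. t \<in> A i (\<sigma> i)"
          unfolding D_def by blast
        have "map \<sigma> [0..<n] \<in> L"
          unfolding L_def using *(2,3) by (auto intro!: exI[of _ y] exI[of _ \<sigma>])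
        then show "t \<in> (\<Union>w\<in>L. {t \<in> space M. \<forall>i<n. t \<in> A i (w ! i)})"
          using * by (intro UN_I[of "map \<sigma> [0..<n]"]) auto
      next
        fix t assume "t \<in> (\<Union>w\<in>L. {t \<in> space M. \<forall>i<n. t \<in> A i (w ! i)})"
        then obtain w where w: "w \<in> L" "t \<in> space M" "\<forall>i<n. t \<in> A i (w ! i)" by blast
        then obtain y \<sigma> where "(y, \<sigma>) \<in> F" "\<forall>i<Suc n. b y \<sigma> i \<le> \<tau> i" "\<forall>i<n. \<sigma> i = w ! i"
          unfolding L_def by blast
        then show "t \<in> D n"
          unfolding D_def using w(2,3) by (auto intro!: exI[of _ y] exI[of _ \<sigma>])
      qed
      have "{t \<in> space M. \<forall>i<n. t \<in> A i (w ! i)} \<in> sets M" for w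
      proof -
        have "{t \<in> space M. t \<in> A i k} = A i k" for i k
          using sets.sets_into_space[OF A[of i k]] by blast
        then have "{t \<in> space M. t \<in> A i k} \<in> sets M" for i k
          using A by simp
        then have "{t \<in> space M. \<forall>i\<in>{..<n}. t \<in> A i (w ! i)} \<in> sets M"
          by (intro sets.sets_Collect_finite_All finite_lessThan)
        then show ?thesis by (simp only: lessThan_iff Ball_def)
      qed
      moreover have "countable L"
        by (rule countable_subset[OF subset_UNIV countableI_type])
      ultimately show ?thesis
        unfolding eq by (rule sets.countable_UN''[rotated])
    qed
    have D_mono: "decseq D"
    proof (rule decseq_SucI, rule subsetI)
      fix n t assume "t \<in> D (Suc n)"
      then obtain y \<sigma> where "t \<in> space M" "(y, \<sigma>) \<in> F" "\<forall>i<Suc (Suc n). b y \<sigma> i \<le> \<tau> i"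
        "\<forall>i<Suc n. t \<in> A i (\<sigma> i)"
        unfolding D_def by blast
      then show "t \<in> D n" unfolding D_def by (blast intro: less_SucI)
    qed
    have W_D: "W \<tau> (Suc n) \<subseteq> D n" for n
      unfolding W_def D_def by blast
    have c_D: "c \<le> emeasure M (D n)" for n
      using c_W[of "Suc n"] outer_measure_of_mono[OF W_D[of n], of M] D_sets[of n] by simp
    have "c \<le> (INF n. emeasure M (D n))"
      using c_D by (intro INF_greatest)
    also have "\<dots> = emeasure M (\<Inter>n. D n)"
      using D_sets D_mono by (intro INF_emeasure_decseq) auto
    finally have "c \<le> emeasure M (\<Inter>n. D n)" .
    moreover have "(\<Inter>n. D n) \<subseteq> S"
    proof
      fix t assume t: "t \<in> (\<Inter>n. D n)"
      then have "\<forall>n. \<exists>y \<sigma>. (y, \<sigma>) \<in> F \<and> (\<forall>i<Suc n. b y \<sigma> i \<le> \<tau> i) \<and> (\<forall>i<n. t \<in> A i (\<sigma> i))"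
        unfolding D_def by blast
      then obtain y \<sigma> where yF: "\<And>n. (y n, \<sigma> n) \<in> F" and bd: "\<And>n i. i < Suc n \<Longrightarrow> b (y n) (\<sigma> n) i \<le> \<tau> i"
        and tA: "\<And>n i. i < n \<Longrightarrow> t \<in> A i (\<sigma> n i)" by metis
      have "dist a (y n) \<le> real (\<tau> 0)" for n
      proof -
        have "nat \<lceil>dist a (y n)\<rceil> \<le> \<tau> 0" using bd[of 0 n] by (simp add: b_def)
        then show ?thesis by linarith
      qed
      then have "\<forall>n. y n \<in> cball a (\<tau> 0)" by simp
      then obtain y' r where r: "strict_mono r" and y': "(y \<circ> r) \<longlonglongrightarrow> y'"
        using compact_cball[of a "\<tau> 0"] unfolding compact_def by metis
      define x where "x n i = (if i < r n then \<sigma> (r n) i else 0)" for n i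
      have "\<exists>q :: nat \<Rightarrow> nat. strict_mono q \<and> (\<forall>i. \<exists>l\<in>{..real (\<tau> (Suc i))} \<inter> \<nat>. (\<lambda>n. real (x (q n) i)) \<longlonglongrightarrow> l)"
      proof (rule diagonal_convergent_subsequence)
        fix i
        have "{..real (\<tau> (Suc i))} \<inter> \<nat> = real ` {..\<tau> (Suc i)}" by (auto simp: Nats_def)
        then show "compact ({..real (\<tau> (Suc i))} \<inter> \<nat>)" by (simp add: finite_imp_compact)
      next
        fix n i show "real (x n i) \<in> {..real (\<tau> (Suc i))} \<inter> \<nat>"
          using bd[of "Suc i" "r n"] by (auto simp: x_def b_def)
      qed
      then obtain q where q: "strict_mono q"
        and "\<forall>i. \<exists>l\<in>{..real (\<tau> (Suc i))} \<inter> \<nat>. (\<lambda>n. real (x (q n) i)) \<longlonglongrightarrow> l" by blast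
      then have "\<forall>i. \<exists>k. (\<lambda>n. real (x (q n) i)) \<longlonglongrightarrow> real k"
        by (metis IntD2 Nats_cases)
      then obtain s where s: "\<And>i. (\<lambda>n. real (x (q n) i)) \<longlonglongrightarrow> real (s i)" by metis
      have ev: "\<forall>\<^sub>F n in sequentially. i < r (q n) \<and> \<sigma> (r (q n)) i = s i" for i
      proof -
        have "\<forall>\<^sub>F n in sequentially. dist (real (x (q n) i)) (real (s i)) < 1"
          using s[of i] by (rule tendstoD) simp
        moreover have "\<forall>\<^sub>F n in sequentially. i < r (q n)"
        proof (rule eventually_sequentiallyI)
          fix n assume "Suc i \<le> n"
          moreover have "n \<le> r (q n)"
            using seq_suble[OF q, of n] seq_suble[OF r, of "q n"] by linarith
          ultimately show "i < r (q n)" by linarith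
        qed
        ultimately show ?thesis
          by eventually_elim (auto simp: x_def dist_real_def)
      qed
      have "(\<lambda>n. \<sigma> (r (q n))) \<longlonglongrightarrow> s"
      proof (rule tendsto_fun_coordinatewise)
        fix i show "(\<lambda>n. \<sigma> (r (q n)) i) \<longlonglongrightarrow> s i"
          by (rule tendsto_eventually, rule eventually_mono[OF ev[of i]]) simp
      qed
      moreover have "(\<lambda>n. y (r (q n))) \<longlonglongrightarrow> y'"
        using LIMSEQ_subseq_LIMSEQ[OF y' q] by (simp add: o_def)
      ultimately have lim: "(\<lambda>n. (y (r (q n)), \<sigma> (r (q n)))) \<longlonglongrightarrow> (y', s)"
        by (intro tendsto_Pair)
      have "(y', s) \<in> F"
        by (rule closed_sequentially[OF F _ lim]) (rule yF)
      moreover have "t \<in> A i (s i)" for i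
      proof -
        obtain n where n: "i < r (q n)" "\<sigma> (r (q n)) i = s i"
          using eventually_happens'[OF sequentially_bot ev[of i]] by blast
        show ?thesis using tA[OF n(1)] n(2) by simp
      qed
      moreover have "t \<in> space M" using t unfolding D_def by blast
      ultimately have "(t, y') \<in> G"
        unfolding G souslin_set_def by blast
      then show "t \<in> S" unfolding S_def by (rule image_eqI[rotated]) simp
    qed
    moreover have "(\<Inter>n. D n) \<in> sets M"
      using D_sets by (intro sets.countable_INT') auto
    ultimately show ?thesis by blast
  qed
  have "S \<subseteq> space M" unfolding S[of "\<lambda>_. 0"] by (rule W_space)
  then have "S \<in> sets M"
    by (rule sets_if_inner_approximation[OF assms(1)]) (rule inner)
  then show ?thesis by (simp add: S_def)
qed

section \<open>Measurable cluster selections\<close>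

definition cluster_point :: "(nat \<Rightarrow> 'a::topological_space) \<Rightarrow> 'a \<Rightarrow> bool" where
  "cluster_point s l \<longleftrightarrow> (\<exists>r. strict_mono r \<and> (s \<circ> r) \<longlonglongrightarrow> l)"

lemma cluster_point_subseq:
  assumes "strict_mono r" "cluster_point (\<lambda>k. s (r k)) l"
  shows "cluster_point s l"
proof -
  obtain q where "strict_mono q" "((\<lambda>k. s (r k)) \<circ> q) \<longlonglongrightarrow> l"
    using assms(2) unfolding cluster_point_def by blast
  then have "strict_mono (r \<circ> q)" "(s \<circ> (r \<circ> q)) \<longlonglongrightarrow> l"
    using strict_mono_o[OF assms(1)] by (simp_all only: o_def)
  then show ?thesis unfolding cluster_point_def by blast
qed

lemma cluster_point_in_closed:
  assumes "cluster_point s l" "closed C" "\<And>k. s k \<in> C"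
  shows "l \<in> C"
proof -
  obtain r where r: "(s \<circ> r) \<longlonglongrightarrow> l"
    using assms(1) unfolding cluster_point_def by blast
  show ?thesis
    by (rule closed_sequentially[OF assms(2) _ r]) (simp add: assms(3))
qed

text \<open>
The two halves of the characterisation of the upper limit, as a real number instead of an extended one.
\<close>

lemma limsup_of_bounded_real:
  fixes s :: "nat \<Rightarrow> real"
  assumes "bounded (range s)"
  defines "L \<equiv> real_of_ereal (limsup (\<lambda>k. ereal (s k)))"
  shows "e > 0 \<Longrightarrow> \<forall>\<^sub>F k in sequentially. s k < L + e"
    and "e > 0 \<Longrightarrow> \<exists>k>n. s k > L - e"
proof -
  obtain B where B: "\<And>k. \<bar>s k\<bar> \<le> B"
    using assms(1) by (auto simp: bounded_iff)
  have "limsup (\<lambda>k. ereal (s k)) \<le> ereal B"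
    using B by (intro Limsup_bounded) (simp add: abs_le_iff)
  moreover have "ereal (- B) \<le> limsup (\<lambda>k. ereal (s k))"
  proof (rule le_Limsup)
    have "- B \<le> s k" for k using B[of k] by linarith
    then show "\<forall>\<^sub>F x in sequentially. ereal (- B) \<le> ereal (s x)" by simp
  qed simp
  ultimately have "\<bar>limsup (\<lambda>k. ereal (s k))\<bar> \<noteq> \<infinity>" by auto
  then have L: "limsup (\<lambda>k. ereal (s k)) = ereal L"
    unfolding L_def by (simp add: ereal_real)
  show "\<forall>\<^sub>F k in sequentially. s k < L + e" if "e > 0"
  proof -
    have "limsup (\<lambda>k. ereal (s k)) < ereal (L + e)" using L that by simp
    from Limsup_lessD[OF this] show ?thesis by simp
  qed
  show "\<exists>k>n. s k > L - e" if "e > 0"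
  proof (rule ccontr)
    assume "\<not> (\<exists>k>n. s k > L - e)"
    then have "s k \<le> L - e" if "Suc n \<le> k" for k
      using that by (meson Suc_le_lessD not_le)
    then have "\<forall>\<^sub>F k in sequentially. ereal (s k) \<le> ereal (L - e)"
      by (intro eventually_sequentiallyI[of "Suc n"]) simp
    then have "limsup (\<lambda>k. ereal (s k)) \<le> ereal (L - e)" by (rule Limsup_bounded)
    then show False using L that by simp
  qed
qed

text \<open>
The upper limit of \<open>q \<bullet> f k t\<close> is a measurable function of \<open>t\<close>, hence so is the least index beyond the
previous one at which the sequence exceeds it up to \<open>1 / Suc j\<close>. The indices depend on \<open>t\<close>, but as they take
countably many values, \<open>f\<close> evaluated along them remains measurable.
\<close>

lemma measurable_limsup_subsequence:
  fixes f :: "nat \<Rightarrow> 't \<Rightarrow> 'a::euclidean_space"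
  assumes [measurable]: "\<And>k. f k \<in> borel_measurable M"
    and bdd: "\<And>t. t \<in> space M \<Longrightarrow> bounded (range (\<lambda>k. f k t))"
  shows "\<exists>\<kappa> :: nat \<Rightarrow> 't \<Rightarrow> nat. (\<forall>j. \<kappa> j \<in> measurable M (count_space UNIV)) \<and>
    (\<forall>t\<in>space M. strict_mono (\<lambda>j. \<kappa> j t) \<and>
       (\<exists>L. (\<lambda>j. q \<bullet> f (\<kappa> j t) t) \<longlonglongrightarrow> L \<and> (\<forall>e>0. \<forall>\<^sub>F k in sequentially. q \<bullet> f k t < L + e)))"
proof -
  define g where "g t = real_of_ereal (limsup (\<lambda>k. ereal (q \<bullet> f k t)))" for t
  have [measurable]: "g \<in> borel_measurable M" unfolding g_def by measurable
  have sbd: "bounded (range (\<lambda>k. q \<bullet> f k t))" if "t \<in> space M" for t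
    using bounded_linear_image[OF bdd[OF that] bounded_linear_inner_right[of q]]
    by (simp add: image_image)
  have upper: "\<forall>\<^sub>F k in sequentially. q \<bullet> f k t < g t + e" if "t \<in> space M" "e > 0" for t e
    unfolding g_def by (rule limsup_of_bounded_real(1)[OF sbd[OF that(1)] that(2)])
  have lower: "\<exists>k>n. q \<bullet> f k t > g t - e" if "t \<in> space M" "e > 0" for t e n
    unfolding g_def by (rule limsup_of_bounded_real(2)[OF sbd[OF that(1)] that(2)])
  define \<kappa> :: "nat \<Rightarrow> 't \<Rightarrow> nat" where
    "\<kappa> = rec_nat (\<lambda>t. LEAST k. q \<bullet> f k t > g t - 1)
      (\<lambda>j \<kappa>j t. LEAST k. k > \<kappa>j t \<and> q \<bullet> f k t > g t - 1 / real (Suc (Suc j)))"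
  have \<kappa>0: "\<kappa> 0 = (\<lambda>t. LEAST k. q \<bullet> f k t > g t - 1)"
    and \<kappa>Suc: "\<kappa> (Suc j) = (\<lambda>t. LEAST k. k > \<kappa> j t \<and> q \<bullet> f k t > g t - 1 / real (Suc (Suc j)))" for j
    by (simp_all add: \<kappa>_def)
  have meas: "\<kappa> j \<in> measurable M (count_space UNIV)" for j
  proof (induction j)
    case 0
    show ?case unfolding \<kappa>0 by measurable
  next
    case (Suc j)
    note Suc.IH[measurable]
    show ?case unfolding \<kappa>Suc by measurable
  qed
  have step: "\<kappa> j t < \<kappa> (Suc j) t \<and> q \<bullet> f (\<kappa> (Suc j) t) t > g t - 1 / real (Suc (Suc j))"
    if "t \<in> space M" for j t
  proof -
    have "\<exists>k. k > \<kappa> j t \<and> q \<bullet> f k t > g t - 1 / real (Suc (Suc j))"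
      by (rule lower[OF that]) simp
    from LeastI_ex[OF this] show ?thesis unfolding \<kappa>Suc .
  qed
  have "strict_mono (\<lambda>j. \<kappa> j t)" if "t \<in> space M" for t
    using step[OF that] by (simp add: strict_mono_Suc_iff)
  moreover have "(\<lambda>j. q \<bullet> f (\<kappa> j t) t) \<longlonglongrightarrow> g t" if t: "t \<in> space M" for t
  proof (rule LIMSEQ_I)
    fix e :: real assume "e > 0"
    have "\<forall>\<^sub>F k in sequentially. q \<bullet> f k t < g t + e" by (rule upper) fact+
    then obtain N where N: "\<And>k. k \<ge> N \<Longrightarrow> q \<bullet> f k t < g t + e"
      by (auto simp: eventually_sequentially)
    obtain n where n: "1 / real (Suc n) < e" using \<open>e > 0\<close> nat_approx_posE by blast
    show "\<exists>no. \<forall>j\<ge>no. norm (q \<bullet> f (\<kappa> j t) t - g t) < e"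
    proof (intro exI allI impI)
      fix j assume j: "Suc (max N n) \<le> j"
      then obtain i where i: "j = Suc i" "max N n \<le> i" by (metis Suc_le_D Suc_le_mono)
      have "strict_mono (\<lambda>j. \<kappa> j t)" using step[OF t] by (simp add: strict_mono_Suc_iff)
      then have "j \<le> \<kappa> j t" by (rule seq_suble)
      then have "q \<bullet> f (\<kappa> j t) t < g t + e" using N j by simp
      moreover have "1 / real (Suc (Suc i)) \<le> 1 / real (Suc n)"
        using i(2) by (intro divide_left_mono) auto
      then have "q \<bullet> f (\<kappa> j t) t > g t - e"
        using step[OF t, of i] n unfolding i(1) by linarith
      ultimately show "norm (q \<bullet> f (\<kappa> j t) t - g t) < e" by (simp add: abs_less_iff)
    qed
  qed
  ultimately show ?thesis using meas upper by (intro exI[of _ \<kappa>]) blast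
qed

text \<open>
One direction is made convergent at a time; later thinning does not disturb the earlier directions.
\<close>

lemma measurable_convergent_subsequence:
  fixes f :: "nat \<Rightarrow> 't \<Rightarrow> 'a::euclidean_space"
  assumes "\<And>k. f k \<in> borel_measurable M"
    and "\<And>t. t \<in> space M \<Longrightarrow> bounded (range (\<lambda>k. f k t))"
  shows "\<exists>\<kappa> :: nat \<Rightarrow> 't \<Rightarrow> nat. (\<forall>j. \<kappa> j \<in> measurable M (count_space UNIV)) \<and>
    (\<forall>t\<in>space M. strict_mono (\<lambda>j. \<kappa> j t) \<and> (\<forall>b\<in>set bs. convergent (\<lambda>j. b \<bullet> f (\<kappa> j t) t)))"
  using assms
proof (induction bs arbitrary: f)
  case Nil
  show ?case by (intro exI[of _ "\<lambda>j t. j"]) (auto simp: strict_mono_def)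
next
  case (Cons b bs)
  from measurable_limsup_subsequence[OF Cons.prems, of b]
  obtain \<kappa> :: "nat \<Rightarrow> 't \<Rightarrow> nat" where \<kappa>[measurable]: "\<And>j. \<kappa> j \<in> measurable M (count_space UNIV)"
    and mono: "\<And>t. t \<in> space M \<Longrightarrow> strict_mono (\<lambda>j. \<kappa> j t)"
    and conv: "\<And>t. t \<in> space M \<Longrightarrow> convergent (\<lambda>j. b \<bullet> f (\<kappa> j t) t)"
    unfolding convergent_def by metis
  have meas: "(\<lambda>t. f (\<kappa> j t) t) \<in> borel_measurable M" for j
    by (rule measurable_compose_countable[OF Cons.prems(1) \<kappa>])
  have bdd: "bounded (range (\<lambda>j. f (\<kappa> j t) t))" if "t \<in> space M" for t
    by (rule bounded_subset[OF Cons.prems(2)[OF that]]) auto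
  have "\<exists>\<nu>. (\<forall>j. \<nu> j \<in> measurable M (count_space UNIV)) \<and>
    (\<forall>t\<in>space M. strict_mono (\<lambda>j. \<nu> j t) \<and> (\<forall>c\<in>set bs. convergent (\<lambda>j. c \<bullet> f (\<kappa> (\<nu> j t) t) t)))"
    by (rule Cons.IH[of "\<lambda>j t. f (\<kappa> j t) t"]) (rule meas, erule bdd)
  then obtain \<nu> :: "nat \<Rightarrow> 't \<Rightarrow> nat" where "\<forall>j. \<nu> j \<in> measurable M (count_space UNIV)"
    and *: "\<forall>t\<in>space M. strict_mono (\<lambda>j. \<nu> j t) \<and> (\<forall>c\<in>set bs. convergent (\<lambda>j. c \<bullet> f (\<kappa> (\<nu> j t) t) t))"
    by (elim exE conjE)
  then have \<nu>: "\<nu> j \<in> measurable M (count_space UNIV)" for j by blast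
  have mono': "strict_mono (\<lambda>j. \<nu> j t)" if "t \<in> space M" for t
    using * that by blast
  have conv': "convergent (\<lambda>j. c \<bullet> f (\<kappa> (\<nu> j t) t) t)" if "t \<in> space M" "c \<in> set bs" for t c
    using bspec[OF * that(1)] that(2) by blast
  show ?case
  proof (intro exI[of _ "\<lambda>j t. \<kappa> (\<nu> j t) t"] conjI allI ballI)
    show "(\<lambda>t. \<kappa> (\<nu> j t) t) \<in> measurable M (count_space UNIV)" for j
      by (rule measurable_compose_countable[OF \<kappa> \<nu>])
  next
    fix t assume t: "t \<in> space M"
    show "strict_mono (\<lambda>j. \<kappa> (\<nu> j t) t)"
      using strict_mono_o[OF mono[OF t] mono'[OF t]] by (simp add: o_def)
    fix c assume "c \<in> set (b # bs)"
    then consider "c = b" | "c \<in> set bs" by auto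
    then show "convergent (\<lambda>j. c \<bullet> f (\<kappa> (\<nu> j t) t) t)"
    proof cases
      case 1
      then show ?thesis
        using convergent_subseq_convergent[OF conv[OF t] mono'[OF t]] by (simp add: o_def)
    qed (use conv'[OF t] in blast)
  qed
qed

text \<open>
The subsequence is first chosen to attain the upper limit in the direction \<open>q\<close> and then thinned out until all
coordinates converge. The limit is therefore a cluster point that is extreme in the direction \<open>q\<close>.
\<close>

proposition measurable_cluster_selection:
  fixes f :: "nat \<Rightarrow> 't \<Rightarrow> 'a::euclidean_space"
  assumes f: "\<And>k. f k \<in> borel_measurable M"
    and bdd: "\<And>t. t \<in> space M \<Longrightarrow> bounded (range (\<lambda>k. f k t))"
  shows "\<exists>g\<in>borel_measurable M. \<forall>t\<in>space M. cluster_point (\<lambda>k. f k t) (g t) \<and>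
           (\<forall>e>0. \<forall>\<^sub>F k in sequentially. q \<bullet> f k t < q \<bullet> g t + e)"
proof -
  from measurable_limsup_subsequence[OF assms, of q]
  obtain \<kappa> :: "nat \<Rightarrow> 't \<Rightarrow> nat" where \<kappa>: "\<And>j. \<kappa> j \<in> measurable M (count_space UNIV)"
    and mono: "\<And>t. t \<in> space M \<Longrightarrow> strict_mono (\<lambda>j. \<kappa> j t)"
    and conv: "\<And>t. t \<in> space M \<Longrightarrow>
      \<exists>L. (\<lambda>j. q \<bullet> f (\<kappa> j t) t) \<longlonglongrightarrow> L \<and> (\<forall>e>0. \<forall>\<^sub>F k in sequentially. q \<bullet> f k t < L + e)"
    by metis
  define f1 where "f1 j t = f (\<kappa> j t) t" for j t
  have f1: "f1 j \<in> borel_measurable M" for j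
    unfolding f1_def by (rule measurable_compose_countable[OF f \<kappa>])
  have f1b: "bounded (range (\<lambda>j. f1 j t))" if "t \<in> space M" for t
    unfolding f1_def by (rule bounded_subset[OF bdd[OF that]]) auto
  obtain bs :: "'a list" where bs: "set bs = Basis"
    using finite_list[OF finite_Basis] by blast
  have "\<exists>\<mu>. (\<forall>j. \<mu> j \<in> measurable M (count_space UNIV)) \<and>
    (\<forall>t\<in>space M. strict_mono (\<lambda>j. \<mu> j t) \<and> (\<forall>b\<in>set bs. convergent (\<lambda>j. b \<bullet> f1 (\<mu> j t) t)))"
    by (rule measurable_convergent_subsequence) (rule f1, erule f1b)
  then obtain \<mu> :: "nat \<Rightarrow> 't \<Rightarrow> nat" where "\<forall>j. \<mu> j \<in> measurable M (count_space UNIV)"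
    and *: "\<forall>t\<in>space M. strict_mono (\<lambda>j. \<mu> j t) \<and> (\<forall>b\<in>set bs. convergent (\<lambda>j. b \<bullet> f1 (\<mu> j t) t))"
    by (elim exE conjE)
  then have \<mu>: "\<mu> j \<in> measurable M (count_space UNIV)" for j by blast
  have mono': "strict_mono (\<lambda>j. \<mu> j t)" if "t \<in> space M" for t
    using * that by blast
  have conv': "convergent (\<lambda>j. b \<bullet> f1 (\<mu> j t) t)" if "t \<in> space M" "b \<in> Basis" for t b
    using bspec[OF * that(1)] that(2) bs by blast
  define f2 where "f2 j t = f1 (\<mu> j t) t" for j t
  have f2: "f2 j \<in> borel_measurable M" for j
    unfolding f2_def by (rule measurable_compose_countable[OF f1 \<mu>])
  define g where "g t = lim (\<lambda>j. f2 j t)" for t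
  have g: "g \<in> borel_measurable M"
    unfolding g_def by (rule borel_measurable_lim_metric[OF f2])
  have lim: "(\<lambda>j. f2 j t) \<longlonglongrightarrow> g t" if t: "t \<in> space M" for t
  proof -
    have "\<forall>b\<in>Basis. \<exists>L. (\<lambda>j. f2 j t \<bullet> b) \<longlonglongrightarrow> L"
      using conv'[OF t] by (simp add: convergent_def f2_def inner_commute)
    from bchoice[OF this] obtain L where L: "\<And>b. b \<in> Basis \<Longrightarrow> (\<lambda>j. f2 j t \<bullet> b) \<longlonglongrightarrow> L b"
      by blast
    have *: "(\<lambda>j. f2 j t) \<longlonglongrightarrow> (\<Sum>b\<in>Basis. L b *\<^sub>R b)"
      using L by (subst tendsto_componentwise_iff) simp
    show ?thesis unfolding g_def limI[OF *] by (rule *)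
  qed
  show ?thesis
  proof (intro bexI[OF _ g] ballI conjI)
    fix t assume t: "t \<in> space M"
    have "strict_mono (\<lambda>j. \<kappa> (\<mu> j t) t)"
      using strict_mono_o[OF mono[OF t] mono'[OF t]] by (simp add: o_def)
    then show "cluster_point (\<lambda>k. f k t) (g t)"
      unfolding cluster_point_def using lim[OF t]
      by (intro exI[of _ "\<lambda>j. \<kappa> (\<mu> j t) t"]) (simp add: o_def f2_def f1_def)
    obtain L where L: "(\<lambda>j. q \<bullet> f1 j t) \<longlonglongrightarrow> L" "\<forall>e>0. \<forall>\<^sub>F k in sequentially. q \<bullet> f k t < L + e"
      using conv[OF t] unfolding f1_def by (elim exE conjE)
    have "(\<lambda>j. q \<bullet> f2 j t) \<longlonglongrightarrow> L"
      unfolding f2_def using LIMSEQ_subseq_LIMSEQ[OF L(1) mono'[OF t]] by (simp only: o_def)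
    moreover have "(\<lambda>j. q \<bullet> f2 j t) \<longlonglongrightarrow> q \<bullet> g t"
      by (rule tendsto_inner[OF tendsto_const lim[OF t]])
    ultimately have "L = q \<bullet> g t" by (rule LIMSEQ_unique)
    then show "\<forall>e>0. \<forall>\<^sub>F k in sequentially. q \<bullet> f k t < q \<bullet> g t + e" using L(2) by (simp only:)
  qed
qed

section \<open>Measurable selections of compact-valued multifunctions\<close>

lemma (in finite_measure) sets_projection:
  fixes G :: "('a \<times> 'y::heine_borel) set"
  assumes "complete_measure M" and "G \<in> sets (M \<Otimes>\<^sub>M borel)"
  shows "fst ` G \<in> sets M"
  using analytic_projection_measurable[OF assms(1) analytic_over_sets_pair[OF assms(2)]] .

text \<open>
For each \<open>j\<close>, the first point of a dense sequence within \<open>1 / Suc j\<close> of the section over \<open>t\<close> is a measurable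
function of \<open>t\<close>: the sets on which a given point qualifies are projections. Any measurable selection of the
cluster points of these approximations lies in the section, which is compact.
\<close>

theorem (in finite_measure) measurable_selection_compact:
  fixes G :: "('a \<times> 'y::euclidean_space) set"
  assumes "complete_measure M" and G: "G \<in> sets (M \<Otimes>\<^sub>M borel)" and T: "T \<in> sets M"
    and cpt: "\<And>t. t \<in> T \<Longrightarrow> compact {y. (t, y) \<in> G}"
    and ne: "\<And>t. t \<in> T \<Longrightarrow> \<exists>y. (t, y) \<in> G"
  shows "\<exists>g\<in>borel_measurable M. \<forall>t\<in>T. (t, g t) \<in> G"
proof -
  obtain D :: "'y set" where D: "countable D" "\<And>X. open X \<Longrightarrow> X \<noteq> {} \<Longrightarrow> \<exists>d\<in>D. d \<in> X"
    using countable_dense_exists by blast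
  then have "D \<noteq> {}" by (metis empty_iff open_UNIV UNIV_not_empty)
  define e where "e = from_nat_into D"
  have dense: "\<exists>i. dist (e i) y < \<delta>" if "\<delta> > 0" for y \<delta>
  proof -
    have "ball y \<delta> \<noteq> {}" using that by (simp add: ball_eq_empty not_le)
    then obtain d where "d \<in> D" "d \<in> ball y \<delta>" using D(2)[OF open_ball] by blast
    moreover obtain i where "e i = d"
      using from_nat_into_surj[OF D(1) \<open>d \<in> D\<close>] unfolding e_def by blast
    ultimately show ?thesis by (auto simp: dist_commute)
  qed
  define S where "S i j = T \<inter> fst ` (G \<inter> (space M \<times> ball (e i) (1 / real (Suc j))))" for i j
  have [measurable]: "S i j \<in> sets M" for i j
    unfolding S_def by (intro sets.Int T sets_projection assms(1) G pair_measureI) simp_all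
  have S_iff: "t \<in> S i j \<longleftrightarrow> t \<in> T \<and> (\<exists>y. (t, y) \<in> G \<and> dist (e i) y < 1 / real (Suc j))" for t i j
    using sets.sets_into_space[OF T] by (auto simp: S_def image_iff Bex_def split_paired_Ex)
  define k where "k j t = (LEAST i. t \<in> S i j)" for j t
  have [measurable]: "k j \<in> measurable M (count_space UNIV)" for j
    unfolding k_def by measurable
  note T[measurable]
  define a where "a j t = (if t \<in> T then e (k j t) else 0)" for j t
  have a: "a j \<in> borel_measurable M" for j unfolding a_def by measurable
  have near: "\<exists>y. (t, y) \<in> G \<and> dist (a j t) y < 1 / real (Suc j)" if t: "t \<in> T" for t j
  proof -
    obtain y where y: "(t, y) \<in> G" using ne[OF t] by blast
    obtain i where "dist (e i) y < 1 / real (Suc j)" using dense[of "1 / real (Suc j)" y] by auto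
    then have "t \<in> S i j" using S_iff t y by blast
    then have "t \<in> S (k j t) j" unfolding k_def by (rule LeastI)
    then show ?thesis using t by (simp add: S_iff a_def)
  qed
  have bdd: "bounded (range (\<lambda>j. a j t))" for t
  proof (cases "t \<in> T")
    case True
    obtain B where B: "\<And>y. (t, y) \<in> G \<Longrightarrow> norm y \<le> B"
      using compact_imp_bounded[OF cpt[OF True]] by (auto simp: bounded_iff)
    have "norm (a j t) \<le> B + 1" for j
    proof -
      obtain y where "(t, y) \<in> G" and d: "dist (a j t) y < 1 / real (Suc j)"
        using near[OF True] by blast
      then have "norm y \<le> B" using B by blast
      moreover have "norm (a j t) \<le> norm y + dist (a j t) y"
        unfolding dist_norm by (rule norm_triangle_sub)
      moreover have "1 / real (Suc j) \<le> 1" by simp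
      ultimately show ?thesis using d by linarith
    qed
    then show ?thesis by (auto simp: bounded_iff)
  next
    case False
    then show ?thesis by (simp add: a_def)
  qed
  obtain g where g: "g \<in> borel_measurable M"
    and cl: "\<And>t. t \<in> space M \<Longrightarrow> cluster_point (\<lambda>j. a j t) (g t)"
    using measurable_cluster_selection[OF a bdd, where q = 0] by blast
  have "(t, g t) \<in> G" if t: "t \<in> T" for t
  proof -
    have tM: "t \<in> space M" using t sets.sets_into_space[OF T] by blast
    obtain r where r: "strict_mono r" "((\<lambda>j. a j t) \<circ> r) \<longlonglongrightarrow> g t"
      using cl[OF tM] unfolding cluster_point_def by blast
    have "\<forall>j. \<exists>y. (t, y) \<in> G \<and> dist (a j t) y < 1 / real (Suc j)" using near[OF t] by blast
    from choice[OF this] obtain y where y: "\<And>j. (t, y j) \<in> G" "\<And>j. dist (a j t) (y j) < 1 / real (Suc j)"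
      by blast
    have "(\<lambda>j. dist (a j t) (y j)) \<longlonglongrightarrow> 0"
    proof (rule tendsto_sandwich[OF _ _ tendsto_const LIMSEQ_Suc[OF lim_1_over_n]])
      show "\<forall>\<^sub>F j in sequentially. dist (a j t) (y j) \<le> 1 / real (Suc j)"
        using y(2) by (simp add: less_imp_le)
    qed simp
    then have "(\<lambda>j. a j t - y j) \<longlonglongrightarrow> 0"
      by (simp add: dist_norm tendsto_norm_zero_iff)
    from LIMSEQ_subseq_LIMSEQ[OF this r(1)]
    have "(\<lambda>j. a (r j) t - y (r j)) \<longlonglongrightarrow> 0" by (simp only: o_def)
    moreover have "(\<lambda>j. a (r j) t) \<longlonglongrightarrow> g t" using r(2) by (simp only: o_def)
    ultimately have "(\<lambda>j. a (r j) t - (a (r j) t - y (r j))) \<longlonglongrightarrow> g t - 0"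
      by (rule tendsto_diff[rotated])
    then have "(\<lambda>j. y (r j)) \<longlonglongrightarrow> g t" by simp
    then have "g t \<in> {y. (t, y) \<in> G}"
      by (rule closed_sequentially[OF compact_imp_closed[OF cpt[OF t]], rotated]) (simp add: y(1))
    then show ?thesis by simp
  qed
  then show ?thesis using g by blast
qed

section \<open>Approximate convexity of integrals over a diffuse measure\<close>

text \<open>
The probability integral transform: \<open>V\<close> is the distribution function \<open>G\<close> of \<open>\<theta>\<close> on \<open>A\<close>, applied to \<open>\<theta>\<close> itself
and normalised. As \<open>\<theta>\<close> has no atoms, \<open>G\<close> is continuous, so \<open>G z = c\<close> for the largest \<open>z \<le> 2\<close> with \<open>G z \<le> c\<close>,
and \<open>V t \<le> x\<close> means \<open>\<theta> t \<le> z\<close>.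
\<close>

lemma (in finite_measure) conditional_uniform_variable_on_set:
  fixes \<theta> :: "'a \<Rightarrow> real"
  assumes [measurable]: "\<theta> \<in> borel_measurable M" "A \<in> sets M"
    and range: "\<And>t. t \<in> space M \<Longrightarrow> \<theta> t \<in> {0..2}"
    and diffuse: "\<And>r. measure M {t \<in> space M. \<theta> t = r} = 0"
  shows "\<exists>V\<in>borel_measurable M. (\<forall>t\<in>space M. V t \<in> {0..1}) \<and>
           (\<forall>x\<in>{0..1}. measure M {t \<in> A. V t \<le> x} = x * measure M A)"
proof (cases "measure M A = 0")
  case True
  have "measure M {t \<in> A. 0 \<le> x} = x * measure M A" if "x \<in> {0..1}" for x :: real
    using that True by simp
  then show ?thesis by (intro bexI[of _ "\<lambda>_. 0"]) auto
next
  case False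
  define m where "m = measure M A"
  have m: "m > 0" using False measure_nonneg[of M A] unfolding m_def by linarith
  have AM: "A \<subseteq> space M" using assms(2) by (rule sets.sets_into_space)
  define G where "G s = measure M {t \<in> A. \<theta> t \<le> s}" for s
  have [measurable]: "{t \<in> A. P t} \<in> sets M" if "Measurable.pred M P" for P
  proof -
    have "{t \<in> A. P t} = A \<inter> {t \<in> space M. P t}" using AM by auto
    then show ?thesis using that by simp
  qed
  have G_mono: "mono G"
    unfolding G_def by (intro monoI finite_measure_mono) auto
  have G_le: "G s \<le> m" for s
    unfolding G_def m_def by (intro finite_measure_mono) auto
  have G_nonneg: "0 \<le> G s" for s unfolding G_def by simp
  have G_low: "G s = 0" if "s < 0" for s
  proof -
    have "{t \<in> A. \<theta> t \<le> s} = {}" using range AM that by force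
    then show ?thesis unfolding G_def by (metis measure_empty)
  qed
  have G_high: "G s = m" if "2 \<le> s" for s
  proof -
    have "{t \<in> A. \<theta> t \<le> s} = A" using range AM that by force
    then show ?thesis unfolding G_def m_def by simp
  qed
  define V where "V t = G (\<theta> t) / m" for t
  have "G \<in> borel_measurable borel" using G_mono by (rule borel_measurable_mono)
  then have [measurable]: "V \<in> borel_measurable M"
    unfolding V_def by measurable
  have V01: "V t \<in> {0..1}" for t
    using G_nonneg[of "\<theta> t"] G_le[of "\<theta> t"] m by (simp add: V_def)
  have "measure M {t \<in> A. V t \<le> x} = x * m" if x: "x \<in> {0..1}" for x
  proof -
    define c where "c = x * m"
    have c: "0 \<le> c" "c \<le> m" using x m by (auto simp: c_def mult_le_cancel_right1)
    \<comment> \<open>The point \<open>-1\<close> lies to the left of all values of \<open>\<theta>\<close>, so the set is nonempty even for \<open>c = 0\<close>.\<close>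
    define X where "X = {s. s \<in> {-1..2} \<and> G s \<le> c}"
    define z where "z = Sup X"
    have X1: "-1 \<in> X" using G_low[of "-1"] c by (simp add: X_def)
    have Xb: "bdd_above X" by (intro bdd_aboveI[of _ 2]) (simp add: X_def)
    have below: "G s \<le> c" if "s < z" for s
    proof -
      have "X \<noteq> {}" using X1 by blast
      from less_cSupD[OF this that[unfolded z_def]]
      obtain s' where "s' \<in> X" "s < s'" by blast
      then show ?thesis using monoD[OF G_mono, of s s'] by (simp add: X_def)
    qed
    have above: "c \<le> G s" if "z < s" for s
    proof (cases "s \<le> 2")
      case True
      have "-1 \<le> z" unfolding z_def by (rule cSup_upper[OF X1 Xb])
      then have "- 1 \<le> s" using that by linarith
      then have "s \<notin> X \<Longrightarrow> \<not> G s \<le> c" using True by (simp add: X_def)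
      moreover have "s \<notin> X" using cSup_upper[OF _ Xb, of s] that unfolding z_def by force
      ultimately show ?thesis by simp
    next
      case False
      then show ?thesis using G_high[of s] c by simp
    qed
    have "G z \<le> c"
    proof -
      have "(\<lambda>n. measure M {t \<in> A. \<theta> t \<le> z - 1 / real (Suc n)})
          \<longlonglongrightarrow> measure M (\<Union>n. {t \<in> A. \<theta> t \<le> z - 1 / real (Suc n)})"
      proof (rule finite_Lim_measure_incseq)
        show "incseq (\<lambda>n. {t \<in> A. \<theta> t \<le> z - 1 / real (Suc n)})"
        proof (intro incseq_SucI subsetI)
          fix n t assume t: "t \<in> {t \<in> A. \<theta> t \<le> z - 1 / real (Suc n)}"
          have "1 / real (Suc (Suc n)) \<le> 1 / real (Suc n)" by (intro divide_left_mono) auto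
          then show "t \<in> {t \<in> A. \<theta> t \<le> z - 1 / real (Suc (Suc n))}" using t by auto
        qed
      qed auto
      moreover have "(\<Union>n. {t \<in> A. \<theta> t \<le> z - 1 / real (Suc n)}) = {t \<in> A. \<theta> t < z}"
      proof (intro set_eqI iffI)
        fix t assume "t \<in> {t \<in> A. \<theta> t < z}"
        then have tA: "t \<in> A" and "z - \<theta> t > 0" by auto
        then obtain n where "1 / real (Suc n) < z - \<theta> t" using nat_approx_posE by blast
        then have "\<theta> t \<le> z - 1 / real (Suc n)" by linarith
        then show "t \<in> (\<Union>n. {t \<in> A. \<theta> t \<le> z - 1 / real (Suc n)})" using tA by blast
      next
        fix t assume "t \<in> (\<Union>n. {t \<in> A. \<theta> t \<le> z - 1 / real (Suc n)})"
        then obtain n where tA: "t \<in> A" "\<theta> t \<le> z - 1 / real (Suc n)" by blast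
        moreover have "0 < 1 / real (Suc n)" by simp
        ultimately have "\<theta> t < z" by linarith
        then show "t \<in> {t \<in> A. \<theta> t < z}" using tA by simp
      qed
      moreover have "measure M {t \<in> A. \<theta> t \<le> z - 1 / real (Suc n)} \<le> c" for n
        using below[of "z - 1 / real (Suc n)"] unfolding G_def by simp
      ultimately have *: "measure M {t \<in> A. \<theta> t < z} \<le> c"
        by (auto intro!: LIMSEQ_le_const2 simp del: of_nat_Suc)
      have "G z \<le> measure M ({t \<in> A. \<theta> t < z} \<union> {t \<in> space M. \<theta> t = z})"
        unfolding G_def using AM by (intro finite_measure_mono) auto
      also have "\<dots> \<le> measure M {t \<in> A. \<theta> t < z} + measure M {t \<in> space M. \<theta> t = z}"
        by (rule measure_Un_le) auto
      finally show ?thesis using * diffuse[of z] by linarith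
    qed
    moreover have "c \<le> G z"
    proof -
      have "(\<lambda>n. measure M {t \<in> A. \<theta> t \<le> z + 1 / real (Suc n)})
          \<longlonglongrightarrow> measure M (\<Inter>n. {t \<in> A. \<theta> t \<le> z + 1 / real (Suc n)})"
      proof (rule finite_Lim_measure_decseq)
        show "decseq (\<lambda>n. {t \<in> A. \<theta> t \<le> z + 1 / real (Suc n)})"
        proof (intro decseq_SucI subsetI)
          fix n t assume t: "t \<in> {t \<in> A. \<theta> t \<le> z + 1 / real (Suc (Suc n))}"
          have "1 / real (Suc (Suc n)) \<le> 1 / real (Suc n)" by (intro divide_left_mono) auto
          then show "t \<in> {t \<in> A. \<theta> t \<le> z + 1 / real (Suc n)}" using t by auto
        qed
      qed auto
      moreover have "(\<Inter>n. {t \<in> A. \<theta> t \<le> z + 1 / real (Suc n)}) = {t \<in> A. \<theta> t \<le> z}"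
      proof (intro set_eqI iffI)
        fix t assume t: "t \<in> (\<Inter>n. {t \<in> A. \<theta> t \<le> z + 1 / real (Suc n)})"
        then have tA: "t \<in> A" and le: "\<And>n. \<theta> t \<le> z + 1 / real (Suc n)" by auto
        have "\<theta> t \<le> z"
        proof (rule ccontr)
          assume "\<not> \<theta> t \<le> z"
          then have "0 < \<theta> t - z" by simp
          then obtain n where "1 / real (Suc n) < \<theta> t - z" using nat_approx_posE by blast
          then show False using le[of n] by linarith
        qed
        then show "t \<in> {t \<in> A. \<theta> t \<le> z}" using tA by simp
      next
        fix t assume t: "t \<in> {t \<in> A. \<theta> t \<le> z}"
        have "\<theta> t \<le> z + 1 / real (Suc n)" for n
        proof -
          have "0 \<le> 1 / real (Suc n)" by simp
          moreover have "\<theta> t \<le> z" using t by simp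
          ultimately show ?thesis by linarith
        qed
        then show "t \<in> (\<Inter>n. {t \<in> A. \<theta> t \<le> z + 1 / real (Suc n)})" using t by blast
      qed
      moreover have "c \<le> measure M {t \<in> A. \<theta> t \<le> z + 1 / real (Suc n)}" for n
        using above[of "z + 1 / real (Suc n)"] unfolding G_def by simp
      ultimately show ?thesis
        unfolding G_def by (auto intro!: LIMSEQ_le_const simp del: of_nat_Suc)
    qed
    ultimately have Gz: "G z = c" by simp
    have "{t \<in> A. V t \<le> x} = {t \<in> A. \<theta> t \<le> z}"
    proof (intro Collect_cong conj_cong refl)
      fix t assume "t \<in> A"
      then have r: "\<theta> t \<in> {0..2}" using AM range by blast
      have "V t \<le> x \<longleftrightarrow> G (\<theta> t) \<le> c"
        unfolding V_def c_def by (rule pos_divide_le_eq[OF m])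
      also have "\<dots> \<longleftrightarrow> \<theta> t \<le> z"
      proof
        assume "G (\<theta> t) \<le> c"
        then have "\<theta> t \<in> X" using r by (simp add: X_def)
        then show "\<theta> t \<le> z" unfolding z_def by (rule cSup_upper[OF _ Xb])
      next
        assume "\<theta> t \<le> z"
        then show "G (\<theta> t) \<le> c" using monoD[OF G_mono, of "\<theta> t" z] Gz by simp
      qed
      finally show "V t \<le> x \<longleftrightarrow> \<theta> t \<le> z" .
    qed
    then show ?thesis using Gz unfolding G_def c_def by simp
  qed
  then show ?thesis using V01 unfolding m_def[symmetric] by (intro bexI[of _ V]) auto
qed

text \<open>
On each cell of the partition given by \<open>\<beta>\<close> the uniform variable of that cell is used; the result is uniform
and independent of the cell.
\<close>

lemma (in finite_measure) conditional_uniform_variable: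
  fixes \<theta> :: "'a \<Rightarrow> real" and \<beta> :: "'a \<Rightarrow> nat"
  assumes \<theta>: "\<theta> \<in> borel_measurable M" and \<beta>[measurable]: "\<beta> \<in> measurable M (count_space UNIV)"
    and range: "\<And>t. t \<in> space M \<Longrightarrow> \<theta> t \<in> {0..2}"
    and diffuse: "\<And>r. measure M {t \<in> space M. \<theta> t = r} = 0"
  shows "\<exists>U\<in>borel_measurable M. (\<forall>t\<in>space M. U t \<in> {0..1}) \<and>
           (\<forall>x\<in>{0..1}. \<forall>b. measure M {t \<in> space M. \<beta> t = b \<and> U t \<le> x}
              = x * measure M {t \<in> space M. \<beta> t = b})"
proof -
  have "\<forall>b. \<exists>V. V \<in> borel_measurable M \<and> (\<forall>t\<in>space M. V t \<in> {0..1}) \<and>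
           (\<forall>x\<in>{0..1}. measure M {t \<in> {t \<in> space M. \<beta> t = b}. V t \<le> x} = x * measure M {t \<in> space M. \<beta> t = b})"
  proof
    fix b
    have "{t \<in> space M. \<beta> t = b} \<in> sets M" by measurable
    from conditional_uniform_variable_on_set[OF \<theta> this range diffuse]
    show "\<exists>V. V \<in> borel_measurable M \<and> (\<forall>t\<in>space M. V t \<in> {0..1}) \<and>
           (\<forall>x\<in>{0..1}. measure M {t \<in> {t \<in> space M. \<beta> t = b}. V t \<le> x} = x * measure M {t \<in> space M. \<beta> t = b})"
      by blast
  qed
  from choice[OF this] obtain V where V: "\<And>b. V b \<in> borel_measurable M"
    "\<And>b t. t \<in> space M \<Longrightarrow> V b t \<in> {0..1}"
    "\<And>b x. x \<in> {0..1} \<Longrightarrow>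
      measure M {t \<in> {t \<in> space M. \<beta> t = b}. V b t \<le> x} = x * measure M {t \<in> space M. \<beta> t = b}"
    by blast
  have "(\<lambda>t. V (\<beta> t) t) \<in> borel_measurable M"
    by (rule measurable_compose_countable[OF V(1) \<beta>])
  moreover have "measure M {t \<in> space M. \<beta> t = b \<and> V (\<beta> t) t \<le> x} = x * measure M {t \<in> space M. \<beta> t = b}"
    if "x \<in> {0..1}" for b x
  proof -
    have "{t \<in> space M. \<beta> t = b \<and> V (\<beta> t) t \<le> x} = {t \<in> {t \<in> space M. \<beta> t = b}. V b t \<le> x}" by auto
    then show ?thesis using V(3)[OF that, of b] by simp
  qed
  ultimately show ?thesis using V(2) by (intro bexI[of _ "\<lambda>t. V (\<beta> t) t"]) auto
qed

lemma finite_valued_approximation: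
  fixes f :: "nat \<Rightarrow> 'a \<Rightarrow> 'b::euclidean_space"
  assumes "\<And>i. i < n \<Longrightarrow> f i \<in> borel_measurable M"
    and "\<And>i t. i < n \<Longrightarrow> t \<in> space M \<Longrightarrow> norm (f i t) \<le> C" and \<delta>: "\<delta> > 0"
  shows "\<exists>\<beta> :: 'a \<Rightarrow> nat. \<beta> \<in> measurable M (count_space UNIV) \<and> finite (\<beta> ` space M) \<and>
           (\<exists>\<gamma>. \<forall>i<n. \<forall>t\<in>space M. norm (f i t - \<gamma> i (\<beta> t)) \<le> \<delta>)"
  using assms(1,2)
proof (induction n)
  case 0
  have "finite ((\<lambda>_. 0::nat) ` space M)" by (rule finite_subset[of _ "{0}"]) auto
  then show ?case by (intro exI[of _ "\<lambda>_. 0"]) simp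
next
  case (Suc n)
  have "\<exists>\<beta> :: 'a \<Rightarrow> nat. \<beta> \<in> measurable M (count_space UNIV) \<and> finite (\<beta> ` space M) \<and>
           (\<exists>\<gamma>. \<forall>i<n. \<forall>t\<in>space M. norm (f i t - \<gamma> i (\<beta> t)) \<le> \<delta>)"
    by (rule Suc.IH) (use Suc.prems in simp_all)
  then obtain \<beta> :: "'a \<Rightarrow> nat" and \<gamma> where [measurable]: "\<beta> \<in> measurable M (count_space UNIV)"
    and fin: "finite (\<beta> ` space M)"
    and \<gamma>: "\<forall>i<n. \<forall>t\<in>space M. norm (f i t - \<gamma> i (\<beta> t)) \<le> \<delta>"
    by (elim exE conjE)
  have [measurable]: "f n \<in> borel_measurable M" using Suc.prems(1) by simp
  have "\<exists>K. finite K \<and> cball (0::'b) C \<subseteq> (\<Union>x\<in>K. ball x \<delta>)"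
    using compact_cball[of "0::'b" C] \<delta> unfolding compact_eq_totally_bounded by simp
  then obtain K where K: "finite K" "cball (0::'b) C \<subseteq> (\<Union>x\<in>K. ball x \<delta>)"
    by (elim exE conjE)
  obtain xs where xs: "set xs = K" using finite_list[OF K(1)] by blast
  \<comment> \<open>The second alternative keeps the index bounded where the first one might fail.\<close>
  define s where "s t = (LEAST i. norm (f n t - xs ! i) \<le> \<delta> \<or> length xs \<le> i)" for t
  have [measurable]: "s \<in> measurable M (count_space UNIV)"
    unfolding s_def by measurable
  have s: "norm (f n t - xs ! s t) \<le> \<delta> \<and> s t \<le> length xs" if t: "t \<in> space M" for t
  proof -
    have "norm (f n t) \<le> C" using Suc.prems(2)[of n t] t by simp
    then have "f n t \<in> cball 0 C" by simp
    then obtain x where "x \<in> K" "f n t \<in> ball x \<delta>" using K(2) by blast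
    moreover obtain i where i: "i < length xs" "xs ! i = x"
      using \<open>x \<in> K\<close> xs by (auto simp: in_set_conv_nth)
    ultimately have fi: "norm (f n t - xs ! i) \<le> \<delta>"
      by (simp add: dist_norm norm_minus_commute less_imp_le)
    then have "s t \<le> i" unfolding s_def using fi by (intro Least_le) simp
    moreover have "norm (f n t - xs ! s t) \<le> \<delta> \<or> length xs \<le> s t"
      unfolding s_def by (rule LeastI[of _ i]) (use fi in simp)
    ultimately show ?thesis using i(1) by linarith
  qed
  define \<beta>' where "\<beta>' t = prod_encode (\<beta> t, s t)" for t
  define \<gamma>' where "\<gamma>' i b = (if i = n then xs ! snd (prod_decode b) else \<gamma> i (fst (prod_decode b)))" for i b
  have "\<beta>' \<in> measurable M (count_space UNIV)"
    unfolding \<beta>'_def by measurable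
  moreover have "finite (\<beta>' ` space M)"
  proof (rule finite_subset)
    show "\<beta>' ` space M \<subseteq> prod_encode ` (\<beta> ` space M \<times> {..length xs})"
      using s by (auto simp: \<beta>'_def)
    show "finite (prod_encode ` (\<beta> ` space M \<times> {..length xs}))" using fin by simp
  qed
  moreover have "\<forall>i<Suc n. \<forall>t\<in>space M. norm (f i t - \<gamma>' i (\<beta>' t)) \<le> \<delta>"
    using s \<gamma> by (auto simp: \<gamma>'_def \<beta>'_def less_Suc_eq)
  ultimately show ?case by blast
qed

text \<open>
A function without atoms is a convenient witness that the measure has none. The bounded range makes its
distribution function vanish to the left of \<open>0\<close> and be complete from \<open>2\<close> on; the codes constructed below by
ternary digits lie in this interval.
\<close>

definition diffuse_coordinate :: "'a measure \<Rightarrow> ('a \<Rightarrow> real) \<Rightarrow> bool" where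
  "diffuse_coordinate M \<theta> \<longleftrightarrow> \<theta> \<in> borel_measurable M \<and> (\<forall>t\<in>space M. \<theta> t \<in> {0..2}) \<and>
     (\<forall>r. measure M {t \<in> space M. \<theta> t = r} = 0)"

text \<open>
An approximate form of Lyapunov's convexity theorem. Up to a small error the functions are constant on the
cells of a finite partition. Let \<open>U\<close> be uniform on \<open>[0, 1]\<close> conditionally on the cells; then the integral of
\<open>f i\<close> over \<open>U \<le> x\<close> is nearly \<open>x\<close> times its full integral. For cut points \<open>S\<close>, the function \<open>h\<close> that equals
\<open>f i\<close> where \<open>S i < U \<le> S (Suc i)\<close> has an integral that is close to the convex combination with weights
\<open>S (Suc i) - S i\<close>. What is gained over mere approximation is that this integral is an exact and continuous
function of the cut points.
\<close>

lemma (in finite_measure) continuous_approximate_mixing: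
  fixes f :: "nat \<Rightarrow> 'a \<Rightarrow> 'b::euclidean_space" and \<theta> :: "'a \<Rightarrow> real"
  assumes diffuse: "diffuse_coordinate M \<theta>"
    and f[measurable]: "\<And>i. f i \<in> borel_measurable M"
    and bound: "\<forall>i. \<forall>t\<in>space M. norm (f i t) \<le> C"
    and n: "n > 0" and e: "e > 0"
  shows "\<exists>\<Lambda> :: nat \<Rightarrow> real \<Rightarrow> 'b. (\<forall>i. continuous_on {0..1} (\<Lambda> i)) \<and>
    (\<forall>i<n. \<forall>x\<in>{0..1}. norm (\<Lambda> i x - x *\<^sub>R integral\<^sup>L M (f i)) \<le> e) \<and>
    (\<forall>S::nat \<Rightarrow> real. S 0 = 0 \<and> S n = 1 \<and> (\<forall>i<n. S i \<le> S (Suc i)) \<longrightarrow>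
       (\<exists>h\<in>borel_measurable M. (\<forall>t\<in>space M. \<exists>i<n. h t = f i t) \<and>
          integral\<^sup>L M h = (\<Sum>i<n. \<Lambda> i (S (Suc i)) - \<Lambda> i (S i))))"
proof -
  have \<theta>: "\<theta> \<in> borel_measurable M" "\<And>t. t \<in> space M \<Longrightarrow> \<theta> t \<in> {0..2}"
      "\<And>r. measure M {t \<in> space M. \<theta> t = r} = 0"
    using diffuse by (auto simp: diffuse_coordinate_def)
  have C: "norm (f i t) \<le> C" if "t \<in> space M" for i t using bound that by blast
  define m where "m = measure M (space M)"
  have m: "m \<ge> 0" by (simp add: m_def)
  define \<delta> where "\<delta> = e / (2 * (m + 1))"
  have \<delta>: "\<delta> > 0" using e m by (simp add: \<delta>_def)
  have \<delta>m: "2 * (\<delta> * m) \<le> e"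
  proof -
    have "2 * (\<delta> * m) = e * (m / (m + 1))" using m by (simp add: \<delta>_def field_simps)
    also have "\<dots> \<le> e * 1" using e m by (intro mult_left_mono) auto
    finally show ?thesis by simp
  qed
  have "\<exists>\<beta> :: 'a \<Rightarrow> nat. \<beta> \<in> measurable M (count_space UNIV) \<and> finite (\<beta> ` space M) \<and>
           (\<exists>\<gamma>. \<forall>i<n. \<forall>t\<in>space M. norm (f i t - \<gamma> i (\<beta> t)) \<le> \<delta>)"
    by (rule finite_valued_approximation[where C = C]) (simp_all add: C \<delta>)
  then obtain \<beta> :: "'a \<Rightarrow> nat" and \<gamma> where \<beta>[measurable]: "\<beta> \<in> measurable M (count_space UNIV)"
    and fin: "finite (\<beta> ` space M)"
    and \<gamma>: "\<forall>i<n. \<forall>t\<in>space M. norm (f i t - \<gamma> i (\<beta> t)) \<le> \<delta>"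
    by (elim exE conjE)
  obtain U where U[measurable]: "U \<in> borel_measurable M"
    and U01: "\<forall>t\<in>space M. U t \<in> {0..1}"
    and Ub: "\<forall>x\<in>{0..1}. \<forall>b. measure M {t \<in> space M. \<beta> t = b \<and> U t \<le> x} = x * measure M {t \<in> space M. \<beta> t = b}"
    using conditional_uniform_variable[OF \<theta>(1) \<beta>] \<theta>(2,3) by blast
  define L where "L x = {t \<in> space M. U t \<le> x}" for x
  have [measurable]: "L x \<in> sets M" for x unfolding L_def by measurable
  have bdd: "integrable M g" if "g \<in> borel_measurable M" "\<And>t. t \<in> space M \<Longrightarrow> norm (g t) \<le> B" for g :: "'a \<Rightarrow> 'b" and B
    using that by (intro integrable_const_bound[of _ B]) auto
  have int_f: "integrable M (f i)" for i by (rule bdd[OF f C])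
  have int_L: "integrable M (\<lambda>t. indicator (L x) t *\<^sub>R f i t)" for i x
    by (rule integrable_mult_indicator[OF _ int_f]) measurable
  have int_ind: "(LINT t|M. indicator B t *\<^sub>R c) = measure M B *\<^sub>R c" if "B \<in> sets M" for B and c :: 'b
    using that by (subst integral_scaleR_left) (auto simp: emeasure_eq_measure)
  have step: "(LINT t|M. indicator (L x) t *\<^sub>R \<gamma> i (\<beta> t)) = x *\<^sub>R (LINT t|M. \<gamma> i (\<beta> t))"
    if x: "x \<in> {0..1}" for i x
  proof -
    define R where "R = \<beta> ` space M"
    have finR: "finite R" using fin by (simp add: R_def)
    define E where "E b = {t \<in> space M. \<beta> t = b}" for b
    have [measurable]: "E b \<in> sets M" for b unfolding E_def by measurable
    have eq: "\<gamma> i (\<beta> t) = (\<Sum>b\<in>R. indicator (E b) t *\<^sub>R \<gamma> i b)" if "t \<in> space M" for t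
    proof -
      have "(\<Sum>b\<in>R. indicator (E b) t *\<^sub>R \<gamma> i b) = (\<Sum>b\<in>R. if b = \<beta> t then \<gamma> i b else 0)"
        using that by (intro sum.cong) (auto simp: E_def indicator_def)
      also have "\<dots> = \<gamma> i (\<beta> t)"
        using finR that by (simp add: R_def)
      finally show ?thesis by simp
    qed
    have i1: "integrable M (\<lambda>t. indicator (E b) t *\<^sub>R \<gamma> i b)" for b
      by (intro integrable_scaleR_left integrable_real_indicator) (auto simp: emeasure_eq_measure)
    have i2: "integrable M (\<lambda>t. indicator (E b \<inter> L x) t *\<^sub>R \<gamma> i b)" for b
      by (intro integrable_scaleR_left integrable_real_indicator) (auto simp: emeasure_eq_measure)
    have "(LINT t|M. indicator (L x) t *\<^sub>R \<gamma> i (\<beta> t)) = (LINT t|M. (\<Sum>b\<in>R. indicator (E b \<inter> L x) t *\<^sub>R \<gamma> i b))"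
      by (intro Bochner_Integration.integral_cong)
         (auto simp: eq scaleR_sum_right indicator_inter_arith mult.commute intro!: sum.cong)
    also have "\<dots> = (\<Sum>b\<in>R. measure M (E b \<inter> L x) *\<^sub>R \<gamma> i b)"
      using i2 by (simp add: Bochner_Integration.integral_sum int_ind)
    also have "\<dots> = (\<Sum>b\<in>R. (x * measure M (E b)) *\<^sub>R \<gamma> i b)"
    proof (intro sum.cong refl arg_cong2[of _ _ _ _ scaleR])
      fix b
      have "E b \<inter> L x = {t \<in> space M. \<beta> t = b \<and> U t \<le> x}" by (auto simp: E_def L_def)
      then show "measure M (E b \<inter> L x) = x * measure M (E b)"
        using Ub x by (simp add: E_def)
    qed
    also have "\<dots> = x *\<^sub>R (\<Sum>b\<in>R. measure M (E b) *\<^sub>R \<gamma> i b)"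
      by (simp add: scaleR_sum_right)
    also have "(\<Sum>b\<in>R. measure M (E b) *\<^sub>R \<gamma> i b) = (LINT t|M. (\<Sum>b\<in>R. indicator (E b) t *\<^sub>R \<gamma> i b))"
      using i1 by (simp add: Bochner_Integration.integral_sum int_ind)
    also have "\<dots> = (LINT t|M. \<gamma> i (\<beta> t))"
      by (intro Bochner_Integration.integral_cong) (auto simp: eq)
    finally show ?thesis .
  qed
  have L_measure: "measure M (L x) = x * m" if x: "x \<in> {0..1}" for x
  proof -
    define R where "R = \<beta> ` space M"
    have finR: "finite R" using fin by (simp add: R_def)
    have "measure M (L x) = measure M (\<Union>b\<in>R. {t \<in> space M. \<beta> t = b \<and> U t \<le> x})"
      by (intro arg_cong[of _ _ "measure M"]) (auto simp: L_def R_def)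
    also have "\<dots> = (\<Sum>b\<in>R. measure M {t \<in> space M. \<beta> t = b \<and> U t \<le> x})"
      using finR by (intro finite_measure_finite_Union) (auto simp: disjoint_family_on_def)
    also have "\<dots> = x * (\<Sum>b\<in>R. measure M {t \<in> space M. \<beta> t = b})"
      using Ub x by (simp add: sum_distrib_left)
    also have "(\<Sum>b\<in>R. measure M {t \<in> space M. \<beta> t = b}) = measure M (\<Union>b\<in>R. {t \<in> space M. \<beta> t = b})"
      using finR by (intro finite_measure_finite_Union[symmetric]) (auto simp: disjoint_family_on_def)
    also have "(\<Union>b\<in>R. {t \<in> space M. \<beta> t = b}) = space M" by (auto simp: R_def)
    finally show ?thesis by (simp add: m_def)
  qed
  define \<Lambda> where "\<Lambda> i x = (LINT t|M. indicator (L x) t *\<^sub>R f i t)" for i x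
  have near: "norm (\<Lambda> i x - x *\<^sub>R integral\<^sup>L M (f i)) \<le> e" if i: "i < n" and x: "x \<in> {0..1}" for i x
  proof -
    have g_meas: "(\<lambda>t. \<gamma> i (\<beta> t)) \<in> borel_measurable M" by measurable
    have "norm (\<gamma> i (\<beta> t)) \<le> C + \<delta>" if t: "t \<in> space M" for t
    proof -
      have "norm (\<gamma> i (\<beta> t)) \<le> norm (f i t) + norm (\<gamma> i (\<beta> t) - f i t)" by (rule norm_triangle_sub)
      moreover have "norm (\<gamma> i (\<beta> t) - f i t) \<le> \<delta>" using \<gamma> i t by (simp add: norm_minus_commute)
      ultimately show ?thesis using C[OF t, of i] by linarith
    qed
    then have int_g: "integrable M (\<lambda>t. \<gamma> i (\<beta> t))" by (rule bdd[OF g_meas])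
    have int_Lg: "integrable M (\<lambda>t. indicator (L x) t *\<^sub>R \<gamma> i (\<beta> t))"
      by (rule integrable_mult_indicator[OF _ int_g]) measurable
    have d1: "norm (\<Lambda> i x - (LINT t|M. indicator (L x) t *\<^sub>R \<gamma> i (\<beta> t))) \<le> \<delta> * m"
    proof -
      have "norm (\<Lambda> i x - (LINT t|M. indicator (L x) t *\<^sub>R \<gamma> i (\<beta> t)))
          = norm (LINT t|M. indicator (L x) t *\<^sub>R (f i t - \<gamma> i (\<beta> t)))"
        unfolding \<Lambda>_def using int_L int_Lg
        by (simp add: scaleR_diff_right flip: Bochner_Integration.integral_diff)
      also have "\<dots> \<le> (LINT t|M. norm (indicator (L x) t *\<^sub>R (f i t - \<gamma> i (\<beta> t))))"
        by (rule integral_norm_bound)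
      also have "\<dots> \<le> (LINT t|M. \<delta>)"
      proof (rule integral_mono)
        show "integrable M (\<lambda>t. norm (indicator (L x) t *\<^sub>R (f i t - \<gamma> i (\<beta> t))))"
          using integrable_norm[OF Bochner_Integration.integrable_diff[OF int_L[of x i] int_Lg]]
          by (simp add: scaleR_diff_right)
        show "norm (indicator (L x) t *\<^sub>R (f i t - \<gamma> i (\<beta> t))) \<le> \<delta>" if "t \<in> space M" for t
          using \<gamma> i that \<delta> by (auto simp: indicator_def)
      qed simp
      also have "\<dots> = \<delta> * m" by (simp add: m_def)
      finally show ?thesis .
    qed
    have d2: "norm ((LINT t|M. \<gamma> i (\<beta> t)) - integral\<^sup>L M (f i)) \<le> \<delta> * m"
    proof -
      have "norm ((LINT t|M. \<gamma> i (\<beta> t)) - integral\<^sup>L M (f i)) = norm (LINT t|M. \<gamma> i (\<beta> t) - f i t)"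
        using int_g int_f by simp
      also have "\<dots> \<le> (LINT t|M. norm (\<gamma> i (\<beta> t) - f i t))"
        by (rule integral_norm_bound)
      also have "\<dots> \<le> (LINT t|M. \<delta>)"
      proof (rule integral_mono)
        show "integrable M (\<lambda>t. norm (\<gamma> i (\<beta> t) - f i t))"
          by (intro integrable_norm Bochner_Integration.integrable_diff int_g int_f)
        show "norm (\<gamma> i (\<beta> t) - f i t) \<le> \<delta>" if "t \<in> space M" for t
          using \<gamma> i that by (simp add: norm_minus_commute)
      qed simp
      also have "\<dots> = \<delta> * m" by (simp add: m_def)
      finally show ?thesis .
    qed
    have "\<Lambda> i x - x *\<^sub>R integral\<^sup>L M (f i)
        = (\<Lambda> i x - (LINT t|M. indicator (L x) t *\<^sub>R \<gamma> i (\<beta> t)))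
          + x *\<^sub>R ((LINT t|M. \<gamma> i (\<beta> t)) - integral\<^sup>L M (f i))"
      unfolding step[OF x] by (simp add: algebra_simps)
    also have "norm \<dots> \<le> \<delta> * m + \<bar>x\<bar> * (\<delta> * m)"
      using d1 d2 by (intro norm_triangle_mono) (auto intro!: mult_left_mono)
    also have "\<dots> \<le> \<delta> * m + 1 * (\<delta> * m)"
      using x \<delta> m by (intro add_left_mono mult_right_mono) auto
    also have "\<dots> \<le> e" using \<delta>m by simp
    finally show ?thesis .
  qed
  have C0: "0 \<le> C * m"
  proof (cases "space M = {}")
    case True
    then show ?thesis by (simp add: m_def)
  next
    case False
    then obtain t where "t \<in> space M" by blast
    then have "0 \<le> C" using C[of t 0] norm_ge_zero[of "f 0 t"] by linarith
    then show ?thesis using m by simp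
  qed
  have lip: "norm (\<Lambda> i y - \<Lambda> i x) \<le> C * m * (y - x)" if xy: "x \<in> {0..1}" "y \<in> {0..1}" "x \<le> y" for i x y
  proof -
    have sub: "L x \<subseteq> L y" using xy by (auto simp: L_def)
    have "\<Lambda> i y - \<Lambda> i x = (LINT t|M. indicator (L y) t *\<^sub>R f i t - indicator (L x) t *\<^sub>R f i t)"
      unfolding \<Lambda>_def by (rule Bochner_Integration.integral_diff[OF int_L int_L, symmetric])
    also have "\<dots> = (LINT t|M. indicator (L y - L x) t *\<^sub>R f i t)"
      using sub by (intro Bochner_Integration.integral_cong) (auto split: split_indicator)
    also have "norm \<dots> \<le> (LINT t|M. norm (indicator (L y - L x) t *\<^sub>R f i t))"
      by (rule integral_norm_bound)
    also have "\<dots> \<le> (LINT t|M. indicator (L y - L x) t * C)"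
    proof (rule integral_mono)
      show "integrable M (\<lambda>t. norm (indicator (L y - L x) t *\<^sub>R f i t))"
        by (intro integrable_norm integrable_mult_indicator int_f) measurable
      show "integrable M (\<lambda>t. indicator (L y - L x) t * C)"
        by (intro integrable_mult_left integrable_real_indicator) (auto simp: emeasure_eq_measure)
      show "norm (indicator (L y - L x) t *\<^sub>R f i t) \<le> indicator (L y - L x) t * C" if "t \<in> space M" for t
        using C[OF that, of i] by (auto simp: indicator_def)
    qed
    also have "\<dots> = measure M (L y - L x) * C" by simp
    also have "measure M (L y - L x) = y * m - x * m"
      using finite_measure_Diff[of "L y" "L x"] sub L_measure xy by simp
    finally show ?thesis by (simp add: algebra_simps)
  qed
  have cont: "continuous_on {0..1} (\<Lambda> i)" for i
  proof (rule lipschitz_on_continuous_on[OF lipschitz_onI])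
    show "dist (\<Lambda> i x) (\<Lambda> i y) \<le> (C * m) * dist x y" if "x \<in> {0..1}" "y \<in> {0..1}" for x y
    proof (cases "x \<le> y")
      case True
      then show ?thesis using lip[of x y i] that by (simp add: dist_norm norm_minus_commute)
    next
      case False
      then show ?thesis using lip[of y x i] that by (simp add: dist_norm)
    qed
  qed (rule C0)
  have "\<exists>h\<in>borel_measurable M. (\<forall>t\<in>space M. \<exists>i<n. h t = f i t) \<and>
          integral\<^sup>L M h = (\<Sum>i<n. \<Lambda> i (S (Suc i)) - \<Lambda> i (S i))"
    if S: "S 0 = 0" "S n = 1" "\<forall>i<n. S i \<le> S (Suc i)" for S :: "nat \<Rightarrow> real"
  proof -
    have S_mono: "S i \<le> S j" if "i \<le> j" "j \<le> n" for i j
      using that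
    proof (induction j)
      case (Suc j)
      then show ?case using S(3) by (cases "i = Suc j") (auto intro: order_trans[of _ "S j"])
    qed simp
    define j where "j t = (LEAST i. U t \<le> S (Suc i))" for t
    have [measurable]: "j \<in> measurable M (count_space UNIV)" unfolding j_def by measurable
    have j_ex: "U t \<le> S (Suc (j t)) \<and> j t < n" if t: "t \<in> space M" for t
    proof -
      have "U t \<le> S (Suc (n - 1))" using U01 t n S(2) by simp
      then have "U t \<le> S (Suc (j t))" "j t \<le> n - 1"
        unfolding j_def by (rule LeastI, rule Least_le)
      then show ?thesis using n by linarith
    qed
    define h where "h t = f (j t) t" for t
    have h: "h \<in> borel_measurable M"
      unfolding h_def by (rule measurable_compose_countable[OF f]) measurable
    have eq: "h t = (\<Sum>i<n. indicator (L (S (Suc i))) t *\<^sub>R f i t - indicator (L (S i)) t *\<^sub>R f i t)"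
      if t: "t \<in> space M" and pos: "U t > 0" for t
    proof -
      have "(\<Sum>i<n. indicator (L (S (Suc i))) t *\<^sub>R f i t - indicator (L (S i)) t *\<^sub>R f i t)
          = (\<Sum>i<n. if i = j t then f i t else 0)"
      proof (rule sum.cong)
        fix i assume i: "i \<in> {..<n}"
        show "indicator (L (S (Suc i))) t *\<^sub>R f i t - indicator (L (S i)) t *\<^sub>R f i t
            = (if i = j t then f i t else 0)"
        proof (cases i "j t" rule: linorder_cases)
          case less
          then have "\<not> U t \<le> S (Suc i)" unfolding j_def by (rule not_less_Least)
          moreover have "S i \<le> S (Suc i)" using S(3) i by simp
          ultimately have "\<not> U t \<le> S i" by linarith
          then show ?thesis using less \<open>\<not> U t \<le> S (Suc i)\<close> by (simp add: L_def)
        next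
          case equal
          have "\<not> U t \<le> S i"
          proof (cases i)
            case 0
            then show ?thesis using S(1) pos by simp
          next
            case (Suc k)
            then have "k < j t" using equal by simp
            then have "\<not> U t \<le> S (Suc k)" unfolding j_def by (rule not_less_Least)
            then show ?thesis using Suc by simp
          qed
          then show ?thesis using equal j_ex[OF t] t by (simp add: L_def)
        next
          case greater
          have "U t \<le> S (Suc (j t))" using j_ex[OF t] by simp
          moreover have "S (Suc (j t)) \<le> S i" "S i \<le> S (Suc i)"
            using greater i by (auto intro!: S_mono)
          ultimately show ?thesis using t greater by (simp add: L_def)
        qed
      qed simp
      also have "\<dots> = f (j t) t" using j_ex[OF t] by simp
      finally show ?thesis by (simp add: h_def)
    qed
    have "AE t in M. U t > 0"
    proof -
      have "measure M (L 0) = 0" using L_measure[of 0] by simp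
      then have "L 0 \<in> null_sets M" by (simp add: null_sets_def emeasure_eq_measure)
      then have "AE t in M. t \<notin> L 0" by (rule AE_not_in)
      then show ?thesis
      proof (rule AE_mp, intro AE_I2 impI)
        fix t assume "t \<in> space M" "t \<notin> L 0"
        then show "U t > 0" by (simp add: L_def)
      qed
    qed
    then have "AE t in M. h t = (\<Sum>i<n. indicator (L (S (Suc i))) t *\<^sub>R f i t - indicator (L (S i)) t *\<^sub>R f i t)"
      by (rule AE_mp) (auto intro!: AE_I2 eq)
    then have "integral\<^sup>L M h
        = (LINT t|M. (\<Sum>i<n. indicator (L (S (Suc i))) t *\<^sub>R f i t - indicator (L (S i)) t *\<^sub>R f i t))"
      by (intro integral_cong_AE h) measurable
    also have "\<dots> = (\<Sum>i<n. \<Lambda> i (S (Suc i)) - \<Lambda> i (S i))"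
      unfolding \<Lambda>_def using int_L by (simp add: Bochner_Integration.integral_sum)
    finally show ?thesis using h j_ex unfolding h_def by (intro bexI[OF _ h[unfolded h_def]]) blast
  qed
  then show ?thesis using cont near by (intro exI[of _ \<Lambda>]) blast
qed

section \<open>Integrals of cluster selections\<close>

text \<open>
The bound \<open>C\<close> holds everywhere, not only almost everywhere, so that every such function is integrable without
a further hypothesis, and the functions can be combined pointwise.
\<close>

definition selection_integrals :: "'a measure \<Rightarrow> real \<Rightarrow> (nat \<Rightarrow> 'a \<Rightarrow> 'b::euclidean_space) \<Rightarrow> 'b set" where
  "selection_integrals M C f = {integral\<^sup>L M g | g. g \<in> borel_measurable M \<and>
     (\<forall>t\<in>space M. norm (g t) \<le> C) \<and> (AE t in M. cluster_point (\<lambda>k. f k t) (g t))}"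

lemma selection_integralsI:
  assumes "g \<in> borel_measurable M" "\<And>t. t \<in> space M \<Longrightarrow> norm (g t) \<le> C"
    and "AE t in M. cluster_point (\<lambda>k. f k t) (g t)"
  shows "integral\<^sup>L M g \<in> selection_integrals M C f"
  using assms unfolding selection_integrals_def by blast

lemma selection_integralsD:
  assumes "r \<in> selection_integrals M C f"
  shows "\<exists>g. g \<in> borel_measurable M \<and> (\<forall>t\<in>space M. norm (g t) \<le> C) \<and>
    (AE t in M. cluster_point (\<lambda>k. f k t) (g t)) \<and> r = integral\<^sup>L M g"
  using assms unfolding selection_integrals_def by blast

lemma cluster_point_norm_le:
  fixes s :: "nat \<Rightarrow> 'a::real_normed_vector"
  assumes "cluster_point s l" "\<And>k. norm (s k) \<le> C"
  shows "norm l \<le> C"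
  using cluster_point_in_closed[OF assms(1) closed_cball[of 0 C]] assms(2) by simp

lemma (in finite_measure) integrable_bounded:
  fixes g :: "'a \<Rightarrow> 'b::{banach, second_countable_topology}"
  assumes "g \<in> borel_measurable M" "\<And>t. t \<in> space M \<Longrightarrow> norm (g t) \<le> B"
  shows "integrable M g"
  using assms by (intro integrable_const_bound[of _ B]) auto

lemma sum_upto_double:
  fixes g :: "nat \<Rightarrow> 'b::comm_monoid_add"
  shows "(\<Sum>i<d + k. g i) = (\<Sum>i<d. g i) + (\<Sum>i<k. g (d + i))"
  by (induction k) (simp_all add: add.assoc)

text \<open>
A function that agrees at every point with one of finitely many cluster selections is a cluster selection.
\<close>

lemma (in finite_measure) selection_integrals_mixing:
  fixes f :: "nat \<Rightarrow> 'a \<Rightarrow> 'b::euclidean_space" and \<theta> :: "'a \<Rightarrow> real" and r :: "nat \<Rightarrow> 'b"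
  assumes \<theta>: "diffuse_coordinate M \<theta>"
    and r: "\<forall>i<n. r i \<in> selection_integrals M C f"
    and n: "n > 0" and e: "e > 0"
  shows "\<exists>\<Lambda> :: nat \<Rightarrow> real \<Rightarrow> 'b. (\<forall>i. continuous_on {0..1} (\<Lambda> i)) \<and>
    (\<forall>i<n. \<forall>x\<in>{0..1}. norm (\<Lambda> i x - x *\<^sub>R r i) \<le> e) \<and>
    (\<forall>S::nat \<Rightarrow> real. S 0 = 0 \<and> S n = 1 \<and> (\<forall>i<n. S i \<le> S (Suc i)) \<longrightarrow>
       (\<Sum>i<n. \<Lambda> i (S (Suc i)) - \<Lambda> i (S i)) \<in> selection_integrals M C f)"
proof -
  have "\<forall>i. \<exists>g. g \<in> borel_measurable M \<and> (\<forall>t\<in>space M. norm (g t) \<le> C) \<and>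
     (AE t in M. cluster_point (\<lambda>k. f k t) (g t)) \<and> (i < n \<longrightarrow> r i = integral\<^sup>L M g)"
  proof
    fix i
    have "(if i < n then r i else r 0) \<in> selection_integrals M C f" using r n by simp
    from selection_integralsD[OF this] show "\<exists>g. g \<in> borel_measurable M \<and> (\<forall>t\<in>space M. norm (g t) \<le> C) \<and>
     (AE t in M. cluster_point (\<lambda>k. f k t) (g t)) \<and> (i < n \<longrightarrow> r i = integral\<^sup>L M g)"
      by auto
  qed
  from choice[OF this] obtain g where g: "\<And>i. g i \<in> borel_measurable M"
    "\<forall>i. \<forall>t\<in>space M. norm (g i t) \<le> C"
    "\<And>i. AE t in M. cluster_point (\<lambda>k. f k t) (g i t)" "\<And>i. i < n \<Longrightarrow> r i = integral\<^sup>L M (g i)"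
    by blast
  obtain \<Lambda> :: "nat \<Rightarrow> real \<Rightarrow> 'b" where cont: "\<forall>i. continuous_on {0..1} (\<Lambda> i)"
    and near: "\<forall>i<n. \<forall>x\<in>{0..1}. norm (\<Lambda> i x - x *\<^sub>R integral\<^sup>L M (g i)) \<le> e"
    and ex: "\<forall>S::nat \<Rightarrow> real. S 0 = 0 \<and> S n = 1 \<and> (\<forall>i<n. S i \<le> S (Suc i)) \<longrightarrow>
       (\<exists>h\<in>borel_measurable M. (\<forall>t\<in>space M. \<exists>i<n. h t = g i t) \<and>
          integral\<^sup>L M h = (\<Sum>i<n. \<Lambda> i (S (Suc i)) - \<Lambda> i (S i)))"
    using continuous_approximate_mixing[OF \<theta> g(1) g(2) n e] by (elim exE conjE)
  have "(\<Sum>i<n. \<Lambda> i (S (Suc i)) - \<Lambda> i (S i)) \<in> selection_integrals M C f"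
    if S: "S 0 = 0 \<and> S n = 1 \<and> (\<forall>i<n. S i \<le> S (Suc i))" for S
  proof -
    obtain h where h: "h \<in> borel_measurable M" "\<And>t. t \<in> space M \<Longrightarrow> \<exists>i<n. h t = g i t"
      "integral\<^sup>L M h = (\<Sum>i<n. \<Lambda> i (S (Suc i)) - \<Lambda> i (S i))"
      using ex S by blast
    have "AE t in M. \<forall>i. cluster_point (\<lambda>k. f k t) (g i t)"
      using g(3) by (simp add: AE_all_countable)
    then have "AE t in M. cluster_point (\<lambda>k. f k t) (h t)"
    proof (rule AE_mp, intro AE_I2 impI)
      fix t assume "t \<in> space M" "\<forall>i. cluster_point (\<lambda>k. f k t) (g i t)"
      then show "cluster_point (\<lambda>k. f k t) (h t)" using h(2)[of t] by auto
    qed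
    moreover have "norm (h t) \<le> C" if "t \<in> space M" for t
      using h(2)[OF that] g(2) that by auto
    ultimately have "integral\<^sup>L M h \<in> selection_integrals M C f"
      by (intro selection_integralsI h(1))
    then show ?thesis using h(3) by simp
  qed
  then show ?thesis using cont near g(4) by (intro exI[of _ \<Lambda>]) auto
qed

lemma convex_closure_if_segments_in_closure:
  fixes R :: "'b::real_normed_vector set"
  assumes seg: "\<And>x y u. x \<in> R \<Longrightarrow> y \<in> R \<Longrightarrow> 0 \<le> u \<Longrightarrow> u \<le> 1 \<Longrightarrow> (1 - u) *\<^sub>R x + u *\<^sub>R y \<in> closure R"
  shows "convex (closure R)"
proof (unfold convex_alt, intro ballI allI impI)
  fix x y and u :: real assume xy: "x \<in> closure R" "y \<in> closure R" and u: "0 \<le> u \<and> u \<le> 1"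
  obtain X Y where X: "\<And>n. X n \<in> R" "X \<longlonglongrightarrow> x" and Y: "\<And>n. Y n \<in> R" "Y \<longlonglongrightarrow> y"
    using xy unfolding closure_sequential by blast
  have lim: "(\<lambda>n. (1 - u) *\<^sub>R X n + u *\<^sub>R Y n) \<longlonglongrightarrow> (1 - u) *\<^sub>R x + u *\<^sub>R y"
    by (intro tendsto_intros X Y)
  show "(1 - u) *\<^sub>R x + u *\<^sub>R y \<in> closure R"
    by (rule closed_sequentially[OF closed_closure _ lim]) (use seg X Y u in simp)
qed

text \<open>
Two selections are mixed at the single cut point \<open>1 - u\<close>; four values of \<open>\<Lambda>\<close> enter, each with error \<open>e / 5\<close>.
\<close>

lemma (in finite_measure) convex_closure_selection_integrals:
  fixes f :: "nat \<Rightarrow> 'a \<Rightarrow> 'b::euclidean_space" and \<theta> :: "'a \<Rightarrow> real"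
  assumes \<theta>: "diffuse_coordinate M \<theta>"
  shows "convex (closure (selection_integrals M C f))"
proof (rule convex_closure_if_segments_in_closure)
  fix x y and u :: real
  assume xy: "x \<in> selection_integrals M C f" "y \<in> selection_integrals M C f" and u: "0 \<le> u" "u \<le> 1"
  show "(1 - u) *\<^sub>R x + u *\<^sub>R y \<in> closure (selection_integrals M C f)"
    unfolding closure_approachable
  proof (intro allI impI)
    fix e :: real assume e: "e > 0"
    define r where "r i = (if i = 0 then x else y)" for i :: nat
    have r: "\<forall>i<2. r i \<in> selection_integrals M C f" using xy by (simp add: r_def)
    have e5: "e / 5 > 0" using e by simp
    obtain \<Lambda> :: "nat \<Rightarrow> real \<Rightarrow> 'b" where "\<forall>i. continuous_on {0..1} (\<Lambda> i)" and
      near: "\<forall>i<2. \<forall>x\<in>{0..1}. norm (\<Lambda> i x - x *\<^sub>R r i) \<le> e / 5"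
      and ex: "\<forall>S::nat \<Rightarrow> real. S 0 = 0 \<and> S 2 = 1 \<and> (\<forall>i<2. S i \<le> S (Suc i)) \<longrightarrow>
       (\<Sum>i<2. \<Lambda> i (S (Suc i)) - \<Lambda> i (S i)) \<in> selection_integrals M C f"
      using selection_integrals_mixing[OF \<theta> r pos2 e5] by (elim exE conjE)
    define S where "S i = (if i = 0 then 0 else if i = 1 then 1 - u else 1)" for i :: nat
    have "S 0 = 0 \<and> S 2 = 1 \<and> (\<forall>i<2. S i \<le> S (Suc i))"
      using u by (auto simp: S_def)
    then have "(\<Sum>i<2. \<Lambda> i (S (Suc i)) - \<Lambda> i (S i)) \<in> selection_integrals M C f"
      using ex by blast
    moreover have "(\<Sum>i<2. \<Lambda> i (S (Suc i)) - \<Lambda> i (S i)) = \<Lambda> 0 (1 - u) - \<Lambda> 0 0 + (\<Lambda> 1 1 - \<Lambda> 1 (1 - u))"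
      by (simp add: S_def numeral_2_eq_2)
    moreover have "dist (\<Lambda> 0 (1 - u) - \<Lambda> 0 0 + (\<Lambda> 1 1 - \<Lambda> 1 (1 - u))) ((1 - u) *\<^sub>R x + u *\<^sub>R y) < e"
    proof -
      have 1: "norm (\<Lambda> 0 (1 - u) - (1 - u) *\<^sub>R x) \<le> e / 5" "norm (\<Lambda> 0 0 - 0) \<le> e / 5"
        "norm (\<Lambda> 1 1 - y) \<le> e / 5" "norm (\<Lambda> 1 (1 - u) - (1 - u) *\<^sub>R y) \<le> e / 5"
        using near[rule_format, of 0 "1 - u"] near[rule_format, of 0 0]
          near[rule_format, of 1 1] near[rule_format, of 1 "1 - u"] u by (auto simp: r_def)
      have "\<Lambda> 0 (1 - u) - \<Lambda> 0 0 + (\<Lambda> 1 1 - \<Lambda> 1 (1 - u)) - ((1 - u) *\<^sub>R x + u *\<^sub>R y)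
          = ((\<Lambda> 0 (1 - u) - (1 - u) *\<^sub>R x) - (\<Lambda> 0 0 - 0)) + ((\<Lambda> 1 1 - y) - (\<Lambda> 1 (1 - u) - (1 - u) *\<^sub>R y))"
        by (simp add: algebra_simps)
      also have "norm \<dots> \<le> (e / 5 + e / 5) + (e / 5 + e / 5)"
        by (intro norm_triangle_mono order_trans[OF norm_triangle_ineq4] add_mono 1)
      finally show ?thesis using e by (simp add: dist_norm)
    qed
    ultimately show "\<exists>z\<in>selection_integrals M C f. dist z ((1 - u) *\<^sub>R x + u *\<^sub>R y) < e"
      by metis
  qed
qed

lemma norm_diff_add_le:
  fixes x y z :: "'b::real_normed_vector"
  assumes "norm x \<le> a" "norm y \<le> b" "norm z \<le> c"
  shows "norm (x - y + z) \<le> a + b + c"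
  using norm_triangle_ineq[of "x - y" z] norm_triangle_ineq4[of x y] assms by linarith

text \<open>
Around a relative interior point \<open>P\<close> of the closure there is a cross-polytope in its affine hull whose
vertices are approximated by integrals \<open>r i\<close> of cluster selections. Every point \<open>a\<close> of a small ball \<open>K\<close> about
\<open>P\<close> is a convex combination of the vertices with weights that are affine in \<open>a\<close>. Mixing the selections with
these weights yields a continuous map \<open>\<Psi>\<close> from \<open>K\<close> into the set of integrals which is near the identity, and
by Brouwer's theorem the value \<open>P\<close> is attained exactly.
\<close>

proposition (in finite_measure) rel_interior_closure_selection_integrals:
  fixes f :: "nat \<Rightarrow> 'a \<Rightarrow> 'b::euclidean_space" and \<theta> :: "'a \<Rightarrow> real"
  assumes \<theta>: "diffuse_coordinate M \<theta>"
    and P: "P \<in> rel_interior (closure (selection_integrals M C f))"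
  shows "P \<in> selection_integrals M C f"
proof -
  define R where "R = selection_integrals M C f"
  define H where "H = affine hull (closure R)"
  obtain e where e: "e > 0" "cball P e \<inter> H \<subseteq> closure R" and PR: "P \<in> closure R"
    using P unfolding mem_rel_interior_cball R_def H_def by blast
  have RH: "R \<subseteq> H" unfolding H_def by (meson closure_subset hull_subset order_trans)
  have PH: "P \<in> H" using PR hull_subset unfolding H_def by fast
  have affH: "affine H" unfolding H_def by (rule affine_affine_hull)
  have "subspace ((\<lambda>x. x - P) ` H)" by (rule affine_diffs_subspace_subtract[OF affH PH])
  then obtain B where B: "B \<subseteq> (\<lambda>x. x - P) ` H" "pairwise orthogonal B"
    "\<And>x. x \<in> B \<Longrightarrow> norm x = 1" "independent B" "span B = (\<lambda>x. x - P) ` H"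
    by (rule orthonormal_basis_subspace) blast
  have finB: "finite B" using B(4) by (rule independent_imp_finite)
  define d where "d = card B"
  obtain b where b: "bij_betw b {..<d} B"
    using ex_bij_betw_nat_finite[OF finB] unfolding d_def atLeast0LessThan by blast
  have expand: "(\<Sum>i<d. ((a - P) \<bullet> b i) *\<^sub>R b i) = a - P" if "a \<in> H" for a
  proof -
    have "a - P \<in> span B" using B(5) that by blast
    from orthonormal_basis_expand[OF B(2,3) this finB]
    have "(\<Sum>x\<in>B. ((a - P) \<bullet> x) *\<^sub>R x) = a - P" by simp
    then show ?thesis using sum.reindex_bij_betw[OF b, of "\<lambda>x. ((a - P) \<bullet> x) *\<^sub>R x"] by simp
  qed
  show ?thesis
  proof (cases "d = 0")
    case True
    have "a = P" if "a \<in> H" for a using expand[OF that] True by simp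
    moreover have "R \<noteq> {}" using PR by auto
    ultimately have "P \<in> R" using RH by (metis ex_in_conv subsetD)
    then show ?thesis by (simp add: R_def)
  next
    case False
    then have d: "d > 0" by simp
    define n where "n = d + d"
    have n: "n > 0" using d by (simp add: n_def)
    \<comment> \<open>The signed basis vectors: \<open>P\<close> is the centre of the cross-polytope with vertices \<open>P + e v i\<close>.\<close>
    define v where "v i = (if i < d then b i else - b (i - d))" for i
    have bB: "b i \<in> B" if "i < d" for i using b that by (auto simp: bij_betw_def)
    have v1: "norm (v i) = 1" if "i < n" for i
      using B(3) bB that by (auto simp: v_def n_def)
    have v_dir: "\<exists>x\<in>H. v i = x - P \<or> v i = P - x" if "i < n" for i
    proof -
      have "\<exists>j<d. v i = b j \<or> v i = - b j"
      proof (cases "i < d")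
        case False
        then have "i - d < d" using that by (simp add: n_def)
        then show ?thesis using False by (intro exI[of _ "i - d"]) (simp add: v_def)
      qed (auto simp: v_def)
      then obtain j where j: "j < d" "v i = b j \<or> v i = - b j" by blast
      obtain x where "x \<in> H" "b j = x - P" using bB[OF j(1)] B(1) by blast
      then show ?thesis using j(2) by auto
    qed
    have vH: "P + e *\<^sub>R v i \<in> H" if "i < n" for i
    proof -
      from v_dir[OF that] obtain x where x: "x \<in> H" "v i = x - P \<or> v i = P - x" by blast
      then show ?thesis
        using mem_affine_3_minus[OF affH PH x(1) PH, of e] mem_affine_3_minus[OF affH PH PH x(1), of e] by auto
    qed
    have vR: "P + e *\<^sub>R v i \<in> closure R" if "i < n" for i
      using e vH[OF that] v1[OF that] by (auto simp: dist_norm intro!: subsetD[OF e(2)])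
    define \<rho> where "\<rho> = e / d"
    have \<rho>: "\<rho> > 0" using e d by (simp add: \<rho>_def)
    have "\<forall>i. \<exists>r. i < n \<longrightarrow> r \<in> R \<and> dist r (P + e *\<^sub>R v i) < \<rho> / 2"
      using vR \<rho> unfolding closure_approachable by (meson half_gt_zero)
    from choice[OF this] obtain r where r: "\<And>i. i < n \<Longrightarrow> r i \<in> R"
      "\<And>i. i < n \<Longrightarrow> dist (r i) (P + e *\<^sub>R v i) < \<rho> / 2" by blast
    have rR: "\<forall>i<n. r i \<in> selection_integrals M C f" using r(1) by (simp add: R_def)
    define e' where "e' = \<rho> / (4 * n)"
    have e': "e' > 0" using \<rho> n by (simp add: e'_def)
    obtain \<Lambda> :: "nat \<Rightarrow> real \<Rightarrow> 'b" where cont: "\<forall>i. continuous_on {0..1} (\<Lambda> i)"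
      and near: "\<forall>i<n. \<forall>x\<in>{0..1}. norm (\<Lambda> i x - x *\<^sub>R r i) \<le> e'"
      and mix: "\<forall>S::nat \<Rightarrow> real. S 0 = 0 \<and> S n = 1 \<and> (\<forall>i<n. S i \<le> S (Suc i)) \<longrightarrow>
         (\<Sum>i<n. \<Lambda> i (S (Suc i)) - \<Lambda> i (S i)) \<in> selection_integrals M C f"
      using selection_integrals_mixing[OF \<theta> rR n e'] by (elim exE conjE)
    define K where "K = cball P \<rho> \<inter> H"
    \<comment> \<open>Barycentric coordinates of \<open>a\<close> with respect to the vertices; they are nonnegative within the radius \<open>\<rho> = e / d\<close>.\<close>
    define \<alpha> where "\<alpha> i a = (1 + ((a - P) \<bullet> v i) / \<rho>) / n" for i :: nat and a
    define S where "S i a = (\<Sum>k<i. \<alpha> k a)" for i :: nat and a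
    have sum_v: "(\<Sum>i<n. g i *\<^sub>R v i) = (\<Sum>i<d. (g i - g (d + i)) *\<^sub>R b i)" for g :: "nat \<Rightarrow> real"
    proof -
      have "(\<Sum>i<n. g i *\<^sub>R v i) = (\<Sum>i<d. g i *\<^sub>R v i) + (\<Sum>i<d. g (d + i) *\<^sub>R v (d + i))"
        unfolding n_def by (rule sum_upto_double)
      also have "\<dots> = (\<Sum>i<d. g i *\<^sub>R b i) + (\<Sum>i<d. - (g (d + i) *\<^sub>R b i))"
        by (intro arg_cong2[of _ _ _ _ "(+)"] sum.cong) (auto simp: v_def)
      also have "\<dots> = (\<Sum>i<d. (g i - g (d + i)) *\<^sub>R b i)"
        by (simp add: scaleR_diff_left sum_negf sum_subtractf)
      finally show ?thesis .
    qed
    have v0: "(\<Sum>i<n. v i) = 0" using sum_v[of "\<lambda>_. 1"] by simp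
    have \<alpha>_sum: "(\<Sum>i<n. \<alpha> i a) = 1" for a
    proof -
      have "(\<Sum>i<n. \<alpha> i a) = (\<Sum>i<n. 1 + ((a - P) \<bullet> v i) / \<rho>) / n"
        by (simp add: \<alpha>_def sum_divide_distrib)
      also have "(\<Sum>i<n. 1 + ((a - P) \<bullet> v i) / \<rho>) = n + ((a - P) \<bullet> (\<Sum>i<n. v i)) / \<rho>"
        by (simp add: sum.distrib inner_sum_right sum_divide_distrib)
      finally show ?thesis using n v0 by simp
    qed
    have bary: "(\<Sum>i<n. \<alpha> i a *\<^sub>R (P + e *\<^sub>R v i)) = a" if a: "a \<in> H" for a
    proof -
      have "(\<Sum>i<n. \<alpha> i a *\<^sub>R (P + e *\<^sub>R v i)) = (\<Sum>i<n. \<alpha> i a) *\<^sub>R P + e *\<^sub>R (\<Sum>i<n. \<alpha> i a *\<^sub>R v i)"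
        by (simp add: scaleR_add_right sum.distrib scaleR_sum_left scaleR_sum_right mult.commute)
      also have "(\<Sum>i<n. \<alpha> i a *\<^sub>R v i) = (\<Sum>i<d. (2 * ((a - P) \<bullet> b i) / (\<rho> * n)) *\<^sub>R b i)"
        unfolding sum_v
      proof (intro sum.cong refl arg_cong2[of _ _ _ _ scaleR])
        fix i assume i: "i \<in> {..<d}"
        have "v i = b i" "v (d + i) = - b i" using i by (simp_all add: v_def)
        then show "\<alpha> i a - \<alpha> (d + i) a = 2 * ((a - P) \<bullet> b i) / (\<rho> * n)"
          using \<rho> n by (simp add: \<alpha>_def field_simps)
      qed
      also have "e *\<^sub>R \<dots> = (\<Sum>i<d. ((a - P) \<bullet> b i) *\<^sub>R b i)"
      proof -
        have "e * (2 * c / (\<rho> * n)) = c" for c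
          using e d by (simp add: \<rho>_def n_def field_simps)
        then show ?thesis by (simp add: scaleR_sum_right)
      qed
      finally show ?thesis by (simp add: \<alpha>_sum expand[OF a])
    qed
    have \<alpha>_nonneg: "\<alpha> i a \<ge> 0" if a: "a \<in> K" and i: "i < n" for a i
    proof -
      have "\<bar>(a - P) \<bullet> v i\<bar> \<le> norm (a - P) * norm (v i)" by (rule Cauchy_Schwarz_ineq2)
      also have "\<dots> \<le> \<rho>" using a v1[OF i] by (simp add: K_def dist_norm norm_minus_commute)
      finally have "- \<rho> \<le> (a - P) \<bullet> v i" by linarith
      then have "0 \<le> 1 + ((a - P) \<bullet> v i) / \<rho>" using \<rho> by (simp add: field_simps)
      then show ?thesis by (simp add: \<alpha>_def)
    qed
    have S_mono: "S i a \<le> S j a" if "a \<in> K" "i \<le> j" "j \<le> n" for a i j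
      unfolding S_def using that \<alpha>_nonneg by (intro sum_mono2) auto
    have S0: "S 0 a = 0" and Sn: "S n a = 1" for a
      by (simp_all add: S_def \<alpha>_sum)
    have S01: "S i a \<in> {0..1}" if "a \<in> K" "i \<le> n" for a i
      using S_mono[of a 0 i] S_mono[of a i n] that by (simp add: S0 Sn)
    define \<Psi> where "\<Psi> a = (\<Sum>i<n. \<Lambda> i (S (Suc i) a) - \<Lambda> i (S i a))" for a
    have \<Psi>R: "\<Psi> a \<in> R" if "a \<in> K" for a
      unfolding \<Psi>_def R_def using mix[rule_format, of "\<lambda>i. S i a"] S0 Sn S_mono[OF that] by simp
    have S_cont: "continuous_on K (S i)" for i
      unfolding S_def \<alpha>_def using \<rho> n by (intro continuous_intros) auto
    have \<Lambda>S: "continuous_on K (\<lambda>a. \<Lambda> i (S j a))" if "j \<le> n" for i j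
      by (rule continuous_on_compose2[OF cont[rule_format] S_cont]) (use S01 that in blast)
    have \<Psi>_cont: "continuous_on K \<Psi>"
      unfolding \<Psi>_def by (intro continuous_on_sum continuous_on_diff \<Lambda>S) auto
    have \<Psi>_near: "norm (\<Psi> a - a) \<le> \<rho>" if a: "a \<in> K" for a
    proof -
      have aH: "a \<in> H" using a by (simp add: K_def)
      have "\<Psi> a - a = (\<Sum>i<n. (\<Lambda> i (S (Suc i) a) - S (Suc i) a *\<^sub>R r i) - (\<Lambda> i (S i a) - S i a *\<^sub>R r i)
          + \<alpha> i a *\<^sub>R (r i - (P + e *\<^sub>R v i)))"
      proof -
        have eqi: "(\<Lambda> i (S (Suc i) a) - S (Suc i) a *\<^sub>R r i) - (\<Lambda> i (S i a) - S i a *\<^sub>R r i)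
          + \<alpha> i a *\<^sub>R (r i - (P + e *\<^sub>R v i)) = (\<Lambda> i (S (Suc i) a) - \<Lambda> i (S i a)) - \<alpha> i a *\<^sub>R (P + e *\<^sub>R v i)" for i
          by (simp add: S_def algebra_simps)
        show ?thesis unfolding eqi sum_subtractf bary[OF aH] \<Psi>_def by (rule refl)
      qed
      also have "norm \<dots> \<le> (\<Sum>i<n. (e' + e') + \<alpha> i a * (\<rho> / 2))"
      proof (rule sum_norm_le)
        fix i assume "i \<in> {..<n}"
        then have i: "i < n" by simp
        have "norm (\<Lambda> i (S (Suc i) a) - S (Suc i) a *\<^sub>R r i) \<le> e'" "norm (\<Lambda> i (S i a) - S i a *\<^sub>R r i) \<le> e'"
          using near i S01[OF a] by simp_all
        moreover have "norm (\<alpha> i a *\<^sub>R (r i - (P + e *\<^sub>R v i))) \<le> \<alpha> i a * (\<rho> / 2)"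
        proof -
          have "norm (r i - (P + e *\<^sub>R v i)) \<le> \<rho> / 2" using r(2)[OF i] by (simp add: dist_norm)
          then have "\<alpha> i a * norm (r i - (P + e *\<^sub>R v i)) \<le> \<alpha> i a * (\<rho> / 2)"
            by (rule mult_left_mono) (rule \<alpha>_nonneg[OF a i])
          then show ?thesis using \<alpha>_nonneg[OF a i] by (simp only: norm_scaleR abs_of_nonneg)
        qed
        ultimately show "norm ((\<Lambda> i (S (Suc i) a) - S (Suc i) a *\<^sub>R r i) - (\<Lambda> i (S i a) - S i a *\<^sub>R r i)
          + \<alpha> i a *\<^sub>R (r i - (P + e *\<^sub>R v i))) \<le> (e' + e') + \<alpha> i a * (\<rho> / 2)"
          by (rule norm_diff_add_le)
      qed
      also have "\<dots> = real n * (e' + e') + (\<Sum>i<n. \<alpha> i a) * (\<rho> / 2)"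
        by (simp add: sum.distrib sum_distrib_right)
      also have "\<dots> = \<rho>" using n by (simp add: \<alpha>_sum e'_def)
      finally show ?thesis .
    qed
    \<comment> \<open>\<open>\<Psi>\<close> moves no point of the ball \<open>K\<close> by more than its radius, so it attains the centre.\<close>
    have "closed H" by (simp add: H_def)
    then have "compact K" unfolding K_def by (intro compact_Int_closed) auto
    moreover have "convex K" unfolding K_def by (rule convex_Int[OF convex_cball affine_imp_convex[OF affH]])
    moreover have "P \<in> K" using PH \<rho> by (simp add: K_def)
    then have "K \<noteq> {}" by blast
    moreover have "continuous_on K (\<lambda>a. a + P - \<Psi> a)" by (intro continuous_intros \<Psi>_cont)
    moreover have "(\<lambda>a. a + P - \<Psi> a) \<in> K \<rightarrow> K"
    proof
      fix a assume a: "a \<in> K"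
      have "\<Psi> a \<in> H" using \<Psi>R[OF a] RH by blast
      moreover have "a \<in> H" using a by (simp add: K_def)
      ultimately have "a + 1 *\<^sub>R (P - \<Psi> a) \<in> H" by (intro mem_affine_3_minus affH PH)
      moreover have "dist P (a + P - \<Psi> a) = norm (\<Psi> a - a)"
        by (simp add: dist_norm)
      ultimately show "a + P - \<Psi> a \<in> K" using \<Psi>_near[OF a] by (simp add: K_def algebra_simps)
    qed
    ultimately obtain a where "a \<in> K" "a + P - \<Psi> a = a" by (rule brouwer)
    then have "P = \<Psi> a" by (simp add: algebra_simps)
    then show ?thesis using \<Psi>R[OF \<open>a \<in> K\<close>] by (simp add: R_def)
  qed
qed

text \<open>
For the cluster selection \<open>g\<close> that is extreme in the direction \<open>q\<close>, the positive part of \<open>q \<bullet> (f k - g)\<close>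
tends to zero and is bounded, so its integral tends to zero: this is the reverse Fatou lemma, and it gives
\<open>q \<bullet> P \<le> q \<bullet> \<integral>g\<close>. If equality holds, the negative part has vanishing integral too; then \<open>q \<bullet> f k\<close>
converges to \<open>q \<bullet> g\<close> in the mean, hence almost everywhere along a subsequence.
\<close>

lemma (in finite_measure) selection_integral_in_direction:
  fixes f :: "nat \<Rightarrow> 'a \<Rightarrow> 'b::euclidean_space"
  assumes f: "\<And>k. f k \<in> borel_measurable M"
    and bound: "\<forall>k. \<forall>t\<in>space M. norm (f k t) \<le> C"
    and lim: "(\<lambda>k. integral\<^sup>L M (f k)) \<longlonglongrightarrow> P"
  shows "\<exists>g\<in>borel_measurable M. (\<forall>t\<in>space M. norm (g t) \<le> C) \<and>
           (\<forall>t\<in>space M. cluster_point (\<lambda>k. f k t) (g t)) \<and> q \<bullet> P \<le> q \<bullet> integral\<^sup>L M g \<and>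
           (q \<bullet> integral\<^sup>L M g \<le> q \<bullet> P \<longrightarrow>
              (\<exists>r. strict_mono r \<and> (AE t in M. (\<lambda>k. q \<bullet> f (r k) t) \<longlonglongrightarrow> q \<bullet> g t)))"
proof -
  have bdd: "bounded (range (\<lambda>k. f k t))" if "t \<in> space M" for t
    using bound that by (auto simp: bounded_iff)
  obtain g where g[measurable]: "g \<in> borel_measurable M"
    and cl: "\<And>t. t \<in> space M \<Longrightarrow> cluster_point (\<lambda>k. f k t) (g t)"
    and up: "\<And>t e. t \<in> space M \<Longrightarrow> e > 0 \<Longrightarrow> \<forall>\<^sub>F k in sequentially. q \<bullet> f k t < q \<bullet> g t + e"
    using measurable_cluster_selection[OF f bdd, where q = q] by blast
  have gC: "norm (g t) \<le> C" if "t \<in> space M" for t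
    using cluster_point_norm_le[OF cl[OF that]] bound that by blast
  note f[measurable]
  have int_f: "integrable M (f k)" for k
    by (rule integrable_bounded[OF f, of _ C]) (use bound in blast)
  have int_g: "integrable M g" by (rule integrable_bounded[OF g gC])
  define \<phi> where "\<phi> k t = max 0 (q \<bullet> f k t - q \<bullet> g t)" for k t
  have \<phi>m[measurable]: "\<phi> k \<in> borel_measurable M" for k unfolding \<phi>_def by measurable
  have \<phi>_le: "norm (\<phi> k t) \<le> 2 * (norm q * C)" if t: "t \<in> space M" for k t
  proof -
    have "\<bar>q \<bullet> f k t\<bar> \<le> norm q * norm (f k t)" "\<bar>q \<bullet> g t\<bar> \<le> norm q * norm (g t)"
      by (rule Cauchy_Schwarz_ineq2)+
    moreover have "norm q * norm (f k t) \<le> norm q * C" "norm q * norm (g t) \<le> norm q * C"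
      using bound gC t by (auto intro!: mult_left_mono)
    ultimately have "\<bar>q \<bullet> f k t\<bar> \<le> norm q * C" "\<bar>q \<bullet> g t\<bar> \<le> norm q * C" by linarith+
    then show ?thesis unfolding \<phi>_def by auto
  qed
  have int_\<phi>: "integrable M (\<phi> k)" for k by (rule integrable_bounded[OF \<phi>m \<phi>_le])
  have \<phi>_lim: "(\<lambda>k. \<phi> k t) \<longlonglongrightarrow> 0" if t: "t \<in> space M" for t
  proof (rule tendstoI)
    fix e :: real assume "e > 0"
    with up[OF t this] show "\<forall>\<^sub>F k in sequentially. dist (\<phi> k t) 0 < e"
      by (auto elim!: eventually_mono simp: \<phi>_def)
  qed
  have "(\<lambda>k. integral\<^sup>L M (\<phi> k)) \<longlonglongrightarrow> integral\<^sup>L M (\<lambda>_. 0)"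
  proof (rule integral_dominated_convergence)
    show "AE t in M. (\<lambda>k. \<phi> k t) \<longlonglongrightarrow> 0" by (intro AE_I2 \<phi>_lim)
    show "AE t in M. norm (\<phi> k t) \<le> 2 * (norm q * C)" for k by (intro AE_I2 \<phi>_le)
  qed auto
  then have \<phi>0: "(\<lambda>k. integral\<^sup>L M (\<phi> k)) \<longlonglongrightarrow> 0" by simp
  have le: "q \<bullet> integral\<^sup>L M (f k) \<le> q \<bullet> integral\<^sup>L M g + integral\<^sup>L M (\<phi> k)" for k
  proof -
    have "q \<bullet> integral\<^sup>L M (f k) = (LINT t|M. q \<bullet> f k t)" using int_f by simp
    also have "\<dots> \<le> (LINT t|M. q \<bullet> g t + \<phi> k t)"
      using int_f int_g int_\<phi> by (intro integral_mono) (auto simp: \<phi>_def)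
    also have "\<dots> = q \<bullet> integral\<^sup>L M g + integral\<^sup>L M (\<phi> k)" using int_g int_\<phi> by simp
    finally show ?thesis .
  qed
  have qlim: "(\<lambda>k. q \<bullet> integral\<^sup>L M (f k)) \<longlonglongrightarrow> q \<bullet> P"
    by (intro tendsto_inner tendsto_const lim)
  have rhs: "(\<lambda>k. q \<bullet> integral\<^sup>L M g + integral\<^sup>L M (\<phi> k)) \<longlonglongrightarrow> q \<bullet> integral\<^sup>L M g + 0"
    by (rule tendsto_add[OF tendsto_const \<phi>0])
  have ge: "q \<bullet> P \<le> q \<bullet> integral\<^sup>L M g"
    using LIMSEQ_le[OF qlim rhs] le by auto
  have "\<exists>r. strict_mono r \<and> (AE t in M. (\<lambda>k. q \<bullet> f (r k) t) \<longlonglongrightarrow> q \<bullet> g t)"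
    if "q \<bullet> integral\<^sup>L M g \<le> q \<bullet> P"
  proof -
    have eq: "q \<bullet> integral\<^sup>L M g = q \<bullet> P" using ge that by simp
    define u where "u k t = q \<bullet> f k t - q \<bullet> g t" for k t
    have int_u: "integrable M (u k)" for k
      unfolding u_def using int_f int_g by auto
    have "(LINT t|M. norm (u k t)) = 2 * integral\<^sup>L M (\<phi> k) - (q \<bullet> integral\<^sup>L M (f k) - q \<bullet> integral\<^sup>L M g)" for k
    proof -
      have "(LINT t|M. norm (u k t)) = (LINT t|M. 2 * \<phi> k t - (q \<bullet> f k t - q \<bullet> g t))"
        by (intro Bochner_Integration.integral_cong) (auto simp: u_def \<phi>_def max_def)
      then show ?thesis using int_f int_g int_\<phi> by simp
    qed
    moreover have "(\<lambda>k. 2 * integral\<^sup>L M (\<phi> k) - (q \<bullet> integral\<^sup>L M (f k) - q \<bullet> integral\<^sup>L M g))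
        \<longlonglongrightarrow> 2 * 0 - (q \<bullet> P - q \<bullet> integral\<^sup>L M g)"
      by (intro tendsto_diff tendsto_mult tendsto_const \<phi>0 qlim)
    ultimately have "(\<lambda>k. LINT t|M. norm (u k t)) \<longlonglongrightarrow> 0" using eq by simp
    from tendsto_L1_AE_subseq[OF int_u this]
    obtain r where "strict_mono r" and r: "AE t in M. (\<lambda>k. u (r k) t) \<longlonglongrightarrow> 0" by blast
    moreover have "AE t in M. (\<lambda>k. q \<bullet> f (r k) t) \<longlonglongrightarrow> q \<bullet> g t"
      using r by eventually_elim (simp add: u_def LIM_zero_iff)
    ultimately show ?thesis by blast
  qed
  then show ?thesis using g cl gC ge by (intro bexI[OF _ g]) blast
qed

text \<open>
A hyperplane that strictly separates \<open>P\<close> from the convex closure of the set \<open>R\<close> of integrals would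
contradict the existence of a selection that is extreme in the normal direction; hence \<open>P\<close> lies in the
closure. In its relative interior
\<open>rel_interior_closure_selection_integrals\<close> applies. Otherwise there is a supporting
hyperplane at \<open>P\<close> that does not contain \<open>R\<close>. A selection that is extreme in its normal direction must have
its integral on the hyperplane, so by the equality case a subsequence converges in this direction, and all
its cluster selections have their integrals on the hyperplane. The affine dimension has dropped, and the
induction hypothesis applies to the subsequence.
\<close>

theorem (in finite_measure) selection_integrals_closed_diffuse:
  fixes f :: "nat \<Rightarrow> 'a \<Rightarrow> 'b::euclidean_space" and \<theta> :: "'a \<Rightarrow> real"
  assumes \<theta>: "diffuse_coordinate M \<theta>"
    and f: "\<forall>k. f k \<in> borel_measurable M"
    and bound: "\<forall>k. \<forall>t\<in>space M. norm (f k t) \<le> C"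
    and lim: "(\<lambda>k. integral\<^sup>L M (f k)) \<longlonglongrightarrow> P"
  shows "P \<in> selection_integrals M C f"
  using f bound lim
proof (induction "nat (aff_dim (selection_integrals M C f) + 1)" arbitrary: f rule: less_induct)
  case less
  define R where "R = selection_integrals M C f"
  have conv: "convex (closure R)"
    unfolding R_def by (rule convex_closure_selection_integrals[OF \<theta>])
  have dir: "\<exists>g\<in>borel_measurable M. (\<forall>t\<in>space M. norm (g t) \<le> C) \<and>
           (\<forall>t\<in>space M. cluster_point (\<lambda>k. f k t) (g t)) \<and> q \<bullet> P \<le> q \<bullet> integral\<^sup>L M g \<and>
           (q \<bullet> integral\<^sup>L M g \<le> q \<bullet> P \<longrightarrow>
              (\<exists>r. strict_mono r \<and> (AE t in M. (\<lambda>k. q \<bullet> f (r k) t) \<longlonglongrightarrow> q \<bullet> g t)))" for q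
    using selection_integral_in_direction[OF less.prems(1)[rule_format] less.prems(2,3), of q] .
  have PR: "P \<in> closure R"
  proof (rule ccontr)
    assume "P \<notin> closure R"
    from separating_hyperplane_closed_point[OF conv closed_closure this]
    obtain a b where ab: "a \<bullet> P < b" "\<forall>x\<in>closure R. b < a \<bullet> x" by blast
    obtain g where g: "g \<in> borel_measurable M" "\<forall>t\<in>space M. norm (g t) \<le> C"
      "\<forall>t\<in>space M. cluster_point (\<lambda>k. f k t) (g t)" "(- a) \<bullet> P \<le> (- a) \<bullet> integral\<^sup>L M g"
      using dir[of "- a"] by (elim bexE conjE)
    have "integral\<^sup>L M g \<in> R"
      unfolding R_def using g by (intro selection_integralsI AE_I2) auto
    then have "b < a \<bullet> integral\<^sup>L M g" using ab(2) closure_subset[of R] by blast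
    then show False using ab(1) g(4) by simp
  qed
  show ?case
  proof (cases "P \<in> rel_interior (closure R)")
    case True
    then show ?thesis unfolding R_def by (rule rel_interior_closure_selection_integrals[OF \<theta>])
  next
    case False
    obtain a where a: "\<And>x. x \<in> closure R \<Longrightarrow> a \<bullet> P \<le> a \<bullet> x"
      "\<And>x. x \<in> rel_interior (closure R) \<Longrightarrow> a \<bullet> P < a \<bullet> x"
      by (rule supporting_hyperplane_rel_boundary[OF conv PR False]) blast
    obtain g where g: "g \<in> borel_measurable M" "\<forall>t\<in>space M. norm (g t) \<le> C"
      "\<forall>t\<in>space M. cluster_point (\<lambda>k. f k t) (g t)" "(- a) \<bullet> P \<le> (- a) \<bullet> integral\<^sup>L M g"
      "(- a) \<bullet> integral\<^sup>L M g \<le> (- a) \<bullet> P \<longrightarrow>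
         (\<exists>r. strict_mono r \<and> (AE t in M. (\<lambda>k. (- a) \<bullet> f (r k) t) \<longlonglongrightarrow> (- a) \<bullet> g t))"
      using dir[of "- a"] by (elim bexE conjE)
    have gR: "integral\<^sup>L M g \<in> R"
      unfolding R_def using g by (intro selection_integralsI AE_I2) auto
    then have "a \<bullet> P \<le> a \<bullet> integral\<^sup>L M g" using a(1) closure_subset[of R] by blast
    then have "(- a) \<bullet> integral\<^sup>L M g \<le> (- a) \<bullet> P" by simp
    with g(5) obtain r where r: "strict_mono r"
      and AEr: "AE t in M. (\<lambda>k. (- a) \<bullet> f (r k) t) \<longlonglongrightarrow> (- a) \<bullet> g t" by blast
    have eq: "a \<bullet> integral\<^sup>L M g = a \<bullet> P"
      using g(4) \<open>a \<bullet> P \<le> a \<bullet> integral\<^sup>L M g\<close> by simp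
    have int_g: "integrable M g" using g(1,2) by (intro integrable_bounded[of g C]) auto
    define F where "F k = f (r k)" for k
    define R' where "R' = selection_integrals M C F"
    have R'R: "R' \<subseteq> R"
    proof
      fix x assume "x \<in> R'"
      from selection_integralsD[OF this[unfolded R'_def]]
      obtain h where h: "h \<in> borel_measurable M" "\<forall>t\<in>space M. norm (h t) \<le> C"
        "AE t in M. cluster_point (\<lambda>k. F k t) (h t)" "x = integral\<^sup>L M h"
        by (elim exE conjE)
      have "AE t in M. cluster_point (\<lambda>k. f k t) (h t)"
        using h(3) by eventually_elim (auto simp: F_def intro: cluster_point_subseq[OF r])
      then show "x \<in> R" unfolding R_def h(4) using h(1,2) by (intro selection_integralsI) auto
    qed
    have R'_face: "a \<bullet> x = a \<bullet> P" if "x \<in> R'" for x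
    proof -
      from selection_integralsD[OF that[unfolded R'_def]]
      obtain h where h: "h \<in> borel_measurable M" "\<forall>t\<in>space M. norm (h t) \<le> C"
        "AE t in M. cluster_point (\<lambda>k. F k t) (h t)" "x = integral\<^sup>L M h"
        by (elim exE conjE)
      have "AE t in M. a \<bullet> h t = a \<bullet> g t"
        using h(3) AEr
      proof eventually_elim
        fix t assume cl: "cluster_point (\<lambda>k. F k t) (h t)"
          and lim: "(\<lambda>k. (- a) \<bullet> f (r k) t) \<longlonglongrightarrow> (- a) \<bullet> g t"
        obtain q where q: "strict_mono q" "((\<lambda>k. F k t) \<circ> q) \<longlonglongrightarrow> h t"
          using cl unfolding cluster_point_def by blast
        have "(\<lambda>k. (- a) \<bullet> ((\<lambda>k. F k t) \<circ> q) k) \<longlonglongrightarrow> (- a) \<bullet> h t"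
          by (rule tendsto_inner[OF tendsto_const q(2)])
        moreover have "(\<lambda>k. (- a) \<bullet> ((\<lambda>k. F k t) \<circ> q) k) \<longlonglongrightarrow> (- a) \<bullet> g t"
          using LIMSEQ_subseq_LIMSEQ[OF lim q(1)] by (simp only: o_def F_def)
        ultimately have "(- a) \<bullet> h t = (- a) \<bullet> g t" by (rule LIMSEQ_unique)
        then show "a \<bullet> h t = a \<bullet> g t" by simp
      qed
      then have "(LINT t|M. a \<bullet> h t) = (LINT t|M. a \<bullet> g t)"
        using h(1) g(1) by (intro integral_cong_AE) auto
      moreover have "integrable M h" using h(1,2) by (intro integrable_bounded[of h C]) auto
      ultimately show ?thesis using int_g h(4) eq by simp
    qed
    have "nat (aff_dim R' + 1) < nat (aff_dim R + 1)"
    proof -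
      have "affine hull R' \<subseteq> affine hull R" by (rule hull_mono[OF R'R])
      moreover have "affine hull R' \<noteq> affine hull R"
      proof
        assume same: "affine hull R' = affine hull R"
        have "affine {x. a \<bullet> x = a \<bullet> P}" by (rule affine_hyperplane)
        then have "affine hull R' \<subseteq> {x. a \<bullet> x = a \<bullet> P}"
          using R'_face by (intro hull_minimal) auto
        then have flat: "affine hull R \<subseteq> {x. a \<bullet> x = a \<bullet> P}" using same by simp
        have "rel_interior (closure R) \<noteq> {}"
          using PR rel_interior_eq_empty[OF conv] by force
        then obtain x where x: "x \<in> rel_interior (closure R)" by blast
        have "x \<in> closure R" using subsetD[OF rel_interior_subset x] .
        then have "x \<in> affine hull R" using closure_affine_hull[of R] by blast
        then have "a \<bullet> x = a \<bullet> P" using flat by blast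
        then show False using a(2)[OF x] by simp
      qed
      ultimately have "aff_dim R' < aff_dim R" by (intro aff_dim_psubset) blast
      moreover have "aff_dim R' \<ge> -1" by (rule aff_dim_geq)
      ultimately show ?thesis by linarith
    qed
    then have small: "nat (aff_dim (selection_integrals M C F) + 1) < nat (aff_dim (selection_integrals M C f) + 1)"
      unfolding R_def R'_def .
    have "P \<in> R'"
      unfolding R'_def
    proof (rule less.hyps[OF small])
      show "(\<lambda>k. integral\<^sup>L M (F k)) \<longlonglongrightarrow> P"
        unfolding F_def using LIMSEQ_subseq_LIMSEQ[OF less.prems(3) r] by (simp only: o_def)
    qed (use less.prems(1,2) in \<open>simp_all add: F_def\<close>)
    then show ?thesis using R'R unfolding R_def by blast
  qed
qed

section \<open>Closedness over arbitrary finite measures\<close>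

text \<open>
Only the digits \<open>0\<close> and \<open>1\<close> occur, and the tail after position \<open>n\<close> sums to at most \<open>(1/3)^n / 2\<close>, so it
cannot compensate for a difference at position \<open>n\<close>. With base two this would fail.
\<close>

lemma ternary_digits_unique:
  fixes a b :: "nat \<Rightarrow> bool"
  assumes "(\<Sum>n. of_bool (a n) * (1/3)^n :: real) = (\<Sum>n. of_bool (b n) * (1/3)^n)"
  shows "a = b"
proof (rule ccontr)
  assume "a \<noteq> b"
  then have "\<exists>n. a n \<noteq> b n" by auto
  define n where "n = (LEAST n. a n \<noteq> b n)"
  have n: "a n \<noteq> b n" unfolding n_def using \<open>\<exists>n. a n \<noteq> b n\<close> by (rule LeastI_ex)
  have less: "a m = b m" if "m < n" for m using not_less_Least[OF that[unfolded n_def]] by simp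
  have geo: "summable (\<lambda>n. (1/3::real)^n)" by (rule summable_geometric) simp
  have sm: "summable (\<lambda>n. of_bool (p n) * (1/3::real)^n)" for p
    by (rule summable_comparison_test'[OF geo, of 0]) (simp add: of_bool_def)
  define c where "c m = (of_bool (a m) - of_bool (b m)) * (1/3::real)^m" for m
  have c: "summable c" "(\<Sum>m. c m) = 0"
  proof -
    have "c = (\<lambda>m. of_bool (a m) * (1/3)^m - of_bool (b m) * (1/3)^m)"
      by (simp add: c_def fun_eq_iff left_diff_distrib)
    then show "summable c" "(\<Sum>m. c m) = 0"
      using summable_diff[OF sm[of a] sm[of b]] suminf_diff[OF sm[of a] sm[of b]] assms
      by simp_all
  qed
  have "(\<Sum>m. c (m + Suc n)) = (\<Sum>m. c m) - (\<Sum>m<Suc n. c m)"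
    by (rule suminf_minus_initial_segment[OF c(1)])
  also have "(\<Sum>m<Suc n. c m) = c n" using less by (simp add: c_def)
  finally have "\<bar>c n\<bar> = \<bar>\<Sum>m. c (m + Suc n)\<bar>" using c(2) by simp
  also have "\<dots> \<le> (\<Sum>m. (1/3::real)^(m + Suc n))"
  proof -
    have le: "norm (c (m + Suc n)) \<le> (1/3::real)^(m + Suc n)" for m
      by (simp add: c_def of_bool_def abs_mult)
    have s1: "summable (\<lambda>m. (1/3::real)^(m + Suc n))"
      using geo by (subst summable_iff_shift)
    have s2: "summable (\<lambda>m. norm (c (m + Suc n)))"
      by (rule summable_comparison_test'[OF s1, of 0]) (use le in simp)
    have "\<bar>\<Sum>m. c (m + Suc n)\<bar> \<le> (\<Sum>m. norm (c (m + Suc n)))"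
      using summable_norm[OF s2] by simp
    also have "\<dots> \<le> (\<Sum>m. (1/3::real)^(m + Suc n))" by (rule suminf_le[OF le s2 s1])
    finally show ?thesis .
  qed
  also have "\<dots> = (1/3)^n / 2"
  proof -
    have "(\<Sum>m. (1/3::real)^(m + Suc n)) = (\<Sum>m. (1/3)^Suc n * (1/3)^m)"
      by (simp add: power_add mult.commute)
    also have "\<dots> = (1/3)^Suc n * (\<Sum>m. (1/3)^m)" by (rule suminf_mult[OF geo])
    also have "(\<Sum>m. (1/3::real)^m) = 3/2" by (subst suminf_geometric) simp_all
    finally show ?thesis by simp
  qed
  finally have "\<bar>c n\<bar> \<le> (1/3)^n / 2" .
  moreover have "\<bar>c n\<bar> = (1/3)^n" using n by (auto simp: c_def of_bool_def)
  moreover have "(1/3::real)^n > 0" by simp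
  ultimately show False by linarith
qed

text \<open>
The digits of \<open>\<theta> t\<close> record for all \<open>k\<close> which members of a countable basis contain \<open>f k t\<close>. Thus a single real
function carries the entire sequence, and an arbitrary finite measure space can be split into atoms and
a diffuse part with respect to \<open>\<theta>\<close>.
\<close>

lemma real_code_of_measurable_sequence:
  fixes f :: "nat \<Rightarrow> 'a \<Rightarrow> 'b::euclidean_space"
  assumes [measurable]: "\<And>k. f k \<in> borel_measurable M"
  shows "\<exists>\<theta>::'a \<Rightarrow> real. \<theta> \<in> borel_measurable M \<and> (\<forall>t. \<theta> t \<in> {0..2}) \<and>
           (\<forall>s t k. \<theta> s = \<theta> t \<longrightarrow> f k s = f k t)"
proof -
  obtain \<B> :: "'b set set" where \<B>: "countable \<B>" "topological_basis \<B>"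
    using ex_countable_basis by blast
  have "\<B> \<noteq> {}"
  proof
    assume "\<B> = {}"
    then show False using topological_basisE[OF \<B>(2) open_UNIV, of 0] by blast
  qed
  define U where "U = from_nat_into \<B>"
  have rangeU: "range U = \<B>" unfolding U_def by (rule range_from_nat_into[OF \<open>\<B> \<noteq> {}\<close> \<B>(1)])
  then have openU: "open (U j)" for j using topological_basis_open[OF \<B>(2)] by blast
  define E where "E n t \<longleftrightarrow> f (fst (prod_decode n)) t \<in> U (snd (prod_decode n))" for n t
  define \<theta> where "\<theta> t = (\<Sum>n. of_bool (E n t) * (1/3::real)^n)" for t
  have geo: "summable (\<lambda>n. (1/3::real)^n)" by (rule summable_geometric) simp
  have sm: "summable (\<lambda>n. of_bool (E n t) * (1/3::real)^n)" for t
    by (rule summable_comparison_test'[OF geo, of 0]) (simp add: of_bool_def)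
  have [measurable]: "Measurable.pred M (E n)" for n
  proof -
    have [measurable]: "U (snd (prod_decode n)) \<in> sets borel" using openU by simp
    show ?thesis unfolding E_def by measurable
  qed
  have "\<theta> \<in> borel_measurable M" unfolding \<theta>_def of_bool_def by measurable
  moreover have "\<theta> t \<in> {0..2}" for t
  proof -
    have "0 \<le> \<theta> t" unfolding \<theta>_def by (rule suminf_nonneg[OF sm]) simp
    moreover have "\<theta> t \<le> (\<Sum>n. (1/3::real)^n)"
      unfolding \<theta>_def by (rule suminf_le[OF _ sm geo]) (simp add: of_bool_def)
    moreover have "(\<Sum>n. (1/3::real)^n) = 3/2" by (subst suminf_geometric) simp_all
    ultimately show ?thesis by simp
  qed
  moreover have "f k s = f k t" if "\<theta> s = \<theta> t" for s t k
  proof (rule ccontr)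
    assume "f k s \<noteq> f k t"
    then obtain V where V: "open V" "f k s \<in> V" "f k t \<notin> V" by (metis t1_space)
    obtain W where W: "W \<in> \<B>" "f k s \<in> W" "W \<subseteq> V" by (rule topological_basisE[OF \<B>(2) V(1,2)])
    obtain j where j: "W = U j" using W(1) rangeU by blast
    have "(\<lambda>n. E n s) = (\<lambda>n. E n t)" using that unfolding \<theta>_def by (rule ternary_digits_unique)
    then have "E (prod_encode (k, j)) s = E (prod_encode (k, j)) t" by (rule fun_cong)
    then show False using V(3) W j by (auto simp: E_def)
  qed
  ultimately show ?thesis by blast
qed

text \<open>
The Fatou lemma for bounded sequences in finite dimensions. The points are divided according to whether the
code \<open>\<theta>\<close> has an atom at its value. There are countably many atoms, and along a diagonal subsequence the
functions converge on all of them, so dominated convergence settles that part. The measure is diffuse on the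
remaining part, and \<open>\<theta>\<close> itself is the coordinate that the diffuse case asks for.
\<close>

theorem (in finite_measure) selection_integrals_closed:
  fixes f :: "nat \<Rightarrow> 'a \<Rightarrow> 'b::euclidean_space"
  assumes f: "\<And>k. f k \<in> borel_measurable M"
    and bound: "\<forall>k. \<forall>t\<in>space M. norm (f k t) \<le> C"
    and lim: "(\<lambda>k. integral\<^sup>L M (f k)) \<longlonglongrightarrow> P"
  shows "P \<in> selection_integrals M C f"
proof -
  note f[measurable]
  obtain \<theta> :: "'a \<Rightarrow> real" where \<theta>[measurable]: "\<theta> \<in> borel_measurable M" and \<theta>01: "\<forall>t. \<theta> t \<in> {0..2}"
    and code: "\<forall>s t k. \<theta> s = \<theta> t \<longrightarrow> f k s = f k t"
    using real_code_of_measurable_sequence[of f M, OF f] by (elim exE conjE)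
  define A where "A = {r. measure M {t \<in> space M. \<theta> t = r} \<noteq> 0}"
  have A_count: "countable A"
  proof -
    interpret D: finite_measure "distr M borel \<theta>" by (rule finite_measure_distr) measurable
    have "measure (distr M borel \<theta>) {r} = measure M {t \<in> space M. \<theta> t = r}" for r
      by (subst measure_distr) (auto intro!: arg_cong[of _ _ "measure M"])
    then have "A = {r. measure (distr M borel \<theta>) {r} \<noteq> 0}" by (simp only: A_def)
    then show ?thesis using D.countable_support by (simp only:)
  qed
  have A_borel[measurable]: "A \<in> sets borel"
    by (rule sets.countable[OF _ A_count]) (rule borel_singleton[OF sets.empty_sets])
  \<comment> \<open>On the atoms of the code each \<open>f k\<close> is constant, so a diagonal subsequence converges there.\<close>
  obtain \<rho> :: "nat \<Rightarrow> nat" where \<rho>: "strict_mono \<rho>"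
    and conv: "\<And>t. t \<in> space M \<Longrightarrow> \<theta> t \<in> A \<Longrightarrow> convergent (\<lambda>k. f (\<rho> k) t)"
  proof (cases "A = {}")
    case True
    have "strict_mono (id :: nat \<Rightarrow> nat)" by (simp add: strict_mono_def)
    then show ?thesis by (rule that) (use True in blast)
  next
    case False
    define \<tau> where "\<tau> i = (SOME t. t \<in> space M \<and> \<theta> t = from_nat_into A i)" for i
    have \<tau>: "\<tau> i \<in> space M \<and> \<theta> (\<tau> i) = from_nat_into A i" for i
    proof -
      have ne: "measure M {t \<in> space M. \<theta> t = from_nat_into A i} \<noteq> 0"
        using from_nat_into[OF False, of i] unfolding A_def by blast
      have "\<exists>t. t \<in> space M \<and> \<theta> t = from_nat_into A i"
      proof (rule ccontr)
        assume "\<not> ?thesis"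
        then have "{t \<in> space M. \<theta> t = from_nat_into A i} = {}" by blast
        then show False using ne by (simp only: measure_empty)
      qed
      then show ?thesis unfolding \<tau>_def by (rule someI_ex)
    qed
    have "\<exists>\<rho> :: nat \<Rightarrow> nat. strict_mono \<rho> \<and> (\<forall>i. \<exists>l\<in>cball 0 C. (\<lambda>n. f (\<rho> n) (\<tau> i)) \<longlonglongrightarrow> l)"
      by (rule diagonal_convergent_subsequence) (use bound \<tau> in simp_all)
    then obtain \<rho> :: "nat \<Rightarrow> nat" where \<rho>: "strict_mono \<rho>"
      "\<forall>i. \<exists>l\<in>cball 0 C. (\<lambda>n. f (\<rho> n) (\<tau> i)) \<longlonglongrightarrow> l" by (elim exE conjE)
    have "convergent (\<lambda>k. f (\<rho> k) t)" if t: "t \<in> space M" "\<theta> t \<in> A" for t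
    proof -
      obtain i where "from_nat_into A i = \<theta> t"
        using from_nat_into_surj[OF A_count t(2)] by blast
      then have "\<theta> t = \<theta> (\<tau> i)" using \<tau> by simp
      then have "(\<lambda>k. f (\<rho> k) t) = (\<lambda>k. f (\<rho> k) (\<tau> i))" using code by blast
      then show ?thesis using \<rho>(2) by (auto simp: convergent_def)
    qed
    then show ?thesis by (rule that[OF \<rho>(1)])
  qed
  define F where "F k = f (\<rho> k)" for k
  have F[measurable]: "F k \<in> borel_measurable M" for k unfolding F_def by (rule f)
  have FC: "norm (F k t) \<le> C" if "t \<in> space M" for k t using bound that by (simp add: F_def)
  have F_lim: "(\<lambda>k. integral\<^sup>L M (F k)) \<longlonglongrightarrow> P"
    unfolding F_def using LIMSEQ_subseq_LIMSEQ[OF lim \<rho>] by (simp only: o_def)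
  define D where "D = {t \<in> space M. \<theta> t \<notin> A}"
  have D[measurable]: "D \<in> sets M" unfolding D_def by measurable
  have DM: "D \<inter> space M = D" by (auto simp: D_def)
  define ga where "ga t = lim (\<lambda>k. F k t)" for t
  have ga[measurable]: "ga \<in> borel_measurable M"
    unfolding ga_def by (rule borel_measurable_lim_metric[OF F])
  have ga_lim: "(\<lambda>k. F k t) \<longlonglongrightarrow> ga t" if "t \<in> space M" "t \<notin> D" for t
    using conv[of t] that unfolding ga_def F_def D_def by (simp add: convergent_LIMSEQ_iff)
  have ga_C: "norm (ga t) \<le> C" if t: "t \<in> space M" "t \<notin> D" for t
    by (rule LIMSEQ_le_const2[OF tendsto_norm[OF ga_lim[OF t]]]) (use FC t in blast)
  define Ga where "Ga t = indicator (space M - D) t *\<^sub>R ga t" for t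
  have Ga_lim: "(\<lambda>k. LINT t|M. indicator (space M - D) t *\<^sub>R F k t) \<longlonglongrightarrow> integral\<^sup>L M Ga"
    unfolding Ga_def
  proof (rule integral_dominated_convergence[where w = "\<lambda>_. \<bar>C\<bar>"])
    show "AE t in M. (\<lambda>k. indicator (space M - D) t *\<^sub>R F k t) \<longlonglongrightarrow> indicator (space M - D) t *\<^sub>R ga t"
      using ga_lim by (intro AE_I2) (auto simp: indicator_def)
    show "AE t in M. norm (indicator (space M - D) t *\<^sub>R F k t) \<le> \<bar>C\<bar>" for k
      using FC by (intro AE_I2) (auto simp: indicator_def intro: order_trans[OF _ abs_ge_self])
  qed auto
  have int_F: "integrable M (F k)" for k by (rule integrable_bounded[OF F FC])
  define M' where "M' = restrict_space M D"
  interpret M': finite_measure M'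
    unfolding M'_def by (rule finite_measure_restrict_space[OF finite_measure_axioms D])
  have space': "space M' = D" unfolding M'_def by (simp add: space_restrict_space DM)
  have int': "integral\<^sup>L M' h = (LINT t|M. indicator D t *\<^sub>R h t)" for h :: "'a \<Rightarrow> 'b"
    unfolding M'_def by (rule integral_restrict_space) (simp add: DM)
  have "diffuse_coordinate M' \<theta>"
    unfolding diffuse_coordinate_def
  proof (intro conjI allI ballI)
    show "\<theta> \<in> borel_measurable M'" unfolding M'_def by (rule measurable_restrict_space1[OF \<theta>])
    show "\<theta> t \<in> {0..2}" for t using \<theta>01 by blast
    fix r
    have "measure M' {t \<in> space M'. \<theta> t = r} = measure M {t \<in> D. \<theta> t = r}"
      unfolding space' unfolding M'_def by (rule measure_restrict_space) (auto simp: DM)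
    also have "\<dots> = 0"
    proof (cases "r \<in> A")
      case True
      then have "{t \<in> D. \<theta> t = r} = {}" by (auto simp: D_def)
      then show ?thesis by (metis measure_empty)
    next
      case False
      have "measure M {t \<in> D. \<theta> t = r} \<le> measure M {t \<in> space M. \<theta> t = r}"
        by (rule finite_measure_mono) (auto simp: D_def)
      also have "\<dots> = 0" using False by (simp add: A_def)
      finally show ?thesis by (intro antisym measure_nonneg)
    qed
    finally show "measure M' {t \<in> space M'. \<theta> t = r} = 0" .
  qed
  moreover have "\<forall>k. F k \<in> borel_measurable M'"
    unfolding M'_def using measurable_restrict_space1[OF F] by blast
  moreover have "\<forall>k. \<forall>t\<in>space M'. norm (F k t) \<le> C"
    using FC by (simp add: space' D_def)
  moreover have "(\<lambda>k. integral\<^sup>L M' (F k)) \<longlonglongrightarrow> P - integral\<^sup>L M Ga"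
  proof -
    have "integral\<^sup>L M' (F k) = integral\<^sup>L M (F k) - (LINT t|M. indicator (space M - D) t *\<^sub>R F k t)" for k
    proof -
      have "integral\<^sup>L M' (F k) = (LINT t|M. F k t - indicator (space M - D) t *\<^sub>R F k t)"
        unfolding int' by (intro Bochner_Integration.integral_cong) (auto simp: indicator_def)
      also have "\<dots> = integral\<^sup>L M (F k) - (LINT t|M. indicator (space M - D) t *\<^sub>R F k t)"
        by (intro Bochner_Integration.integral_diff int_F integrable_mult_indicator) measurable
      finally show ?thesis .
    qed
    then show ?thesis using tendsto_diff[OF F_lim Ga_lim] by simp
  qed
  ultimately have "P - integral\<^sup>L M Ga \<in> selection_integrals M' C F"
    by (rule M'.selection_integrals_closed_diffuse)
  from selection_integralsD[OF this] obtain gd where gd: "gd \<in> borel_measurable M'"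
    "\<forall>t\<in>space M'. norm (gd t) \<le> C" "AE t in M'. cluster_point (\<lambda>k. F k t) (gd t)"
    "P - integral\<^sup>L M Ga = integral\<^sup>L M' gd" by (elim exE conjE)
  define Gd where "Gd t = (if t \<in> D then gd t else 0)" for t
  have Gd[measurable]: "Gd \<in> borel_measurable M"
    unfolding Gd_def using gd(1) unfolding M'_def
    by (subst (asm) measurable_restrict_space_iff[of _ _ 0]) (simp_all add: DM)
  define g where "g t = (if t \<in> D then Gd t else ga t)" for t
  have g: "g \<in> borel_measurable M" unfolding g_def by measurable
  have gC: "norm (g t) \<le> C" if "t \<in> space M" for t
    using that ga_C gd(2) by (auto simp: g_def Gd_def space')
  have "AE t in M. t \<in> D \<longrightarrow> cluster_point (\<lambda>k. F k t) (gd t)"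
    using gd(3) unfolding M'_def by (subst (asm) AE_restrict_space_iff) (simp_all add: DM)
  then have "AE t in M. cluster_point (\<lambda>k. f k t) (g t)"
  proof (rule AE_mp, intro AE_I2 impI)
    fix t assume t: "t \<in> space M" and "t \<in> D \<longrightarrow> cluster_point (\<lambda>k. F k t) (gd t)"
    then have "cluster_point (\<lambda>k. F k t) (g t)"
      using ga_lim[of t] unfolding g_def Gd_def
      by (auto simp: cluster_point_def o_def intro!: exI[of _ id] strict_mono_id)
    then show "cluster_point (\<lambda>k. f k t) (g t)"
      unfolding F_def by (rule cluster_point_subseq[OF \<rho>])
  qed
  moreover have "integral\<^sup>L M g = P"
  proof -
    have int_Gd: "integrable M Gd"
      by (rule integrable_bounded[OF Gd, of "\<bar>C\<bar>"])
         (use gd(2) in \<open>auto simp: Gd_def space' intro: order_trans[OF _ abs_ge_self]\<close>)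
    have int_Ga: "integrable M Ga"
      unfolding Ga_def by (rule integrable_bounded[of _ "\<bar>C\<bar>"])
         (use ga_C in \<open>auto simp: indicator_def intro: order_trans[OF _ abs_ge_self]\<close>)
    have "integral\<^sup>L M g = (LINT t|M. Gd t + Ga t)"
      by (intro Bochner_Integration.integral_cong) (auto simp: g_def Gd_def Ga_def indicator_def)
    also have "\<dots> = integral\<^sup>L M Gd + integral\<^sup>L M Ga"
      by (rule Bochner_Integration.integral_add[OF int_Gd int_Ga])
    also have "integral\<^sup>L M Gd = integral\<^sup>L M' gd"
      unfolding int' by (intro Bochner_Integration.integral_cong) (auto simp: Gd_def indicator_def)
    finally show ?thesis using gd(4) by (simp add: algebra_simps)
  qed
  ultimately show ?thesis using selection_integralsI[OF g, of C f] gC by auto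
qed

section \<open>Regular and limiting normals\<close>

lemma regular_normal_cone_iff:
  "xs \<in> regular_normal_cone x C \<longleftrightarrow>
     x \<in> C \<and> (\<forall>e>0. \<exists>d>0. \<forall>u\<in>C. dist u x < d \<longrightarrow> inner xs (u - x) \<le> e * norm (u - x))"
proof
  assume xs: "xs \<in> regular_normal_cone x C"
  have "\<exists>d>0. \<forall>u\<in>C. dist u x < d \<longrightarrow> inner xs (u - x) \<le> e * norm (u - x)" if e: "e > 0" for e
  proof -
    have "Limsup (at x within C) (\<lambda>u. ereal (inner xs (u - x) / norm (u - x))) < ereal e"
      using xs e unfolding regular_normal_cone_def by (auto intro: le_less_trans)
    from Limsup_lessD[OF this]
    have "\<forall>\<^sub>F u in at x within C. inner xs (u - x) / norm (u - x) < e" by simp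
    then obtain d where d: "d > 0" "\<forall>u\<in>C. u \<noteq> x \<and> dist u x < d \<longrightarrow> inner xs (u - x) / norm (u - x) < e"
      unfolding eventually_at by blast
    have "inner xs (u - x) \<le> e * norm (u - x)" if u: "u \<in> C" "dist u x < d" for u
    proof (cases "u = x")
      case False
      then have "inner xs (u - x) / norm (u - x) < e" using d(2) u by blast
      then show ?thesis using False by (simp add: pos_divide_less_eq less_imp_le)
    qed simp
    then show ?thesis using d(1) by blast
  qed
  then show "x \<in> C \<and> (\<forall>e>0. \<exists>d>0. \<forall>u\<in>C. dist u x < d \<longrightarrow> inner xs (u - x) \<le> e * norm (u - x))"
    using xs unfolding regular_normal_cone_def by blast
next
  assume xs: "x \<in> C \<and> (\<forall>e>0. \<exists>d>0. \<forall>u\<in>C. dist u x < d \<longrightarrow> inner xs (u - x) \<le> e * norm (u - x))"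
  have "Limsup (at x within C) (\<lambda>u. ereal (inner xs (u - x) / norm (u - x))) \<le> 0 + ereal e" if e: "e > 0" for e
  proof (rule Limsup_bounded)
    obtain d where d: "d > 0" "\<forall>u\<in>C. dist u x < d \<longrightarrow> inner xs (u - x) \<le> e * norm (u - x)"
      using xs e by blast
    have "ereal (inner xs (u - x) / norm (u - x)) \<le> 0 + ereal e"
      if u: "u \<in> C" and "u \<noteq> x \<and> dist u x < d" for u
    proof -
      have "inner xs (u - x) \<le> e * norm (u - x)" using d(2) that by blast
      then show ?thesis using that by (simp add: pos_divide_le_eq)
    qed
    then show "\<forall>\<^sub>F u in at x within C. ereal (inner xs (u - x) / norm (u - x)) \<le> 0 + ereal e"
      unfolding eventually_at by (intro exI[of _ d] conjI ballI impI d(1))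
  qed
  then have "Limsup (at x within C) (\<lambda>u. ereal (inner xs (u - x) / norm (u - x))) \<le> 0"
    by (rule ereal_le_epsilon2)
  then show "xs \<in> regular_normal_cone x C" using conjunct1[OF xs] by (simp add: regular_normal_cone_def)
qed

text \<open>
A local quadratic bound defines a proximal normal, and these are regular. Every regular normal constructed
below is of this kind.
\<close>

lemma regular_normal_cone_if_quadratic:
  assumes "x \<in> C" "r > 0"
    and quad: "\<And>u. u \<in> C \<Longrightarrow> dist u x < r \<Longrightarrow> inner xs (u - x) \<le> B * norm (u - x) ^ 2"
  shows "xs \<in> regular_normal_cone x C"
  unfolding regular_normal_cone_iff
proof (intro conjI allI impI assms(1))
  fix e :: real assume e: "e > 0"
  define d where "d = min r (e / (\<bar>B\<bar> + 1))"
  show "\<exists>d>0. \<forall>u\<in>C. dist u x < d \<longrightarrow> inner xs (u - x) \<le> e * norm (u - x)"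
  proof (intro exI[of _ d] conjI ballI impI)
    show "d > 0" using e assms(2) by (simp add: d_def add_nonneg_pos)
    fix u assume u: "u \<in> C" "dist u x < d"
    have n: "norm (u - x) \<le> e / (\<bar>B\<bar> + 1)" using u(2) by (simp add: d_def dist_norm)
    have "B * norm (u - x) \<le> (\<bar>B\<bar> + 1) * norm (u - x)" by (intro mult_right_mono) auto
    also have "\<dots> \<le> (\<bar>B\<bar> + 1) * (e / (\<bar>B\<bar> + 1))" using n by (intro mult_left_mono) auto
    also have "\<dots> = e" by (simp add: add_nonneg_pos less_imp_neq[THEN not_sym])
    finally have "B * norm (u - x) * norm (u - x) \<le> e * norm (u - x)" by (intro mult_right_mono) auto
    moreover have "inner xs (u - x) \<le> B * norm (u - x) ^ 2" using quad u by (simp add: d_def)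
    ultimately show "inner xs (u - x) \<le> e * norm (u - x)" by (simp add: power2_eq_square mult.assoc)
  qed
qed

lemma nearest_point_regular_normal:
  assumes "w \<in> C" and near: "\<And>c. c \<in> C \<Longrightarrow> dist u w \<le> dist u c" and "a \<ge> 0"
  shows "a *\<^sub>R (u - w) \<in> regular_normal_cone w C"
proof (rule regular_normal_cone_if_quadratic[OF assms(1) zero_less_one])
  fix c assume c: "c \<in> C"
  have "norm (u - w) ^ 2 \<le> norm (u - c) ^ 2"
    using near[OF c] by (simp add: dist_norm power_mono)
  also have "u - c = (u - w) - (c - w)" by simp
  also have "norm ((u - w) - (c - w)) ^ 2 = norm (u - w) ^ 2 - 2 * inner (u - w) (c - w) + norm (c - w) ^ 2"
    by (simp add: power2_norm_eq_inner inner_diff_left inner_diff_right inner_commute)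
  finally have "inner (u - w) (c - w) \<le> norm (c - w) ^ 2 / 2" by simp
  then have "a * inner (u - w) (c - w) \<le> a * (norm (c - w) ^ 2 / 2)" using \<open>a \<ge> 0\<close> by (rule mult_left_mono)
  then show "inner (a *\<^sub>R (u - w)) (c - w) \<le> (a / 2) * norm (c - w) ^ 2" by simp
qed

lemma regular_normal_cone_scaleR:
  assumes "xs \<in> regular_normal_cone x C" "a > 0"
  shows "a *\<^sub>R xs \<in> regular_normal_cone x C"
  unfolding regular_normal_cone_iff
proof (intro conjI allI impI)
  show "x \<in> C" using assms(1) by (simp add: regular_normal_cone_iff)
  fix e :: real assume "e > 0"
  then have "e / a > 0" using assms(2) by simp
  then obtain d where d: "d > 0" "\<forall>u\<in>C. dist u x < d \<longrightarrow> inner xs (u - x) \<le> e / a * norm (u - x)"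
    using assms(1) unfolding regular_normal_cone_iff by blast
  have "inner (a *\<^sub>R xs) (u - x) \<le> e * norm (u - x)" if u: "u \<in> C" "dist u x < d" for u
  proof -
    have "a * inner xs (u - x) \<le> a * (e / a * norm (u - x))"
      using d(2) u assms(2) by (intro mult_left_mono) auto
    then show ?thesis using assms(2) by simp
  qed
  then show "\<exists>d>0. \<forall>u\<in>C. dist u x < d \<longrightarrow> inner (a *\<^sub>R xs) (u - x) \<le> e * norm (u - x)" using d(1) by blast
qed

lemma normal_coneI:
  assumes "\<And>k::nat. XS k \<in> regular_normal_cone (X k) C" "X \<longlonglongrightarrow> x" "XS \<longlonglongrightarrow> xs"
  shows "xs \<in> normal_cone x C"
  using assms unfolding normal_cone_def by blast

lemma normal_cone_scaleR:
  assumes "xs \<in> normal_cone x C" "a > 0"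
  shows "a *\<^sub>R xs \<in> normal_cone x C"
proof -
  obtain X XS where X: "\<forall>k::nat. XS k \<in> regular_normal_cone (X k) C" "X \<longlonglongrightarrow> x" "XS \<longlonglongrightarrow> xs"
    using assms(1) unfolding normal_cone_def by blast
  have "\<forall>k. a *\<^sub>R XS k \<in> regular_normal_cone (X k) C"
    using X(1) regular_normal_cone_scaleR[OF _ assms(2)] by blast
  moreover have "(\<lambda>k. a *\<^sub>R XS k) \<longlonglongrightarrow> a *\<^sub>R xs" by (intro tendsto_intros X(3))
  ultimately show ?thesis using X(2) by (intro normal_coneI[of "\<lambda>k. a *\<^sub>R XS k" X]) simp_all
qed

lemma coderivative_scaleR:
  assumes "us \<in> coderivative G u y ys" "a > 0"
  shows "a *\<^sub>R us \<in> coderivative G u y (a *\<^sub>R ys)"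
proof -
  have "(us, - ys) \<in> normal_cone (u, y) (gph G)" using assms(1) by (simp add: coderivative_def)
  from normal_cone_scaleR[OF this assms(2)] show ?thesis by (simp add: coderivative_def)
qed

text \<open>
This is the Cauchy-Schwarz inequality, from the variance of \<open>norm (h t)\<close>. It makes the square of an integral
comparable to an integral, so that it can be estimated pointwise.
\<close>

lemma (in finite_measure) norm_integral_power2_le:
  fixes h :: "'a \<Rightarrow> 'b::euclidean_space"
  assumes h: "integrable M h" and h2: "integrable M (\<lambda>t. norm (h t) ^ 2)"
  shows "norm (integral\<^sup>L M h) ^ 2 \<le> measure M (space M) * (LINT t|M. norm (h t) ^ 2)"
proof -
  define m where "m = measure M (space M)"
  define I where "I = (LINT t|M. norm (h t))"
  have m: "m \<ge> 0" by (simp add: m_def)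
  have nI: "norm (integral\<^sup>L M h) \<le> I" unfolding I_def by (rule integral_norm_bound)
  have hn: "integrable M (\<lambda>t. norm (h t))" using h by (rule integrable_norm)
  have "0 \<le> (LINT t|M. (m * norm (h t) - I) ^ 2)" by simp
  also have "(LINT t|M. (m * norm (h t) - I) ^ 2)
      = (LINT t|M. m ^ 2 * norm (h t) ^ 2 - 2 * m * I * norm (h t) + I ^ 2)"
    by (intro Bochner_Integration.integral_cong) (auto simp: power2_eq_square algebra_simps)
  also have "\<dots> = m ^ 2 * (LINT t|M. norm (h t) ^ 2) - 2 * m * I * I + m * I ^ 2"
    using hn h2 by (simp add: I_def m_def)
  finally have *: "m * I ^ 2 \<le> m * (m * (LINT t|M. norm (h t) ^ 2))"
    by (simp add: power2_eq_square algebra_simps)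
  have "I ^ 2 \<le> m * (LINT t|M. norm (h t) ^ 2)"
  proof (cases "m = 0")
    case True
    then have "emeasure M (space M) = 0" by (simp add: m_def emeasure_eq_measure)
    then have "AE t in M. norm (h t) = 0"
      by (intro AE_I[of _ _ "space M"]) auto
    then have "I = 0" unfolding I_def by (rule integral_eq_zero_AE)
    then show ?thesis using True by simp
  next
    case False
    then show ?thesis using * m by simp
  qed
  moreover have "norm (integral\<^sup>L M h) ^ 2 \<le> I ^ 2" using nI by (intro power_mono) auto
  ultimately show ?thesis unfolding m_def by linarith
qed

section \<open>A penalised integral problem\<close>

text \<open>
The integrand near the point \<open>ubar\<close>, reduced to a set \<open>T0\<close> of full measure on which the Lipschitz condition
holds and the value at \<open>ubar\<close> is given by the integrable function \<open>y0\<close>. The radius satisfies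
\<open>3 * l * r \<le> \<gamma>\<close> because a value near the graph is within \<open>l * r\<close> of \<open>y0 t\<close> and moving its argument
inside the ball shifts it by at most \<open>2 * l * r\<close>: the shifted value is again near enough for the Lipschitz
condition to apply.
\<close>

locale lipschitz_integrand = finite_measure M for M :: "'t measure" +
  fixes \<Phi> :: "'t \<Rightarrow> 'u::euclidean_space \<Rightarrow> 'v::euclidean_space set"
    and ubar :: 'u and y0 :: "'t \<Rightarrow> 'v" and T0 :: "'t set" and l \<gamma> r :: real
  assumes complete: "complete_measure M"
    and integrand: "set_valued_normal_integrand M \<Phi>"
    and T0: "T0 \<in> sets M" and T0_full: "AE t in M. t \<in> T0"
    and y0: "integrable M y0"
    and single: "t \<in> T0 \<Longrightarrow> \<Phi> t ubar = {y0 t}"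
    and l: "l > 0" and r: "r > 0" and lr: "3 * l * r \<le> \<gamma>"
    and lip: "t \<in> T0 \<Longrightarrow> u \<in> cball ubar r \<Longrightarrow> u' \<in> cball ubar r \<Longrightarrow> x \<in> \<Phi> t u \<Longrightarrow>
      x \<in> cball (y0 t) \<gamma> \<Longrightarrow> \<exists>x'\<in>\<Phi> t u'. norm (x' - x) \<le> l * norm (u - u')"
begin

definition near_graph :: "'t \<Rightarrow> 'u \<Rightarrow> 'v \<Rightarrow> bool" where
  "near_graph t v f \<longleftrightarrow> v \<in> cball ubar r \<and> f \<in> \<Phi> t v \<and> f \<in> cball (y0 t) \<gamma>"

definition admissible :: "('t \<Rightarrow> 'u) \<Rightarrow> ('t \<Rightarrow> 'v) \<Rightarrow> bool" where
  "admissible v f \<longleftrightarrow> v \<in> borel_measurable M \<and> f \<in> borel_measurable M \<and> (AE t in M. near_graph t (v t) (f t))"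

lemma y0_measurable [measurable]: "y0 \<in> borel_measurable M"
  using y0 by (rule borel_measurable_integrable)

lemma \<gamma>_pos: "\<gamma> > 0"
proof -
  have "0 < 3 * l * r" using l r by simp
  then show ?thesis using lr by linarith
qed

lemma T0_space: "t \<in> T0 \<Longrightarrow> t \<in> space M"
  using sets.sets_into_space[OF T0] by blast

lemma closed_graph: "t \<in> T0 \<Longrightarrow> closed (gph (\<Phi> t))"
  using integrand T0_space unfolding set_valued_normal_integrand_def by blast

text \<open>
The Lipschitz condition is applied with \<open>ubar\<close> as second argument, where \<open>y0 t\<close> is the only value. In this
way single-valuedness at one point bounds all competitors.
\<close>

lemma near_graph_close:
  assumes "t \<in> T0" "near_graph t v f"
  shows "norm (f - y0 t) \<le> l * norm (v - ubar)"
proof -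
  obtain x' where "x' \<in> \<Phi> t ubar" "norm (x' - f) \<le> l * norm (v - ubar)"
    using lip[OF assms(1), of v ubar f] assms(2) r unfolding near_graph_def by auto
  then show ?thesis using single[OF assms(1)] by (simp add: norm_minus_commute)
qed

lemma near_graph_bound:
  assumes "t \<in> T0" "near_graph t v f"
  shows "norm (f - y0 t) \<le> l * r" and "norm (v - ubar) \<le> r"
proof -
  show v: "norm (v - ubar) \<le> r"
    using assms(2) by (simp add: near_graph_def dist_norm norm_minus_commute)
  have "l * norm (v - ubar) \<le> l * r" using v l by (intro mult_left_mono) auto
  then show "norm (f - y0 t) \<le> l * r" using near_graph_close[OF assms] by linarith
qed

lemma near_graph_shift:
  assumes t: "t \<in> T0" "near_graph t v f" and u: "u \<in> cball ubar r"
  shows "\<exists>f'. near_graph t u f' \<and> norm (f' - f) \<le> l * norm (v - u)"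
proof -
  obtain f' where f': "f' \<in> \<Phi> t u" "norm (f' - f) \<le> l * norm (v - u)"
    using lip[OF t(1), of v u f] t(2) u unfolding near_graph_def by blast
  have "norm (v - u) \<le> norm (v - ubar) + norm (ubar - u)"
    using norm_triangle_ineq[of "v - ubar" "ubar - u"] by simp
  also have "\<dots> \<le> r + r" using near_graph_bound(2)[OF t] u by (intro add_mono) (auto simp: dist_norm)
  finally have "l * norm (v - u) \<le> l * (r + r)" using l by (intro mult_left_mono) auto
  moreover have "norm (f' - y0 t) \<le> norm (f' - f) + norm (f - y0 t)"
    using norm_triangle_ineq[of "f' - f" "f - y0 t"] by simp
  ultimately have "norm (f' - y0 t) \<le> 3 * l * r"
    using f'(2) near_graph_bound(1)[OF t] by (simp add: algebra_simps)
  then have "f' \<in> cball (y0 t) \<gamma>" using lr by (simp add: dist_norm norm_minus_commute)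
  then show ?thesis using f' u unfolding near_graph_def by blast
qed

lemma admissible_base: "admissible (\<lambda>_. ubar) y0"
proof -
  have "AE t in M. near_graph t ubar (y0 t)"
    using T0_full by eventually_elim (use single r \<gamma>_pos in \<open>simp add: near_graph_def\<close>)
  then show ?thesis unfolding admissible_def by simp
qed

lemma admissible_AE_bound:
  assumes "admissible v f"
  shows "AE t in M. norm (f t - y0 t) \<le> l * r \<and> norm (v t - ubar) \<le> r"
proof -
  have "AE t in M. near_graph t (v t) (f t)" using assms by (simp add: admissible_def)
  with T0_full show ?thesis by eventually_elim (use near_graph_bound in blast)
qed

lemma admissible_integrable:
  assumes "admissible v f"
  shows "integrable M f" and "integrable M v"
    and "u \<in> cball ubar r \<Longrightarrow> integrable M (\<lambda>t. norm (v t - u) ^ 2)"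
proof -
  have [measurable]: "v \<in> borel_measurable M" "f \<in> borel_measurable M"
    using assms by (simp_all add: admissible_def)
  note AE = admissible_AE_bound[OF assms]
  have "integrable M (\<lambda>t. f t - y0 t)"
    by (rule integrable_const_bound[of _ "l * r"]) (use AE in \<open>auto elim!: eventually_mono\<close>)
  from Bochner_Integration.integrable_add[OF this y0] show "integrable M f" by simp
  have "integrable M (\<lambda>t. v t - ubar)"
    by (rule integrable_const_bound[of _ r]) (use AE in \<open>auto elim!: eventually_mono\<close>)
  from Bochner_Integration.integrable_add[OF this, of "\<lambda>_. ubar"] show "integrable M v" by simp
  assume u: "u \<in> cball ubar r"
  have "AE t in M. norm (norm (v t - u) ^ 2) \<le> (r + r) ^ 2"
    using AE
  proof eventually_elim
    fix t assume a: "norm (f t - y0 t) \<le> l * r \<and> norm (v t - ubar) \<le> r"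
    have "norm (v t - u) \<le> norm (v t - ubar) + norm (ubar - u)"
      using norm_triangle_ineq[of "v t - ubar" "ubar - u"] by simp
    also have "\<dots> \<le> r + r" using a u by (simp add: dist_norm)
    finally have "norm (v t - u) ^ 2 \<le> (r + r) ^ 2" by (rule power_mono) simp
    then show "norm (norm (v t - u) ^ 2) \<le> (r + r) ^ 2" by (simp only: real_norm_def abs_power2)
  qed
  then show "integrable M (\<lambda>t. norm (v t - u) ^ 2)"
    by (intro integrable_const_bound[of _ "(r + r) ^ 2"]) auto
qed

lemma sets_AE_complete:
  assumes "AE t in M. P t"
  shows "{t \<in> space M. P t} \<in> sets M"
proof -
  interpret complete_measure M by (rule complete)
  have "{t \<in> space M. \<not> P t} \<in> sets M"
    using assms unfolding AE_iff_null_sets by (rule null_setsD2)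
  then have "space M - {t \<in> space M. \<not> P t} \<in> sets M" by simp
  moreover have "space M - {t \<in> space M. \<not> P t} = {t \<in> space M. P t}" by auto
  ultimately show ?thesis by simp
qed

text \<open>
The Fatou lemma is applied to the triples \<open>(v, f - y0, norm (v - u) ^ 2)\<close>. Including the third component as a
separate coordinate is what makes the quadratic term converge, although \<open>v\<close> converges in no sense: a cluster
point of the triples has the form \<open>(v', f' - y0, norm (v' - u') ^ 2)\<close> with the same \<open>v'\<close>. Closed graphs make
the cluster points admissible.
\<close>

proposition admissible_compactness:
  assumes u: "\<forall>k. u k \<in> cball ubar r" and adm: "\<forall>k. admissible (v k) (f k)"
  shows "\<exists>\<rho> u' v' f'. strict_mono (\<rho>::nat \<Rightarrow> nat) \<and> u' \<in> cball ubar r \<and> (\<lambda>k. u (\<rho> k)) \<longlonglongrightarrow> u' \<and>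
    admissible v' f' \<and> (\<lambda>k. integral\<^sup>L M (f (\<rho> k))) \<longlonglongrightarrow> integral\<^sup>L M f' \<and>
    (\<lambda>k. LINT t|M. norm (v (\<rho> k) t - u (\<rho> k)) ^ 2) \<longlonglongrightarrow> (LINT t|M. norm (v' t - u') ^ 2)"
proof -
  define good where "good t \<longleftrightarrow> t \<in> T0 \<and> (\<forall>k. near_graph t (v k t) (f k t))" for t
  have good_AE: "AE t in M. good t"
    using adm T0_full unfolding good_def admissible_def by (simp add: AE_all_countable)
  have [measurable]: "{t \<in> space M. good t} \<in> sets M" by (rule sets_AE_complete[OF good_AE])
  have vm[measurable]: "v k \<in> borel_measurable M" and fm[measurable]: "f k \<in> borel_measurable M" for k
    using adm by (simp_all add: admissible_def)
  define F where "F k t = (if good t then (v k t, f k t - y0 t, norm (v k t - u k) ^ 2) else (0, 0, 0))" for k t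
  have F[measurable]: "F k \<in> borel_measurable M" for k unfolding F_def by measurable
  define C where "C = (norm ubar + r) + (l * r + (r + r) ^ 2)"
  have C0: "C \<ge> 0" using l r by (simp add: C_def)
  have FC: "\<forall>k. \<forall>t\<in>space M. norm (F k t) \<le> C"
  proof (intro allI ballI)
    fix k t
    show "norm (F k t) \<le> C"
    proof (cases "good t")
      case True
      then have g: "t \<in> T0" "near_graph t (v k t) (f k t)" by (simp_all add: good_def)
      have "norm (v k t) \<le> norm ubar + r"
        using norm_triangle_ineq[of ubar "v k t - ubar"] near_graph_bound(2)[OF g] by simp
      moreover have "norm (v k t - u k) \<le> r + r"
        using norm_triangle_ineq[of "v k t - ubar" "ubar - u k"] near_graph_bound(2)[OF g] u
        by (auto simp: dist_norm dest!: spec[of _ k])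
      then have "norm (v k t - u k) ^ 2 \<le> (r + r) ^ 2" by (intro power_mono) auto
      moreover have "norm (F k t) \<le> norm (v k t) + (norm (f k t - y0 t) + norm (norm (v k t - u k) ^ 2))"
        unfolding F_def using True
        by (simp only: if_True) (intro order_trans[OF norm_Pair_le] add_left_mono norm_Pair_le)
      ultimately show ?thesis using near_graph_bound(1)[OF g] by (simp add: C_def)
    qed (simp add: F_def C0 zero_prod_def[symmetric])
  qed
  have int_F: "integrable M (F k)" for k by (rule integrable_bounded[OF F]) (use FC in blast)
  have pairs: "\<forall>k. (u k, integral\<^sup>L M (F k)) \<in> cball ubar r \<times> cball 0 (C * measure M (space M))"
  proof
    fix k
    have "norm (integral\<^sup>L M (F k)) \<le> (LINT t|M. norm (F k t))" by (rule integral_norm_bound)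
    also have "\<dots> \<le> (LINT t|M. C)" using int_F FC by (intro integral_mono integrable_norm) auto
    finally show "(u k, integral\<^sup>L M (F k)) \<in> cball ubar r \<times> cball 0 (C * measure M (space M))"
      using u by (simp add: mult.commute)
  qed
  have "seq_compact (cball ubar r \<times> cball (0::'u \<times> 'v \<times> real) (C * measure M (space M)))"
    by (intro compact_imp_seq_compact compact_Times compact_cball)
  from seq_compactE[OF this pairs] obtain z \<rho> where z: "z \<in> cball ubar r \<times> cball (0::'u \<times> 'v \<times> real) (C * measure M (space M))"
    and \<rho>: "strict_mono \<rho>" and zlim: "((\<lambda>k. (u k, integral\<^sup>L M (F k))) \<circ> \<rho>) \<longlonglongrightarrow> z"
    by blast
  define u' where "u' = fst z"
  have u': "u' \<in> cball ubar r" using z by (auto simp: u'_def)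
  have ulim: "(\<lambda>k. u (\<rho> k)) \<longlonglongrightarrow> u'"
    using tendsto_fst[OF zlim] by (simp add: u'_def o_def)
  have Flim: "(\<lambda>k. integral\<^sup>L M (F (\<rho> k))) \<longlonglongrightarrow> snd z"
    using tendsto_snd[OF zlim] by (simp add: o_def)
  have "snd z \<in> selection_integrals M C (\<lambda>k. F (\<rho> k))"
    by (rule selection_integrals_closed[OF F _ Flim]) (use FC in blast)
  from selection_integralsD[OF this] obtain g where g[measurable]: "g \<in> borel_measurable M"
    and gC: "\<forall>t\<in>space M. norm (g t) \<le> C"
    and gcl: "AE t in M. cluster_point (\<lambda>k. F (\<rho> k) t) (g t)" and gz: "snd z = integral\<^sup>L M g"
    by (elim exE conjE)
  have int_g: "integrable M g" by (rule integrable_bounded[OF g]) (use gC in blast)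
  define v' where "v' t = fst (g t)" for t
  define f' where "f' t = fst (snd (g t)) + y0 t" for t
  have fst_meas: "(fst :: 'u \<times> 'v \<times> real \<Rightarrow> 'u) \<in> borel_measurable borel"
    and snd_meas: "(\<lambda>z :: 'u \<times> 'v \<times> real. fst (snd z)) \<in> borel_measurable borel"
    by (intro borel_measurable_continuous_onI continuous_intros)+
  have v'm[measurable]: "v' \<in> borel_measurable M"
    unfolding v'_def by (rule measurable_compose[OF g fst_meas])
  have f'm[measurable]: "f' \<in> borel_measurable M"
    unfolding f'_def by (intro borel_measurable_add measurable_compose[OF g snd_meas] y0_measurable)
  have lim_AE: "AE t in M. near_graph t (v' t) (f' t) \<and> snd (snd (g t)) = norm (v' t - u') ^ 2"
    using gcl good_AE
  proof eventually_elim
    fix t assume cl: "cluster_point (\<lambda>k. F (\<rho> k) t) (g t)" and gt: "good t"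
    obtain q where q: "strict_mono q" "((\<lambda>k. F (\<rho> k) t) \<circ> q) \<longlonglongrightarrow> g t"
      using cl unfolding cluster_point_def by blast
    define s where "s k = \<rho> (q k)" for k
    have lim: "(\<lambda>k. (v (s k) t, f (s k) t - y0 t, norm (v (s k) t - u (s k)) ^ 2)) \<longlonglongrightarrow> g t"
      using q(2) gt by (simp add: F_def o_def s_def)
    have l1: "(\<lambda>k. v (s k) t) \<longlonglongrightarrow> v' t" using tendsto_fst[OF lim] by (simp add: v'_def)
    have l2: "(\<lambda>k. f (s k) t) \<longlonglongrightarrow> f' t"
      using tendsto_add[OF tendsto_fst[OF tendsto_snd[OF lim]] tendsto_const[of "y0 t"]] by (simp add: f'_def)
    have l3: "(\<lambda>k. norm (v (s k) t - u (s k)) ^ 2) \<longlonglongrightarrow> snd (snd (g t))"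
      using tendsto_snd[OF tendsto_snd[OF lim]] by simp
    have lu: "(\<lambda>k. u (s k)) \<longlonglongrightarrow> u'"
      using LIMSEQ_subseq_LIMSEQ[OF ulim q(1)] by (simp add: o_def s_def)
    have l4: "(\<lambda>k. norm (v (s k) t - u (s k)) ^ 2) \<longlonglongrightarrow> norm (v' t - u') ^ 2"
      by (intro tendsto_intros l1 lu)
    have ng: "near_graph t (v k t) (f k t)" for k using gt by (simp add: good_def)
    have "v' t \<in> cball ubar r"
      by (rule closed_sequentially[OF closed_cball _ l1]) (use ng in \<open>simp add: near_graph_def\<close>)
    moreover have "f' t \<in> cball (y0 t) \<gamma>"
      by (rule closed_sequentially[OF closed_cball _ l2]) (use ng in \<open>simp add: near_graph_def\<close>)
    moreover have "(v' t, f' t) \<in> gph (\<Phi> t)"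
    proof (rule closed_sequentially[OF closed_graph _ tendsto_Pair[OF l1 l2]])
      show "t \<in> T0" using gt by (simp add: good_def)
    qed (use ng in \<open>simp add: near_graph_def gph_def\<close>)
    ultimately show "near_graph t (v' t) (f' t) \<and> snd (snd (g t)) = norm (v' t - u') ^ 2"
      using LIMSEQ_unique[OF l3 l4] by (simp add: near_graph_def gph_def)
  qed
  have adm': "admissible v' f'"
    unfolding admissible_def using lim_AE by (auto elim!: eventually_mono)
  have fst_int: "(LINT t|M. fst (snd (h t))) = fst (snd (integral\<^sup>L M h))"
    and snd_int: "(LINT t|M. snd (snd (h t))) = snd (snd (integral\<^sup>L M h))"
    if "integrable M h" for h :: "'t \<Rightarrow> 'u \<times> 'v \<times> real"
    using integral_bounded_linear[OF bounded_linear_compose[OF bounded_linear_fst bounded_linear_snd] that]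
      integral_bounded_linear[OF bounded_linear_compose[OF bounded_linear_snd bounded_linear_snd] that]
    by simp_all
  have fint: "integral\<^sup>L M (f k) = fst (snd (integral\<^sup>L M (F k))) + integral\<^sup>L M y0" for k
  proof -
    have "fst (snd (integral\<^sup>L M (F k))) = (LINT t|M. fst (snd (F k t)))" using fst_int[OF int_F] by simp
    also have "\<dots> = (LINT t|M. f k t - y0 t)"
    proof (rule integral_cong_AE)
      show "(\<lambda>t. fst (snd (F k t))) \<in> borel_measurable M" by (rule measurable_compose[OF F snd_meas])
      show "AE t in M. fst (snd (F k t)) = f k t - y0 t"
        using good_AE by eventually_elim (simp add: F_def)
    qed measurable
    also have "\<dots> = integral\<^sup>L M (f k) - integral\<^sup>L M y0"
      using admissible_integrable(1) adm y0 by (intro Bochner_Integration.integral_diff) auto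
    finally show ?thesis by simp
  qed
  have f'int: "integral\<^sup>L M f' = fst (snd (integral\<^sup>L M g)) + integral\<^sup>L M y0"
  proof -
    have "integrable M (\<lambda>t. fst (snd (g t)))"
      by (intro integrable_fst integrable_snd int_g)
    then show ?thesis
      unfolding f'_def using y0 by (simp add: fst_int[OF int_g])
  qed
  have nm: "(\<lambda>t. snd (snd (h t))) \<in> borel_measurable M" if "h \<in> borel_measurable M" for h :: "'t \<Rightarrow> 'u \<times> 'v \<times> real"
    by (rule measurable_compose[OF that]) (intro borel_measurable_continuous_onI continuous_intros)
  have sint: "(LINT t|M. norm (v k t - u k) ^ 2) = snd (snd (integral\<^sup>L M (F k)))" for k
  proof -
    have "(LINT t|M. norm (v k t - u k) ^ 2) = (LINT t|M. snd (snd (F k t)))"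
      by (rule integral_cong_AE[OF _ nm[OF F]])
         (use good_AE in \<open>auto simp: F_def elim!: eventually_mono\<close>)
    then show ?thesis using snd_int[OF int_F] by simp
  qed
  have s'int: "(LINT t|M. norm (v' t - u') ^ 2) = snd (snd (integral\<^sup>L M g))"
  proof -
    have "(LINT t|M. norm (v' t - u') ^ 2) = (LINT t|M. snd (snd (g t)))"
    proof (rule integral_cong_AE[OF _ nm[OF g]])
      show "AE t in M. norm (v' t - u') ^ 2 = snd (snd (g t))" using lim_AE by eventually_elim simp
    qed measurable
    then show ?thesis using snd_int[OF int_g] by simp
  qed
  have "(\<lambda>k. integral\<^sup>L M (f (\<rho> k))) \<longlonglongrightarrow> integral\<^sup>L M f'"
    unfolding fint f'int using Flim unfolding gz by (intro tendsto_intros)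
  moreover have "(\<lambda>k. LINT t|M. norm (v (\<rho> k) t - u (\<rho> k)) ^ 2) \<longlonglongrightarrow> (LINT t|M. norm (v' t - u') ^ 2)"
    unfolding sint s'int using Flim unfolding gz by (intro tendsto_intros)
  ultimately show ?thesis using \<rho> u' ulim adm'
    by (intro exI[of _ \<rho>] exI[of _ u'] exI[of _ v'] exI[of _ f'] conjI)
qed

text \<open>
On the feasible points a regular normal \<open>us\<close> obeys \<open>us \<bullet> (u - ubar) \<le> e * norm (u - ubar)\<close>, so the factor \<open>2 * e\<close>
makes \<open>ubar\<close> a strict minimiser there. The non-smooth term contains \<open>u\<close> only. Hence the normals to \<open>K\<close>, \<open>Om\<close>
and the graphs come out exact, and the error appears only in the equation that links them to \<open>us\<close>. The weight
\<open>c\<close> of the last term is chosen later in terms of the Lipschitz constant.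
\<close>

definition penalty :: "'v set \<Rightarrow> 'u set \<Rightarrow> 'u \<Rightarrow> real \<Rightarrow> real \<Rightarrow> real \<Rightarrow> 'u \<Rightarrow> ('t \<Rightarrow> 'u) \<Rightarrow> ('t \<Rightarrow> 'v) \<Rightarrow> real" where
  "penalty K Om us e c n u v f = - inner us (u - ubar) + 2 * e * norm (u - ubar)
     + n / 2 * infdist u Om ^ 2 + n / 2 * infdist (integral\<^sup>L M f) K ^ 2
     + c * n / 2 * (LINT t|M. norm (v t - u) ^ 2)"

lemma penalty_lower_bound:
  assumes "u \<in> cball ubar r" "e \<ge> 0" "c \<ge> 0" "n \<ge> 0"
  shows "- (norm us * r) \<le> penalty K Om us e c n u v f"
proof -
  have "inner us (u - ubar) \<le> norm us * norm (u - ubar)" by (rule norm_cauchy_schwarz)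
  also have "\<dots> \<le> norm us * r"
    using assms(1) by (intro mult_left_mono) (auto simp: dist_norm norm_minus_commute)
  finally have "- (norm us * r) \<le> - inner us (u - ubar)" by simp
  moreover have "0 \<le> 2 * e * norm (u - ubar)" "0 \<le> n / 2 * infdist u Om ^ 2"
    "0 \<le> n / 2 * infdist (integral\<^sup>L M f) K ^ 2" "0 \<le> c * n / 2 * (LINT t|M. norm (v t - u) ^ 2)"
    using assms by simp_all
  ultimately show ?thesis unfolding penalty_def by linarith
qed

lemma penalty_base:
  assumes "ubar \<in> Om" "integral\<^sup>L M y0 \<in> K"
  shows "penalty K Om us e c n ubar (\<lambda>_. ubar) y0 = 0"
  using assms by (simp add: penalty_def)

lemma penalty_minimiser:
  assumes "e \<ge> 0" "c \<ge> 0" "n \<ge> 0"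
  shows "\<exists>u v f. u \<in> cball ubar r \<and> admissible v f \<and>
    (\<forall>u' v' f'. u' \<in> cball ubar r \<longrightarrow> admissible v' f' \<longrightarrow>
       penalty K Om us e c n u v f \<le> penalty K Om us e c n u' v' f')"
proof -
  define J where "J = penalty K Om us e c n"
  define X where "X = {J u v f | u v f. u \<in> cball ubar r \<and> admissible v f}"
  have "ubar \<in> cball ubar r" using r by simp
  then have ne: "X \<noteq> {}" using admissible_base unfolding X_def by blast
  have bdd: "bdd_below X"
    unfolding X_def J_def using penalty_lower_bound[OF _ assms]
    by (intro bdd_belowI[of _ "- (norm us * r)"]) blast
  have "Inf X \<in> closure X" by (rule closure_contains_Inf[OF ne bdd])
  then obtain x where x: "\<forall>k. x k \<in> X" "x \<longlonglongrightarrow> Inf X" unfolding closure_sequential by blast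
  have "\<forall>k. \<exists>z. fst z \<in> cball ubar r \<and> admissible (fst (snd z)) (snd (snd z)) \<and>
      x k = J (fst z) (fst (snd z)) (snd (snd z))"
  proof
    fix k
    obtain u v f where "u \<in> cball ubar r" "admissible v f" "x k = J u v f"
      using x(1) unfolding X_def by blast
    then show "\<exists>z. fst z \<in> cball ubar r \<and> admissible (fst (snd z)) (snd (snd z)) \<and>
      x k = J (fst z) (fst (snd z)) (snd (snd z))" by (intro exI[of _ "(u, v, f)"]) simp
  qed
  from choice[OF this] obtain z where z: "\<forall>k. fst (z k) \<in> cball ubar r \<and>
    admissible (fst (snd (z k))) (snd (snd (z k))) \<and> x k = J (fst (z k)) (fst (snd (z k))) (snd (snd (z k)))"
    by (elim exE)
  define u where "u k = fst (z k)" for k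
  define v where "v k = fst (snd (z k))" for k
  define f where "f k = snd (snd (z k))" for k
  have u: "\<forall>k. u k \<in> cball ubar r" and adm: "\<forall>k. admissible (v k) (f k)" and xJ: "\<And>k. x k = J (u k) (v k) (f k)"
    using z by (simp_all add: u_def v_def f_def)
  from admissible_compactness[OF u adm]
  obtain \<rho> :: "nat \<Rightarrow> nat" and u' v' f' where \<rho>: "strict_mono \<rho>" and u': "u' \<in> cball ubar r"
    and ulim: "(\<lambda>k. u (\<rho> k)) \<longlonglongrightarrow> u'" and adm': "admissible v' f'"
    and flim: "(\<lambda>k. integral\<^sup>L M (f (\<rho> k))) \<longlonglongrightarrow> integral\<^sup>L M f'"
    and vlim: "(\<lambda>k. LINT t|M. norm (v (\<rho> k) t - u (\<rho> k)) ^ 2) \<longlonglongrightarrow> (LINT t|M. norm (v' t - u') ^ 2)"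
    by (elim exE conjE)
  have "(\<lambda>k. J (u (\<rho> k)) (v (\<rho> k)) (f (\<rho> k))) \<longlonglongrightarrow> J u' v' f'"
    unfolding J_def penalty_def by (intro tendsto_intros ulim flim vlim)
  moreover have "(\<lambda>k. J (u (\<rho> k)) (v (\<rho> k)) (f (\<rho> k))) \<longlonglongrightarrow> Inf X"
    using LIMSEQ_subseq_LIMSEQ[OF x(2) \<rho>] by (simp add: o_def xJ)
  ultimately have eq: "J u' v' f' = Inf X" by (rule LIMSEQ_unique)
  have "J u' v' f' \<le> J u1 v1 f1" if "u1 \<in> cball ubar r" "admissible v1 f1" for u1 v1 f1
    unfolding eq by (rule cInf_lower[OF _ bdd]) (use that X_def in blast)
  then show ?thesis using u' adm' unfolding J_def by blast
qed

text \<open>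
Let \<open>B j\<close> be the set of those \<open>t\<close> for which some point near the graph violates the inequality by
\<open>1 / Suc j\<close>. It is measurable as a projection, and replacing \<open>(v, f)\<close> on it by a measurable selection of
violating points decreases the penalty by at least \<open>measure M (B j) / Suc j\<close>; so \<open>B j\<close> is a null set. The
distance to \<open>K\<close> is estimated by the distance to the fixed nearest point \<open>\<kappa>\<close>, and the square of the integral of
the change by an integral of squares. This costs the last, quadratic term of the inequality, which does not
affect normals, and thereby atoms need no separate treatment.
\<close>

proposition pointwise_optimality:
  fixes u and n c :: real
  defines "m \<equiv> measure M (space M)"
  assumes u: "u \<in> cball ubar r" and adm: "admissible v f" and n: "n \<ge> 0" and c: "c \<ge> 0"
    and \<kappa>: "\<kappa> \<in> K" "infdist (integral\<^sup>L M f) K = dist (integral\<^sup>L M f) \<kappa>"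
    and opt: "\<And>v' f'. admissible v' f' \<Longrightarrow> penalty K Om us e c n u v f \<le> penalty K Om us e c n u v' f'"
    and ys: "ys = n *\<^sub>R (integral\<^sup>L M f - \<kappa>)"
  shows "AE t in M. t \<in> T0 \<and> near_graph t (v t) (f t) \<and> (\<forall>v' f'. near_graph t v' f' \<longrightarrow>
    0 \<le> c * n / 2 * (norm (v' - u) ^ 2 - norm (v t - u) ^ 2) + inner ys (f' - f t)
        + n / 2 * m * norm (f' - f t) ^ 2)"
proof -
  define Q where "Q t v' f' = c * n / 2 * (norm (v' - u) ^ 2 - norm (v t - u) ^ 2) + inner ys (f' - f t)
        + n / 2 * m * norm (f' - f t) ^ 2" for t v' f'
  have vm[measurable]: "v \<in> borel_measurable M" and fm[measurable]: "f \<in> borel_measurable M"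
    using adm by (simp_all add: admissible_def)
  define T1 where "T1 = {t \<in> space M. t \<in> T0 \<and> near_graph t (v t) (f t)}"
  have T1_AE: "AE t in M. t \<in> T0 \<and> near_graph t (v t) (f t)"
    using adm T0_full unfolding admissible_def by auto
  have T1[measurable]: "T1 \<in> sets M" unfolding T1_def by (rule sets_AE_complete[OF T1_AE])
  define gr where "gr = {(t, x, y). t \<in> space M \<and> y \<in> \<Phi> t x}"
  have gr[measurable]: "gr \<in> sets (M \<Otimes>\<^sub>M borel)"
    using integrand unfolding set_valued_normal_integrand_def gr_def by blast
  define G where "G j = {w \<in> space (M \<Otimes>\<^sub>M borel). w \<in> gr \<and> fst w \<in> T1 \<and> dist ubar (fst (snd w)) \<le> r \<and>
      dist (y0 (fst w)) (snd (snd w)) \<le> \<gamma> \<and> Q (fst w) (fst (snd w)) (snd (snd w)) \<le> - (1 / real (Suc j))}" for j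
  have m1[measurable]: "(\<lambda>w::'t \<times> 'u \<times> 'v. fst (snd w)) \<in> borel_measurable (M \<Otimes>\<^sub>M borel)"
    by (rule measurable_compose[OF measurable_snd]) (intro borel_measurable_continuous_onI continuous_intros)
  have m2[measurable]: "(\<lambda>w::'t \<times> 'u \<times> 'v. snd (snd w)) \<in> borel_measurable (M \<Otimes>\<^sub>M borel)"
    by (rule measurable_compose[OF measurable_snd]) (intro borel_measurable_continuous_onI continuous_intros)
  have G: "G j \<in> sets (M \<Otimes>\<^sub>M borel)" for j
    unfolding G_def Q_def by measurable
  have G_iff: "(t, v', f') \<in> G j \<longleftrightarrow> t \<in> T1 \<and> near_graph t v' f' \<and> Q t v' f' \<le> - (1 / real (Suc j))" for t v' f' j
    by (auto simp: G_def gr_def T1_def near_graph_def space_pair_measure)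
  define B where "B j = fst ` G j" for j
  have B[measurable]: "B j \<in> sets M" for j
    unfolding B_def by (rule sets_projection[OF complete G])
  have BT1: "B j \<subseteq> T1" for j using G_iff by (fastforce simp: B_def)
  have cpt: "compact {z. (t, z) \<in> G j}" if t: "t \<in> B j" for t j
  proof -
    have tT: "t \<in> T1" "t \<in> T0" using t BT1 by (auto simp: T1_def)
    have eq: "{z. (t, z) \<in> G j} = (cball ubar r \<times> cball (y0 t) \<gamma>) \<inter>
        (gph (\<Phi> t) \<inter> {z. Q t (fst z) (snd z) \<le> - (1 / real (Suc j))})"
      using tT by (auto simp: G_iff near_graph_def gph_def)
    have "closed {z. Q t (fst z) (snd z) \<le> - (1 / real (Suc j))}"
      unfolding Q_def by (intro closed_Collect_le continuous_intros)
    then show ?thesis unfolding eq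
      by (intro compact_Int_closed compact_Times compact_cball closed_Int closed_graph tT)
  qed
  have null: "measure M (B j) = 0" for j
  proof -
    have "\<exists>g\<in>borel_measurable M. \<forall>t\<in>B j. (t, g t) \<in> G j"
    proof (rule measurable_selection_compact[OF complete G B cpt])
      fix t assume "t \<in> B j"
      then obtain w where "w \<in> G j" "t = fst w" unfolding B_def by blast
      then have "(t, snd w) \<in> G j" by simp
      then show "\<exists>z. (t, z) \<in> G j" by blast
    qed
    then obtain g where g[measurable]: "g \<in> borel_measurable M" and gG: "\<And>t. t \<in> B j \<Longrightarrow> (t, g t) \<in> G j" by blast
    define v1 where "v1 t = (if t \<in> B j then fst (g t) else v t)" for t
    define f1 where "f1 t = (if t \<in> B j then snd (g t) else f t)" for t
    have "(\<lambda>t. fst (g t)) \<in> borel_measurable M" "(\<lambda>t. snd (g t)) \<in> borel_measurable M"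
      by (rule measurable_compose[OF g], intro borel_measurable_continuous_onI continuous_intros)+
    then have v1m[measurable]: "v1 \<in> borel_measurable M" and f1m[measurable]: "f1 \<in> borel_measurable M"
      unfolding v1_def f1_def by measurable
    have gB: "near_graph t (fst (g t)) (snd (g t)) \<and> Q t (fst (g t)) (snd (g t)) \<le> - (1 / real (Suc j))"
      if "t \<in> B j" for t
      using gG[OF that] G_iff[of t "fst (g t)" "snd (g t)" j] by simp
    have adm1: "admissible v1 f1"
      unfolding admissible_def
    proof (intro conjI v1m f1m)
      show "AE t in M. near_graph t (v1 t) (f1 t)"
        using T1_AE by eventually_elim (use gB in \<open>auto simp: v1_def f1_def\<close>)
    qed
    have i: "integrable M f" "integrable M f1" "integrable M (\<lambda>t. norm (v t - u) ^ 2)"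
      "integrable M (\<lambda>t. norm (v1 t - u) ^ 2)"
      using admissible_integrable[OF adm] admissible_integrable[OF adm1] u by auto
    define h where "h t = f1 t - f t" for t
    have h: "integrable M h" unfolding h_def using i by simp
    have "AE t in M. norm (norm (h t) ^ 2) \<le> (l * r + l * r) ^ 2"
      using admissible_AE_bound[OF adm] admissible_AE_bound[OF adm1]
    proof eventually_elim
      fix t assume "norm (f t - y0 t) \<le> l * r \<and> norm (v t - ubar) \<le> r"
        and "norm (f1 t - y0 t) \<le> l * r \<and> norm (v1 t - ubar) \<le> r"
      then have "norm (h t) \<le> l * r + l * r"
        using norm_triangle_ineq4[of "f1 t - y0 t" "f t - y0 t"] by (simp add: h_def)
      then have "norm (h t) ^ 2 \<le> (l * r + l * r) ^ 2" by (rule power_mono) simp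
      then show "norm (norm (h t) ^ 2) \<le> (l * r + l * r) ^ 2" by (simp only: real_norm_def abs_power2)
    qed
    then have h2: "integrable M (\<lambda>t. norm (h t) ^ 2)"
      by (intro integrable_const_bound[of _ "(l * r + l * r) ^ 2"]) (auto simp: h_def)
    define \<Delta> where "\<Delta> = integral\<^sup>L M h"
    define \<xi> where "\<xi> = integral\<^sup>L M f"
    have \<xi>1: "integral\<^sup>L M f1 = \<xi> + \<Delta>" unfolding \<Delta>_def h_def \<xi>_def using i by simp
    have "infdist (\<xi> + \<Delta>) K \<le> dist (\<xi> + \<Delta>) \<kappa>" by (rule infdist_le[OF \<kappa>(1)])
    then have "infdist (\<xi> + \<Delta>) K ^ 2 \<le> norm ((\<xi> - \<kappa>) + \<Delta>) ^ 2"
      using infdist_nonneg[of "\<xi> + \<Delta>" K] by (intro power_mono) (simp_all add: dist_norm algebra_simps)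
    also have "\<dots> = norm (\<xi> - \<kappa>) ^ 2 + 2 * inner (\<xi> - \<kappa>) \<Delta> + norm \<Delta> ^ 2"
      by (simp add: power2_norm_eq_inner inner_add_left inner_add_right inner_commute)
    finally have dK: "infdist (\<xi> + \<Delta>) K ^ 2 - infdist \<xi> K ^ 2 \<le> 2 * inner (\<xi> - \<kappa>) \<Delta> + norm \<Delta> ^ 2"
      using \<kappa>(2) by (simp add: \<xi>_def dist_norm)
    have "0 \<le> penalty K Om us e c n u v1 f1 - penalty K Om us e c n u v f"
      using opt[OF adm1] by simp
    also have "\<dots> = n / 2 * (infdist (\<xi> + \<Delta>) K ^ 2 - infdist \<xi> K ^ 2)
        + c * n / 2 * ((LINT t|M. norm (v1 t - u) ^ 2) - (LINT t|M. norm (v t - u) ^ 2))"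
      unfolding penalty_def \<xi>1 \<xi>_def[symmetric] by (simp add: algebra_simps)
    also have "\<dots> \<le> n / 2 * (2 * inner (\<xi> - \<kappa>) \<Delta> + norm \<Delta> ^ 2)
        + c * n / 2 * ((LINT t|M. norm (v1 t - u) ^ 2) - (LINT t|M. norm (v t - u) ^ 2))"
      using dK n by (intro add_right_mono mult_left_mono) auto
    also have "\<dots> \<le> n / 2 * (2 * inner (\<xi> - \<kappa>) \<Delta> + m * (LINT t|M. norm (h t) ^ 2))
        + c * n / 2 * ((LINT t|M. norm (v1 t - u) ^ 2) - (LINT t|M. norm (v t - u) ^ 2))"
      using norm_integral_power2_le[OF h h2] n unfolding \<Delta>_def m_def
      by (intro add_right_mono mult_left_mono add_left_mono) auto
    also have "\<dots> = (LINT t|M. c * n / 2 * (norm (v1 t - u) ^ 2 - norm (v t - u) ^ 2) + inner ys (h t)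
        + n / 2 * m * norm (h t) ^ 2)"
      using i h h2 unfolding ys \<Delta>_def \<xi>_def by (simp add: algebra_simps)
    also have "\<dots> \<le> (LINT t|M. - (1 / real (Suc j)) * indicator (B j) t)"
    proof (rule integral_mono)
      show "c * n / 2 * (norm (v1 t - u) ^ 2 - norm (v t - u) ^ 2) + inner ys (h t)
        + n / 2 * m * norm (h t) ^ 2 \<le> - (1 / real (Suc j)) * indicator (B j) t" for t
        using gB[of t] by (auto simp: v1_def f1_def h_def Q_def indicator_def simp del: of_nat_Suc)
    qed (use i h h2 in \<open>auto simp: emeasure_eq_measure\<close>)
    also have "\<dots> = - (1 / real (Suc j)) * measure M (B j)" by simp
    finally have "1 / real (Suc j) * measure M (B j) \<le> 0" by simp
    moreover have "1 / real (Suc j) > 0" by simp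
    ultimately have "measure M (B j) \<le> 0" by (simp only: mult_le_0_iff) linarith
    then show ?thesis by (intro antisym measure_nonneg)
  qed
  have "AE t in M. \<forall>j. t \<notin> B j"
  proof -
    have "B j \<in> null_sets M" for j using null[of j] B[of j] by (simp add: null_sets_def emeasure_eq_measure)
    then show ?thesis by (simp add: AE_all_countable AE_not_in)
  qed
  with T1_AE show ?thesis
  proof (rule AE_mp[OF AE_conjI], intro AE_I2 impI conjI allI)
    fix t v' f' assume tM: "t \<in> space M" and t: "(t \<in> T0 \<and> near_graph t (v t) (f t)) \<and> (\<forall>j. t \<notin> B j)"
      and ng: "near_graph t v' f'"
    have "- Q t v' f' \<le> 0"
    proof (rule ccontr)
      assume "\<not> - Q t v' f' \<le> 0"
      then have "0 < - Q t v' f'" by simp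
      then obtain j where "1 / real (Suc j) < - Q t v' f'" using nat_approx_posE by blast
      then have "(t, v', f') \<in> G j" unfolding G_iff using t tM ng by (simp add: T1_def)
      then have "t \<in> B j" unfolding B_def by (rule image_eqI[rotated]) simp
      then show False using t by blast
    qed
    then show "0 \<le> c * n / 2 * (norm (v' - u) ^ 2 - norm (v t - u) ^ 2) + inner ys (f' - f t)
        + n / 2 * m * norm (f' - f t) ^ 2" by (simp add: Q_def)
  qed auto
qed

end

section \<open>Approximate normals\<close>

text \<open>
The inequality is tested with a short step in the direction \<open>- Z\<close>.
\<close>

lemma norm_le_of_first_order:
  fixes Z :: "'b::real_inner"
  assumes s0: "s0 > 0" and C: "C \<ge> 0" and a: "a \<ge> 0"
    and ineq: "\<And>d. norm d \<le> s0 \<Longrightarrow> 0 \<le> inner Z d + a * norm d + C * norm d ^ 2"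
  shows "norm Z \<le> a"
proof (rule ccontr)
  assume "\<not> norm Z \<le> a"
  then have gap: "norm Z - a > 0" by simp
  then have Z: "norm Z > 0" using a by linarith
  define s where "s = min (s0 / norm Z) ((norm Z - a) / (2 * (C + 1) * norm Z))"
  have s: "s > 0" using s0 gap Z C by (simp add: s_def)
  have "norm (- s *\<^sub>R Z) \<le> s0"
  proof -
    have "s * norm Z \<le> s0 / norm Z * norm Z" by (intro mult_right_mono) (simp_all add: s_def)
    also have "\<dots> = s0" using Z by simp
    finally show ?thesis using s by simp
  qed
  from ineq[OF this] have "0 \<le> s * (norm Z * (- norm Z + a + C * s * norm Z))"
    using s by (simp add: power2_norm_eq_inner[symmetric] power2_eq_square algebra_simps)
  then have "0 \<le> - norm Z + a + C * s * norm Z"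
    using s Z by (simp add: zero_le_mult_iff)
  moreover have "C * s * norm Z \<le> (norm Z - a) / 2"
  proof -
    have "C * s * norm Z \<le> (C + 1) * ((norm Z - a) / (2 * (C + 1) * norm Z)) * norm Z"
      using C s by (intro mult_right_mono mult_mono) (simp_all add: s_def)
    also have "\<dots> = (norm Z - a) / 2"
    proof -
      have cancel: "p * (g / (2 * p * z)) * z = g / 2" if "p \<noteq> 0" "z \<noteq> 0" for p g z :: real
        using that by (simp add: field_simps)
      show ?thesis by (rule cancel) (use C Z in auto)
    qed
    finally show ?thesis .
  qed
  ultimately have "0 \<le> - (norm Z - a) + (norm Z - a) / 2" by linarith
  then show False using gap by (simp add: field_simps)
qed

context lipschitz_integrand
begin

text \<open>
Comparison with the value zero at \<open>ubar\<close> bounds the penalised squares by a multiple of \<open>1 / n\<close>. By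
compactness some minimisers converge to a feasible point \<open>u'\<close> with
\<open>2 * e * norm (u' - ubar) \<le> us \<bullet> (u' - ubar)\<close>, and the assumption on \<open>us\<close> leaves only \<open>u' = ubar\<close>.
\<close>

lemma penalty_minimisers_converge:
  assumes K: "closed K" and Om: "closed Om" and base: "ubar \<in> Om" "integral\<^sup>L M y0 \<in> K"
    and e: "e > 0" and c: "c \<ge> 1"
    and reg: "\<And>u. u \<in> Om \<Longrightarrow> u \<in> cball ubar r \<Longrightarrow> expected_multifunction M \<Phi> u \<inter> K \<noteq> {} \<Longrightarrow>
        inner us (u - ubar) \<le> e * norm (u - ubar)"
    and \<delta>: "\<delta> > 0"
  shows "\<exists>n u v f. n > 0 \<and> norm (u - ubar) < \<delta> \<and> u \<in> cball ubar r \<and> admissible v f \<and>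
    infdist u Om < \<delta> \<and> infdist (integral\<^sup>L M f) K < \<delta> \<and>
    (\<forall>u' v' f'. u' \<in> cball ubar r \<longrightarrow> admissible v' f' \<longrightarrow>
       penalty K Om us e c n u v f \<le> penalty K Om us e c n u' v' f')"
proof -
  define N where "N k = real (Suc k)" for k
  have N: "N k > 0" for k by (simp add: N_def)
  have "\<forall>k. \<exists>z. fst z \<in> cball ubar r \<and> admissible (fst (snd z)) (snd (snd z)) \<and>
    (\<forall>u' v' f'. u' \<in> cball ubar r \<longrightarrow> admissible v' f' \<longrightarrow>
       penalty K Om us e c (N k) (fst z) (fst (snd z)) (snd (snd z)) \<le> penalty K Om us e c (N k) u' v' f')"
  proof
    fix k
    obtain u v f where "u \<in> cball ubar r" "admissible v f"
      "\<forall>u' v' f'. u' \<in> cball ubar r \<longrightarrow> admissible v' f' \<longrightarrow>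
       penalty K Om us e c (N k) u v f \<le> penalty K Om us e c (N k) u' v' f'"
      using penalty_minimiser[of e c "N k" K Om us] e c N[of k] by (auto simp: less_imp_le)
    then show "\<exists>z. fst z \<in> cball ubar r \<and> admissible (fst (snd z)) (snd (snd z)) \<and>
    (\<forall>u' v' f'. u' \<in> cball ubar r \<longrightarrow> admissible v' f' \<longrightarrow>
       penalty K Om us e c (N k) (fst z) (fst (snd z)) (snd (snd z)) \<le> penalty K Om us e c (N k) u' v' f')"
      by (intro exI[of _ "(u, v, f)"]) simp
  qed
  from choice[OF this] obtain z where z: "\<forall>k. fst (z k) \<in> cball ubar r \<and>
    admissible (fst (snd (z k))) (snd (snd (z k))) \<and>
    (\<forall>u' v' f'. u' \<in> cball ubar r \<longrightarrow> admissible v' f' \<longrightarrow>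
       penalty K Om us e c (N k) (fst (z k)) (fst (snd (z k))) (snd (snd (z k))) \<le> penalty K Om us e c (N k) u' v' f')"
    by (elim exE)
  define u where "u k = fst (z k)" for k
  define v where "v k = fst (snd (z k))" for k
  define f where "f k = snd (snd (z k))" for k
  have u: "\<forall>k. u k \<in> cball ubar r" and adm: "\<forall>k. admissible (v k) (f k)"
    and min: "\<forall>k. \<forall>u' v' f'. u' \<in> cball ubar r \<longrightarrow> admissible v' f' \<longrightarrow>
       penalty K Om us e c (N k) (u k) (v k) (f k) \<le> penalty K Om us e c (N k) u' v' f'"
    using z by (simp_all add: u_def v_def f_def)
  define A where "A k = infdist (u k) Om" for k
  define B where "B k = infdist (integral\<^sup>L M (f k)) K" for k
  define S where "S k = (LINT t|M. norm (v k t - u k) ^ 2)" for k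
  have S0: "S k \<ge> 0" for k by (simp add: S_def)
  have J0: "- inner us (u k - ubar) + 2 * e * norm (u k - ubar) + N k / 2 * A k ^ 2 + N k / 2 * B k ^ 2
      + c * N k / 2 * S k \<le> 0" for k
  proof -
    have "penalty K Om us e c (N k) (u k) (v k) (f k) \<le> penalty K Om us e c (N k) ubar (\<lambda>_. ubar) y0"
      using min admissible_base r by simp
    then show ?thesis using penalty_base[OF base] by (simp add: penalty_def A_def B_def S_def)
  qed
  have nonneg: "0 \<le> N k / 2 * A k ^ 2" "0 \<le> N k / 2 * B k ^ 2" "0 \<le> c * N k / 2 * S k" for k
    using N[of k] c S0[of k] by simp_all
  have low: "2 * e * norm (u k - ubar) \<le> inner us (u k - ubar)" for k
    using J0[of k] nonneg[of k] by linarith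
  have up: "inner us (u k - ubar) - 2 * e * norm (u k - ubar) \<le> norm us * r" for k
  proof -
    have "inner us (u k - ubar) \<le> norm us * norm (u k - ubar)" by (rule norm_cauchy_schwarz)
    also have "\<dots> \<le> norm us * r" using u by (intro mult_left_mono) (auto simp: dist_norm norm_minus_commute)
    finally have "inner us (u k - ubar) \<le> norm us * r" .
    moreover have "0 \<le> 2 * e * norm (u k - ubar)" using e by simp
    ultimately show ?thesis by linarith
  qed
  define b where "b k = 2 * (norm us * r) / N k" for k
  have b0: "b \<longlonglongrightarrow> 0"
    unfolding b_def N_def using LIMSEQ_Suc[OF lim_const_over_n[of "2 * (norm us * r)"]] by simp
  have A2: "A k ^ 2 \<le> b k" and B2: "B k ^ 2 \<le> b k" and S2: "S k \<le> b k" for k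
  proof -
    have "N k / 2 * A k ^ 2 \<le> norm us * r" "N k / 2 * B k ^ 2 \<le> norm us * r" "c * N k / 2 * S k \<le> norm us * r"
      using J0[of k] nonneg[of k] up[of k] by linarith+
    moreover have "N k / 2 * S k \<le> c * N k / 2 * S k"
      using mult_right_mono[OF c, of "N k / 2 * S k"] N[of k] S0[of k] by simp
    ultimately have "N k / 2 * A k ^ 2 \<le> norm us * r" "N k / 2 * B k ^ 2 \<le> norm us * r"
      "N k / 2 * S k \<le> norm us * r" by linarith+
    then show "A k ^ 2 \<le> b k" "B k ^ 2 \<le> b k" "S k \<le> b k"
      using N[of k] by (simp_all add: b_def pos_le_divide_eq mult.commute)
  qed
  have sq0: "x \<longlonglongrightarrow> 0" if "\<And>k. x k ^ 2 \<le> b k" for x :: "nat \<Rightarrow> real"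
  proof -
    have "(\<lambda>k. x k ^ 2) \<longlonglongrightarrow> 0"
      by (rule tendsto_sandwich[OF _ _ tendsto_const b0]) (use that in simp_all)
    then have "(\<lambda>k. sqrt (x k ^ 2)) \<longlonglongrightarrow> sqrt 0" by (rule tendsto_real_sqrt)
    then have "(\<lambda>k. \<bar>x k\<bar>) \<longlonglongrightarrow> 0" by simp
    then show ?thesis by (rule tendsto_rabs_zero_cancel)
  qed
  have A0: "A \<longlonglongrightarrow> 0" by (rule sq0[OF A2])
  have B0: "B \<longlonglongrightarrow> 0" by (rule sq0[OF B2])
  have S_lim: "S \<longlonglongrightarrow> 0"
    by (rule tendsto_sandwich[OF _ _ tendsto_const b0]) (use S0 S2 in simp_all)
  from admissible_compactness[OF u adm]
  obtain \<rho> :: "nat \<Rightarrow> nat" and u' v' f' where \<rho>: "strict_mono \<rho>" and u': "u' \<in> cball ubar r"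
    and ulim: "(\<lambda>k. u (\<rho> k)) \<longlonglongrightarrow> u'" and adm': "admissible v' f'"
    and flim: "(\<lambda>k. integral\<^sup>L M (f (\<rho> k))) \<longlonglongrightarrow> integral\<^sup>L M f'"
    and vlim: "(\<lambda>k. LINT t|M. norm (v (\<rho> k) t - u (\<rho> k)) ^ 2) \<longlonglongrightarrow> (LINT t|M. norm (v' t - u') ^ 2)"
    by (elim exE conjE)
  have A\<rho>: "(\<lambda>k. A (\<rho> k)) \<longlonglongrightarrow> 0" and B\<rho>: "(\<lambda>k. B (\<rho> k)) \<longlonglongrightarrow> 0" and S\<rho>: "(\<lambda>k. S (\<rho> k)) \<longlonglongrightarrow> 0"
    using LIMSEQ_subseq_LIMSEQ[OF A0 \<rho>] LIMSEQ_subseq_LIMSEQ[OF B0 \<rho>] LIMSEQ_subseq_LIMSEQ[OF S_lim \<rho>]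
    by (simp_all only: o_def)
  have "infdist u' Om = 0"
    by (rule LIMSEQ_unique[OF _ A\<rho>]) (unfold A_def, intro tendsto_intros ulim)
  then have u'Om: "u' \<in> Om" using in_closed_iff_infdist_zero[OF Om] base(1) by blast
  have "infdist (integral\<^sup>L M f') K = 0"
    by (rule LIMSEQ_unique[OF _ B\<rho>]) (unfold B_def, intro tendsto_intros flim)
  then have f'K: "integral\<^sup>L M f' \<in> K" using in_closed_iff_infdist_zero[OF K] base(2) by blast
  have "(LINT t|M. norm (v' t - u') ^ 2) = 0"
    by (rule LIMSEQ_unique[OF _ S\<rho>]) (unfold S_def, rule vlim)
  then have "AE t in M. norm (v' t - u') ^ 2 = 0"
    using integral_nonneg_eq_0_iff_AE[OF admissible_integrable(3)[OF adm' u']] by simp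
  moreover have "AE t in M. near_graph t (v' t) (f' t)" using adm' by (simp add: admissible_def)
  ultimately have "AE t in M. f' t \<in> \<Phi> t u'"
    by eventually_elim (simp add: near_graph_def)
  then have "integral\<^sup>L M f' \<in> expected_multifunction M \<Phi> u'"
    unfolding expected_multifunction_def aumann_integral_def
    using admissible_integrable(1)[OF adm'] by blast
  then have "inner us (u' - ubar) \<le> e * norm (u' - ubar)"
    using f'K by (intro reg u'Om u') blast
  moreover have "2 * e * norm (u' - ubar) \<le> inner us (u' - ubar)"
    by (rule LIMSEQ_le[of "\<lambda>k. 2 * e * norm (u (\<rho> k) - ubar)" _ "\<lambda>k. inner us (u (\<rho> k) - ubar)"])
       (use low in \<open>auto intro!: tendsto_intros ulim\<close>)
  ultimately have "e * norm (u' - ubar) \<le> 0" by simp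
  then have "u' = ubar" using e by (simp add: mult_le_0_iff)
  then have nlim: "(\<lambda>k. norm (u (\<rho> k) - ubar)) \<longlonglongrightarrow> 0"
    using tendsto_norm[OF tendsto_diff[OF ulim tendsto_const[of ubar]]] by simp
  have "\<forall>\<^sub>F k in sequentially. norm (u (\<rho> k) - ubar) < \<delta> \<and> A (\<rho> k) < \<delta> \<and> B (\<rho> k) < \<delta>"
    by (intro eventually_conj order_tendstoD(2)[OF nlim \<delta>] order_tendstoD(2)[OF A\<rho> \<delta>] order_tendstoD(2)[OF B\<rho> \<delta>])
  then obtain k where k: "norm (u (\<rho> k) - ubar) < \<delta>" "A (\<rho> k) < \<delta>" "B (\<rho> k) < \<delta>"
    using eventually_happens'[OF sequentially_bot] by blast
  show ?thesis
    using k u adm min N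
    by (intro exI[of _ "N (\<rho> k)"] exI[of _ "u (\<rho> k)"] exI[of _ "v (\<rho> k)"] exI[of _ "f (\<rho> k)"])
       (simp add: A_def B_def)
qed

text \<open>
The inequality for a regular normal holds in a ball that depends on \<open>e\<close>; the problem is posed inside it.
\<close>

lemma shrink_radius:
  assumes "0 < r'" "r' \<le> r"
  shows "lipschitz_integrand M \<Phi> ubar y0 T0 l \<gamma> r'"
proof (intro lipschitz_integrand.intro lipschitz_integrand_axioms.intro)
  have "3 * l * r' \<le> 3 * l * r" using assms(2) l by (intro mult_left_mono) auto
  then show "3 * l * r' \<le> \<gamma>" using lr by linarith
  have sub: "cball ubar r' \<subseteq> cball ubar r" using assms(2) by (rule subset_cball)
  show "\<exists>x'\<in>\<Phi> t u'. norm (x' - x) \<le> l * norm (u - u')"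
    if "t \<in> T0" "u \<in> cball ubar r'" "u' \<in> cball ubar r'" "x \<in> \<Phi> t u" "x \<in> cball (y0 t) \<gamma>" for t u u' x
    using lip[OF that(1) subsetD[OF sub that(2)] subsetD[OF sub that(3)] that(4,5)] .
qed (use finite_measure_axioms complete integrand T0 T0_full y0 single l assms(1) in simp_all)

text \<open>
The pair \<open>(v, f)\<close> is compared with a pair \<open>(u, f')\<close> over the common point \<open>u\<close>, where
\<open>norm (f' - f) \<le> l * norm (v - u)\<close>. The weight \<open>c = 1 + m * l ^ 2\<close> is such that the quadratic cost of moving
\<open>f\<close> is absorbed and one half of \<open>n * norm (v - u) ^ 2\<close> remains against the linear term.
\<close>

lemma optimal_selection_near:
  assumes t: "t \<in> T0" "near_graph t v f" and u: "u \<in> cball ubar r" and n: "n > 0" and m: "m \<ge> 0"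
    and opt: "\<And>v' f'. near_graph t v' f' \<Longrightarrow>
      0 \<le> (1 + m * l ^ 2) * n / 2 * (norm (v' - u) ^ 2 - norm (v - u) ^ 2) + inner ys (f' - f)
        + n / 2 * m * norm (f' - f) ^ 2"
  shows "n * norm (v - u) \<le> 2 * l * norm ys"
proof -
  obtain f' where f': "near_graph t u f'" "norm (f' - f) \<le> l * norm (v - u)"
    using near_graph_shift[OF t u] by blast
  define a where "a = norm (v - u)"
  have a: "a \<ge> 0" by (simp add: a_def)
  have "inner ys (f' - f) \<le> norm ys * norm (f' - f)" by (rule norm_cauchy_schwarz)
  also have "\<dots> \<le> norm ys * (l * a)" using f'(2) by (intro mult_left_mono) (simp_all add: a_def)
  finally have 1: "inner ys (f' - f) \<le> norm ys * (l * a)" .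
  have "norm (f' - f) ^ 2 \<le> (l * a) ^ 2" using f'(2) unfolding a_def by (rule power_mono) simp
  then have 2: "n / 2 * m * norm (f' - f) ^ 2 \<le> n / 2 * m * (l * a) ^ 2"
    using n m by (intro mult_left_mono) auto
  have "0 \<le> (1 + m * l ^ 2) * n / 2 * (0 - a ^ 2) + inner ys (f' - f) + n / 2 * m * norm (f' - f) ^ 2"
    using opt[OF f'(1)] by (simp add: a_def)
  also have "\<dots> \<le> (1 + m * l ^ 2) * n / 2 * (0 - a ^ 2) + norm ys * (l * a) + n / 2 * m * (l * a) ^ 2"
    using 1 2 by (intro add_mono) auto
  also have "\<dots> = a * (norm ys * l - n / 2 * a)"
    by (simp add: power2_eq_square field_simps)
  finally have *: "0 \<le> a * (norm ys * l - n / 2 * a)" .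
  have "n * a \<le> 2 * l * norm ys"
  proof (cases "a = 0")
    case True
    then show ?thesis using l by simp
  next
    case False
    then have "0 \<le> norm ys * l - n / 2 * a" using * a by (simp add: zero_le_mult_iff)
    then show ?thesis by (simp add: algebra_simps)
  qed
  then show ?thesis by (simp add: a_def)
qed

text \<open>
All points of the graph close to \<open>(v, f)\<close> compete, because \<open>v\<close> lies in the open ball and \<open>f\<close> is strictly
inside the ball of radius \<open>\<gamma>\<close>. Expanding the square turns the inequality into that of a proximal normal.
\<close>

lemma optimal_selection_normal:
  assumes t: "t \<in> T0" "near_graph t v f" and int: "norm (v - ubar) < r" and n: "n > 0" and m: "m \<ge> 0" and c: "c \<ge> 0"
    and opt: "\<And>v' f'. near_graph t v' f' \<Longrightarrow>
      0 \<le> c * n / 2 * (norm (v' - u) ^ 2 - norm (v - u) ^ 2) + inner ys (f' - f)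
        + n / 2 * m * norm (f' - f) ^ 2"
  shows "((c * n) *\<^sub>R (u - v), - ys) \<in> regular_normal_cone (v, f) (gph (\<Phi> t))"
proof -
  define p where "p = (c * n) *\<^sub>R (u - v)"
  define s where "s = min (r - norm (v - ubar)) (\<gamma> - norm (f - y0 t))"
  have "norm (f - y0 t) \<le> l * r" by (rule near_graph_bound(1)[OF t])
  moreover have "l * r < 3 * l * r" using l r by simp
  ultimately have s: "s > 0" using int lr by (simp add: s_def)
  show ?thesis
    unfolding p_def[symmetric]
  proof (rule regular_normal_cone_if_quadratic[OF _ s])
    show "(v, f) \<in> gph (\<Phi> t)" using t(2) by (simp add: near_graph_def gph_def)
    fix z assume z: "z \<in> gph (\<Phi> t)" "dist z (v, f) < s"
    obtain v' f' where zz: "z = (v', f')" by (cases z)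
    have d: "norm (v' - v) < s" "norm (f' - f) < s"
      using z(2) norm_fst_le[of "v' - v" "f' - f"] norm_snd_le[of "f' - f" "v' - v"]
      by (simp_all add: zz dist_norm)
    have "norm (v' - ubar) \<le> norm (v' - v) + norm (v - ubar)"
      using norm_triangle_ineq[of "v' - v" "v - ubar"] by simp
    moreover have "norm (f' - y0 t) \<le> norm (f' - f) + norm (f - y0 t)"
      using norm_triangle_ineq[of "f' - f" "f - y0 t"] by simp
    ultimately have "near_graph t v' f'"
      using d z(1) by (simp add: near_graph_def zz gph_def s_def dist_norm norm_minus_commute)
    from opt[OF this]
    have q: "0 \<le> c * n / 2 * (norm (v' - u) ^ 2 - norm (v - u) ^ 2) + inner ys (f' - f)
        + n / 2 * m * norm (f' - f) ^ 2" .
    have expand: "norm (v' - u) ^ 2 - norm (v - u) ^ 2 = norm (v' - v) ^ 2 - 2 * inner (u - v) (v' - v)"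
      by (simp add: power2_norm_eq_inner inner_diff_left inner_diff_right inner_commute)
    have distrib: "k / 2 * (a - 2 * b) = k / 2 * a - k * b" for k a b :: real
      by (simp add: field_simps)
    have "c * n / 2 * (norm (v' - u) ^ 2 - norm (v - u) ^ 2) = c * n / 2 * norm (v' - v) ^ 2 - inner p (v' - v)"
      unfolding expand p_def inner_scaleR_left by (rule distrib)
    then have "inner p (v' - v) - inner ys (f' - f) \<le> c * n / 2 * norm (v' - v) ^ 2 + n / 2 * m * norm (f' - f) ^ 2"
      using q by linarith
    also have "\<dots> \<le> (c * n / 2 + n / 2 * m) * (norm (v' - v) ^ 2 + norm (f' - f) ^ 2)"
    proof -
      have "0 \<le> c * n / 2 * norm (f' - f) ^ 2" "0 \<le> n / 2 * m * norm (v' - v) ^ 2" using c n m by simp_all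
      then show ?thesis by (simp add: algebra_simps)
    qed
    finally show "inner (p, - ys) (z - (v, f)) \<le> (c * n / 2 + n / 2 * m) * norm (z - (v, f)) ^ 2"
      by (simp add: zz norm_prod_def)
  qed
qed

text \<open>
For fixed \<open>v\<close> and \<open>f\<close> the smooth terms have the gradient \<open>n (u - w) + \<integral>p - us\<close>, up to quadratic terms, and the
norm contributes a slope of at most \<open>2 * e\<close>.
\<close>

lemma stationarity_in_u:
  assumes u: "norm (u - ubar) < r" and adm: "admissible v f" and n: "n > 0" and c: "c \<ge> 0" and e: "e \<ge> 0"
    and w: "w \<in> Om" "infdist u Om = dist u w"
    and opt: "\<And>u'. u' \<in> cball ubar r \<Longrightarrow> penalty K Om us e c n u v f \<le> penalty K Om us e c n u' v f"
  shows "norm (us - n *\<^sub>R (u - w) - (LINT t|M. (c * n) *\<^sub>R (u - v t))) \<le> 2 * e"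
proof -
  define m where "m = measure M (space M)"
  define P where "P = (LINT t|M. (c * n) *\<^sub>R (u - v t))"
  define Z where "Z = n *\<^sub>R (u - w) + P - us"
  have ub: "u \<in> cball ubar r" using u by (simp add: dist_norm norm_minus_commute)
  have iv: "integrable M v" by (rule admissible_integrable(2)[OF adm])
  have P: "P = (c * n) *\<^sub>R (LINT t|M. u - v t)" unfolding P_def using iv by simp
  have "norm Z \<le> 2 * e"
  proof (rule norm_le_of_first_order)
    show "r - norm (u - ubar) > 0" using u by simp
    show "n / 2 + c * n / 2 * m \<ge> 0" using n c by (simp add: m_def)
    show "2 * e \<ge> 0" using e by simp
    fix d :: 'u assume d: "norm d \<le> r - norm (u - ubar)"
    have "norm (u + d - ubar) \<le> norm (u - ubar) + norm d"
      using norm_triangle_ineq[of "u - ubar" d] by (simp add: algebra_simps)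
    then have n1: "norm (u + d - ubar) - norm (u - ubar) \<le> norm d" and u': "u + d \<in> cball ubar r"
      using d by (simp_all add: dist_norm norm_minus_commute)
    have "infdist (u + d) Om ^ 2 \<le> norm ((u - w) + d) ^ 2"
      using infdist_le[OF w(1), of "u + d"] infdist_nonneg[of "u + d" Om]
      by (intro power_mono) (simp_all add: dist_norm algebra_simps)
    also have "\<dots> = norm (u - w) ^ 2 + 2 * inner (u - w) d + norm d ^ 2"
      by (simp add: power2_norm_eq_inner inner_add_left inner_add_right inner_commute)
    finally have n2: "infdist (u + d) Om ^ 2 - infdist u Om ^ 2 \<le> 2 * inner (u - w) d + norm d ^ 2"
      using w(2) by (simp add: dist_norm)
    have n3: "(LINT t|M. norm (v t - (u + d)) ^ 2) - (LINT t|M. norm (v t - u) ^ 2)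
        = 2 * inner (LINT t|M. u - v t) d + m * norm d ^ 2"
    proof -
      have "(LINT t|M. norm (v t - (u + d)) ^ 2) - (LINT t|M. norm (v t - u) ^ 2)
          = (LINT t|M. norm (v t - (u + d)) ^ 2 - norm (v t - u) ^ 2)"
        using admissible_integrable(3)[OF adm ub] admissible_integrable(3)[OF adm u'] by simp
      also have "\<dots> = (LINT t|M. 2 * inner (u - v t) d + norm d ^ 2)"
        by (intro Bochner_Integration.integral_cong)
           (auto simp: power2_norm_eq_inner inner_add_left inner_add_right inner_diff_left inner_diff_right inner_commute)
      also have "\<dots> = 2 * inner (LINT t|M. u - v t) d + m * norm d ^ 2"
        using iv by (simp add: m_def)
      finally show ?thesis .
    qed
    have "0 \<le> penalty K Om us e c n (u + d) v f - penalty K Om us e c n u v f"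
      using opt[OF u'] by simp
    also have "\<dots> = - inner us d + 2 * e * (norm (u + d - ubar) - norm (u - ubar))
        + n / 2 * (infdist (u + d) Om ^ 2 - infdist u Om ^ 2)
        + c * n / 2 * ((LINT t|M. norm (v t - (u + d)) ^ 2) - (LINT t|M. norm (v t - u) ^ 2))"
      unfolding penalty_def by (simp add: algebra_simps inner_diff_right inner_add_right)
    also have "\<dots> \<le> - inner us d + 2 * e * norm d + n / 2 * (2 * inner (u - w) d + norm d ^ 2)
        + c * n / 2 * (2 * inner (LINT t|M. u - v t) d + m * norm d ^ 2)"
      unfolding n3 using n1 n2 e n by (intro add_mono mult_left_mono order_refl) auto
    also have "\<dots> = inner Z d + 2 * e * norm d + (n / 2 + c * n / 2 * m) * norm d ^ 2"
      unfolding Z_def P by (simp add: algebra_simps inner_add_left inner_diff_left)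
    finally show "0 \<le> inner Z d + 2 * e * norm d + (n / 2 + c * n / 2 * m) * norm d ^ 2" .
  qed
  then show ?thesis using norm_minus_commute[of us "n *\<^sub>R (u - w) + P"] unfolding Z_def P_def[symmetric]
    by (simp add: algebra_simps)
qed

text \<open>
The constants measure how far things can be from their limits if \<open>u\<close>, \<open>Om\<close> and \<open>K\<close> are met up to \<open>\<delta>\<close>: then
\<open>norm ys \<le> n * \<delta>\<close>, so \<open>norm (v t - u) \<le> 2 * l * \<delta>\<close> and \<open>norm (v t - ubar) \<le> \<eta>\<close>, so \<open>f t\<close> is within
\<open>l * \<eta>\<close> of \<open>y0 t\<close> and \<open>\<integral>f\<close> within \<open>m * l * \<eta>\<close> of \<open>\<integral>y0\<close>. The sum of all these distances is at most
\<open>\<delta> * D\<close>, and \<open>\<delta>\<close> is chosen to put it below \<open>e\<close> and \<open>r\<close>.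
\<close>

proposition approximate_normals_at_radius:
  fixes us :: 'u and e :: real
  defines "m \<equiv> measure M (space M)"
  assumes K: "closed K" and Om: "closed Om" and base: "ubar \<in> Om" "integral\<^sup>L M y0 \<in> K"
    and e: "e > 0"
    and reg: "\<And>u. u \<in> Om \<Longrightarrow> u \<in> cball ubar r \<Longrightarrow> expected_multifunction M \<Phi> u \<inter> K \<noteq> {} \<Longrightarrow>
        inner us (u - ubar) \<le> e * norm (u - ubar)"
  shows "\<exists>w ws \<kappa> ys v f p. ws \<in> regular_normal_cone w Om \<and> norm (w - ubar) \<le> e \<and>
    ys \<in> regular_normal_cone \<kappa> K \<and> norm (\<kappa> - integral\<^sup>L M y0) \<le> e \<and> p \<in> borel_measurable M \<and>
    (AE t in M. (p t, - ys) \<in> regular_normal_cone (v t, f t) (gph (\<Phi> t)) \<and>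
       norm (p t) \<le> 2 * l * (1 + m * l ^ 2) * norm ys \<and> norm (v t - ubar) \<le> e \<and> norm (f t - y0 t) \<le> e) \<and>
    norm (us - ws - integral\<^sup>L M p) \<le> 2 * e"
proof -
  define c where "c = 1 + m * l ^ 2"
  have m: "m \<ge> 0" by (simp add: m_def)
  have c: "c \<ge> 1" using m by (simp add: c_def)
  define D where "D = 2 + (1 + 2 * l) * (1 + l + m * l)"
  have D: "D \<ge> 2" using l m by (simp add: D_def)
  define \<delta> where "\<delta> = min e r / (2 * D)"
  have \<delta>: "\<delta> > 0" using e r D by (simp add: \<delta>_def)
  have \<delta>D: "\<delta> * D < e" "\<delta> * D < r"
  proof -
    have "\<delta> * D = min e r / 2" using D by (simp add: \<delta>_def)
    then show "\<delta> * D < e" "\<delta> * D < r" using e r by auto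
  qed
  have ml: "m * l \<ge> 0" using m l by simp
  define \<eta> where "\<eta> = (1 + 2 * l) * \<delta>"
  have \<eta>: "\<eta> \<ge> 0" using l \<delta> by (simp add: \<eta>_def)
  have \<delta>De: "\<delta> * D = 2 * \<delta> + \<eta> + l * \<eta> + m * l * \<eta>" by (simp add: D_def \<eta>_def algebra_simps)
  have l\<eta>: "0 \<le> l * \<eta>" "0 \<le> m * l * \<eta>" using \<eta> l ml by simp_all
  have "\<exists>n u v f. n > 0 \<and> norm (u - ubar) < \<delta> \<and> u \<in> cball ubar r \<and> admissible v f \<and>
    infdist u Om < \<delta> \<and> infdist (integral\<^sup>L M f) K < \<delta> \<and>
    (\<forall>u' v' f'. u' \<in> cball ubar r \<longrightarrow> admissible v' f' \<longrightarrow>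
       penalty K Om us e c n u v f \<le> penalty K Om us e c n u' v' f')"
    by (rule penalty_minimisers_converge[OF K Om base e c _ \<delta>]) (rule reg)
  then obtain n u v f where n: "n > 0" and ud: "norm (u - ubar) < \<delta>" and u: "u \<in> cball ubar r"
    and adm: "admissible v f" and Ad: "infdist u Om < \<delta>" and Bd: "infdist (integral\<^sup>L M f) K < \<delta>"
    and min: "\<forall>u' v' f'. u' \<in> cball ubar r \<longrightarrow> admissible v' f' \<longrightarrow>
       penalty K Om us e c n u v f \<le> penalty K Om us e c n u' v' f'"
    by (elim exE conjE)
  obtain w where w: "w \<in> Om" "infdist u Om = dist u w"
    using infdist_attains_inf[OF Om, of u] base(1) by blast
  obtain \<kappa> where \<kappa>: "\<kappa> \<in> K" "infdist (integral\<^sup>L M f) K = dist (integral\<^sup>L M f) \<kappa>"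
    using infdist_attains_inf[OF K, of "integral\<^sup>L M f"] base(2) by blast
  define ys where "ys = n *\<^sub>R (integral\<^sup>L M f - \<kappa>)"
  define ws where "ws = n *\<^sub>R (u - w)"
  define p where "p t = (c * n) *\<^sub>R (u - v t)" for t
  have [measurable]: "v \<in> borel_measurable M" using adm by (simp add: admissible_def)
  have p: "p \<in> borel_measurable M" unfolding p_def by measurable
  have nys: "norm ys < n * \<delta>" using Bd n \<kappa>(2) by (simp add: ys_def dist_norm)
  have AE_opt: "AE t in M. t \<in> T0 \<and> near_graph t (v t) (f t) \<and> (\<forall>v' f'. near_graph t v' f' \<longrightarrow>
    0 \<le> c * n / 2 * (norm (v' - u) ^ 2 - norm (v t - u) ^ 2) + inner ys (f' - f t)
        + n / 2 * m * norm (f' - f t) ^ 2)"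
    unfolding m_def
    by (rule pointwise_optimality[OF u adm _ _ \<kappa> _ ys_def]) (use n c u min in auto)
  have AE_all: "AE t in M. ((p t, - ys) \<in> regular_normal_cone (v t, f t) (gph (\<Phi> t)) \<and>
       norm (p t) \<le> 2 * l * (1 + m * l ^ 2) * norm ys) \<and> norm (v t - ubar) \<le> \<eta> \<and> norm (f t - y0 t) \<le> l * \<eta>"
    using AE_opt
  proof eventually_elim
    fix t assume a: "t \<in> T0 \<and> near_graph t (v t) (f t) \<and> (\<forall>v' f'. near_graph t v' f' \<longrightarrow>
    0 \<le> c * n / 2 * (norm (v' - u) ^ 2 - norm (v t - u) ^ 2) + inner ys (f' - f t)
        + n / 2 * m * norm (f' - f t) ^ 2)"
    then have t: "t \<in> T0" "near_graph t (v t) (f t)" by simp_all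
    have near: "n * norm (v t - u) \<le> 2 * l * norm ys"
      by (rule optimal_selection_near[OF t u n m]) (use a in \<open>simp add: c_def\<close>)
    also have "\<dots> \<le> 2 * l * (n * \<delta>)" using nys l by (intro mult_left_mono) auto
    finally have "n * norm (v t - u) \<le> n * (2 * l * \<delta>)" by (simp add: algebra_simps)
    then have "norm (v t - u) \<le> 2 * l * \<delta>" using n by simp
    moreover have "norm (v t - ubar) \<le> norm (v t - u) + norm (u - ubar)"
      using norm_triangle_ineq[of "v t - u" "u - ubar"] by simp
    ultimately have v\<eta>: "norm (v t - ubar) \<le> \<eta>" using ud by (simp add: \<eta>_def algebra_simps)
    have "l * norm (v t - ubar) \<le> l * \<eta>" using v\<eta> l by (intro mult_left_mono) auto
    then have f\<eta>: "norm (f t - y0 t) \<le> l * \<eta>" using near_graph_close[OF t] by linarith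
    have "norm (v t - ubar) < r" using v\<eta> \<delta>D(2) l\<eta> \<delta> unfolding \<delta>De by linarith
    then have "(p t, - ys) \<in> regular_normal_cone (v t, f t) (gph (\<Phi> t))"
      unfolding p_def by (rule optimal_selection_normal[OF t _ n m]) (use a c in auto)
    moreover have "norm (p t) \<le> 2 * l * (1 + m * l ^ 2) * norm ys"
    proof -
      have "norm (p t) = c * (n * norm (v t - u))"
        using c n by (simp add: p_def norm_minus_commute)
      also have "\<dots> \<le> c * (2 * l * norm ys)" using near c by (intro mult_left_mono) auto
      finally show ?thesis by (simp add: c_def algebra_simps)
    qed
    ultimately show "((p t, - ys) \<in> regular_normal_cone (v t, f t) (gph (\<Phi> t)) \<and>
       norm (p t) \<le> 2 * l * (1 + m * l ^ 2) * norm ys) \<and> norm (v t - ubar) \<le> \<eta> \<and> norm (f t - y0 t) \<le> l * \<eta>"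
      using v\<eta> f\<eta> by (intro conjI)
  qed
  have "norm (integral\<^sup>L M f - integral\<^sup>L M y0) \<le> m * l * \<eta>"
  proof -
    have i: "integrable M (\<lambda>t. f t - y0 t)" using admissible_integrable(1)[OF adm] y0 by simp
    have "norm (integral\<^sup>L M f - integral\<^sup>L M y0) = norm (LINT t|M. f t - y0 t)"
      using admissible_integrable(1)[OF adm] y0 by simp
    also have "\<dots> \<le> (LINT t|M. norm (f t - y0 t))" by (rule integral_norm_bound)
    also have "\<dots> \<le> (LINT t|M. l * \<eta>)"
    proof (rule integral_mono_AE)
      show "AE t in M. norm (f t - y0 t) \<le> l * \<eta>" using AE_all by eventually_elim simp
    qed (use i in auto)
    finally show ?thesis by (simp add: m_def algebra_simps)
  qed
  moreover have "norm (\<kappa> - integral\<^sup>L M y0) \<le> dist (integral\<^sup>L M f) \<kappa> + norm (integral\<^sup>L M f - integral\<^sup>L M y0)"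
    using norm_triangle_ineq[of "\<kappa> - integral\<^sup>L M f" "integral\<^sup>L M f - integral\<^sup>L M y0"]
    by (simp add: dist_norm norm_minus_commute)
  ultimately have \<kappa>e: "norm (\<kappa> - integral\<^sup>L M y0) \<le> e"
    using Bd \<kappa>(2) \<delta>D(1) l\<eta> \<eta> \<delta> unfolding \<delta>De by linarith
  have "norm (w - ubar) \<le> dist u w + norm (u - ubar)"
    using norm_triangle_ineq[of "w - u" "u - ubar"] by (simp add: dist_norm norm_minus_commute)
  then have we: "norm (w - ubar) \<le> e"
    using Ad w(2) ud \<delta>D(1) l\<eta> \<eta> unfolding \<delta>De by linarith
  have ws: "ws \<in> regular_normal_cone w Om"
    unfolding ws_def using n infdist_le[of _ Om u] w
    by (intro nearest_point_regular_normal) auto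
  have ysn: "ys \<in> regular_normal_cone \<kappa> K"
    unfolding ys_def using n infdist_le[of _ K "integral\<^sup>L M f"] \<kappa>
    by (intro nearest_point_regular_normal) auto
  have ur: "norm (u - ubar) < r" using ud \<delta>D(2) l\<eta> \<eta> \<delta> unfolding \<delta>De by linarith
  have "norm (us - ws - integral\<^sup>L M p) \<le> 2 * e"
    unfolding ws_def p_def
    by (rule stationarity_in_u[OF ur adm n _ _ w]) (use c e min adm in auto)
  moreover have "AE t in M. (p t, - ys) \<in> regular_normal_cone (v t, f t) (gph (\<Phi> t)) \<and>
       norm (p t) \<le> 2 * l * (1 + m * l ^ 2) * norm ys \<and> norm (v t - ubar) \<le> e \<and> norm (f t - y0 t) \<le> e"
    using AE_all
  proof eventually_elim
    fix t assume a: "((p t, - ys) \<in> regular_normal_cone (v t, f t) (gph (\<Phi> t)) \<and>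
       norm (p t) \<le> 2 * l * (1 + m * l ^ 2) * norm ys) \<and> norm (v t - ubar) \<le> \<eta> \<and> norm (f t - y0 t) \<le> l * \<eta>"
    then have "norm (v t - ubar) \<le> e" "norm (f t - y0 t) \<le> e"
      using \<delta>D(1) l\<eta> \<eta> \<delta> unfolding \<delta>De by linarith+
    then show "(p t, - ys) \<in> regular_normal_cone (v t, f t) (gph (\<Phi> t)) \<and>
       norm (p t) \<le> 2 * l * (1 + m * l ^ 2) * norm ys \<and> norm (v t - ubar) \<le> e \<and> norm (f t - y0 t) \<le> e"
      using a by (elim conjE, intro conjI)
  qed
  ultimately show ?thesis using ws we ysn \<kappa>e p
    by (intro exI[of _ w] exI[of _ ws] exI[of _ \<kappa>] exI[of _ ys] exI[of _ v] exI[of _ f] exI[of _ p] conjI)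
qed

proposition approximate_normals:
  fixes us :: 'u and e :: real
  defines "m \<equiv> measure M (space M)"
  assumes K: "closed K" and Om: "closed Om" and base: "integral\<^sup>L M y0 \<in> K"
    and us: "us \<in> regular_normal_cone ubar {u \<in> Om. expected_multifunction M \<Phi> u \<inter> K \<noteq> {}}"
    and e: "e > 0"
  shows "\<exists>w ws \<kappa> ys v f p. ws \<in> regular_normal_cone w Om \<and> norm (w - ubar) \<le> e \<and>
    ys \<in> regular_normal_cone \<kappa> K \<and> norm (\<kappa> - integral\<^sup>L M y0) \<le> e \<and> p \<in> borel_measurable M \<and>
    (AE t in M. (p t, - ys) \<in> regular_normal_cone (v t, f t) (gph (\<Phi> t)) \<and>
       norm (p t) \<le> 2 * l * (1 + m * l ^ 2) * norm ys \<and> norm (v t - ubar) \<le> e \<and> norm (f t - y0 t) \<le> e) \<and>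
    norm (us - ws - integral\<^sup>L M p) \<le> 2 * e"
proof -
  have ubar: "ubar \<in> Om" using us by (simp add: regular_normal_cone_iff)
  obtain d where d: "d > 0"
    "\<forall>u\<in>{u \<in> Om. expected_multifunction M \<Phi> u \<inter> K \<noteq> {}}. dist u ubar < d \<longrightarrow> inner us (u - ubar) \<le> e * norm (u - ubar)"
    using us e unfolding regular_normal_cone_iff by blast
  define r' where "r' = min r (d / 2)"
  have r': "0 < r'" "r' \<le> r" "r' < d" using r d(1) by (auto simp: r'_def)
  interpret S: lipschitz_integrand M \<Phi> ubar y0 T0 l \<gamma> r' by (rule shrink_radius[OF r'(1,2)])
  show ?thesis
    unfolding m_def
  proof (rule S.approximate_normals_at_radius[OF K Om ubar base e])
    fix u assume "u \<in> Om" and u: "u \<in> cball ubar r'" and "expected_multifunction M \<Phi> u \<inter> K \<noteq> {}"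
    then have "u \<in> {u \<in> Om. expected_multifunction M \<Phi> u \<inter> K \<noteq> {}}" by blast
    moreover have "dist u ubar < d" using u r'(3) by (simp add: dist_commute)
    ultimately show "inner us (u - ubar) \<le> e * norm (u - ubar)" using bspec[OF d(2)] by simp
  qed
qed

end

section \<open>Passage to the limit\<close>

lemma aumann_integral_cong_AE:
  assumes "AE t in M. G t = H t"
  shows "aumann_integral M G = aumann_integral M H"
proof -
  have "(AE t in M. f t \<in> G t) \<longleftrightarrow> (AE t in M. f t \<in> H t)" for f
    using assms by (intro eventually_subst) (auto elim!: eventually_mono)
  then show ?thesis unfolding aumann_integral_def by simp
qed

context lipschitz_integrand
begin

text \<open>
Approximate normals for \<open>e = 1 / Suc k\<close> are multiplied by \<open>s k\<close>. Their limits satisfy \<open>S *\<^sub>R us = I + W\<close>, where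
\<open>I\<close> is the integral of a selection of coderivatives at \<open>Y\<close>, by the Fatou lemma, and \<open>W\<close> is normal to \<open>Om\<close>.
If \<open>S > 0\<close> the equation is divided by \<open>S\<close>, as all sets involved are cones. If \<open>S = 0\<close> the multipliers were
unbounded and \<open>norm Y \<ge> 1\<close>; but then \<open>W = - I\<close>, the second qualification condition gives \<open>I = 0\<close> and the first
one \<open>Y = 0\<close>.
\<close>

theorem normals_of_constraint_system:
  assumes K: "closed K" and Om: "closed Om" and base: "integral\<^sup>L M y0 \<in> K"
    and us: "us \<in> regular_normal_cone ubar {u \<in> Om. expected_multifunction M \<Phi> u \<inter> K \<noteq> {}}"
    and qual1: "\<And>ys. 0 \<in> aumann_integral M (\<lambda>t. coderivative (\<Phi> t) ubar (y0 t) ys) \<Longrightarrow>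
        ys \<in> normal_cone (integral\<^sup>L M y0) K \<Longrightarrow> ys = 0"
    and qual2: "\<And>ys q. ys \<in> normal_cone (integral\<^sup>L M y0) K \<Longrightarrow>
        q \<in> aumann_integral M (\<lambda>t. coderivative (\<Phi> t) ubar (y0 t) ys) \<Longrightarrow>
        - q \<in> normal_cone ubar Om \<Longrightarrow> q = 0"
  shows "\<exists>ys\<in>normal_cone (integral\<^sup>L M y0) K.
      us \<in> aumann_integral M (\<lambda>t. coderivative (\<Phi> t) ubar (y0 t) ys) + normal_cone ubar Om"
proof -
  define C where "C = 2 * l * (1 + measure M (space M) * l ^ 2)"
  have C: "C \<ge> 0" using l by (simp add: C_def)
  define \<epsilon> where "\<epsilon> k = 1 / real (Suc k)" for k
  have \<epsilon>: "\<epsilon> k > 0" for k by (simp add: \<epsilon>_def)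
  have \<epsilon>_le: "\<epsilon> k \<le> 1" for k
    unfolding \<epsilon>_def by (subst pos_divide_le_eq) simp_all
  have \<epsilon>0: "\<epsilon> \<longlonglongrightarrow> 0" unfolding \<epsilon>_def by (rule LIMSEQ_Suc[OF lim_1_over_n])
  define normal_at where "normal_at k p ys v f t \<longleftrightarrow> (p t, - ys) \<in> regular_normal_cone (v t, f t) (gph (\<Phi> t)) \<and>
       norm (p t) \<le> C * norm ys \<and> norm (v t - ubar) \<le> \<epsilon> k \<and> norm (f t - y0 t) \<le> \<epsilon> k" for k p ys v f t
  define approx where "approx k w ws \<kappa> ys v f p \<longleftrightarrow> ws \<in> regular_normal_cone w Om \<and> norm (w - ubar) \<le> \<epsilon> k \<and>
    ys \<in> regular_normal_cone \<kappa> K \<and> norm (\<kappa> - integral\<^sup>L M y0) \<le> \<epsilon> k \<and> p \<in> borel_measurable M \<and>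
    (AE t in M. normal_at k p ys v f t) \<and> norm (us - ws - integral\<^sup>L M p) \<le> 2 * \<epsilon> k" for k w ws \<kappa> ys v f p
  have "\<exists>w ws \<kappa> ys v f p. approx k w ws \<kappa> ys v f p" for k
    unfolding approx_def normal_at_def C_def by (rule approximate_normals[OF K Om base us \<epsilon>])
  then obtain w ws \<kappa> ys v f p where a: "\<And>k. approx k (w k) (ws k) (\<kappa> k) (ys k) (v k) (f k) (p k)"
    by metis
  have a1: "\<And>k. ws k \<in> regular_normal_cone (w k) Om" "\<And>k. norm (w k - ubar) \<le> \<epsilon> k"
    "\<And>k. ys k \<in> regular_normal_cone (\<kappa> k) K" "\<And>k. norm (\<kappa> k - integral\<^sup>L M y0) \<le> \<epsilon> k"
    "\<And>k. p k \<in> borel_measurable M" "\<And>k. AE t in M. normal_at k (p k) (ys k) (v k) (f k) t"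
    "\<And>k. norm (us - ws k - integral\<^sup>L M (p k)) \<le> 2 * \<epsilon> k"
    using a unfolding approx_def by blast+
  \<comment> \<open>Scaling by \<open>max 1 (norm (ys k))\<close> treats bounded and unbounded multipliers together.\<close>
  define s where "s k = 1 / max 1 (norm (ys k))" for k
  have s: "s k > 0" "s k \<le> 1" for k by (simp_all add: s_def)
  have sy: "s k * norm (ys k) \<le> 1" "1 \<le> s k * norm (ys k) + s k" for k
    by (auto simp: s_def max_def divide_simps)
  define good where "good t \<longleftrightarrow> (\<forall>k. normal_at k (p k) (ys k) (v k) (f k) t)" for t
  have good_AE: "AE t in M. good t" unfolding good_def using a1(6) by (simp add: AE_all_countable)
  have [measurable]: "{t \<in> space M. good t} \<in> sets M" by (rule sets_AE_complete[OF good_AE])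
  note a1(5)[measurable]
  define P where "P k t = (if good t then s k *\<^sub>R p k t else 0)" for k t
  have P[measurable]: "P k \<in> borel_measurable M" for k unfolding P_def by measurable
  have PC: "\<forall>k. \<forall>t\<in>space M. norm (P k t) \<le> C"
  proof (intro allI ballI)
    fix k t
    show "norm (P k t) \<le> C"
    proof (cases "good t")
      case True
      then have "norm (p k t) \<le> C * norm (ys k)" by (simp add: good_def normal_at_def)
      then have "s k * norm (p k t) \<le> s k * (C * norm (ys k))" using s(1)[of k] by (intro mult_left_mono) auto
      also have "\<dots> = C * (s k * norm (ys k))" by simp
      also have "\<dots> \<le> C * 1" using sy(1) C by (intro mult_left_mono) auto
      finally show ?thesis using True s(1)[of k] by (simp add: P_def)
    qed (simp add: P_def C)
  qed
  have intP: "integral\<^sup>L M (P k) = s k *\<^sub>R integral\<^sup>L M (p k)" for k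
  proof -
    have "integral\<^sup>L M (P k) = (LINT t|M. s k *\<^sub>R p k t)"
    proof (rule integral_cong_AE)
      show "AE t in M. P k t = s k *\<^sub>R p k t" using good_AE by eventually_elim (simp add: P_def)
    qed measurable
    then show ?thesis by simp
  qed
  have normP: "norm (integral\<^sup>L M (P k)) \<le> C * measure M (space M)" for k
  proof -
    have int_P: "integrable M (P k)" by (rule integrable_bounded[OF P]) (use PC in blast)
    have "norm (integral\<^sup>L M (P k)) \<le> (LINT t|M. norm (P k t))" by (rule integral_norm_bound)
    also have "\<dots> \<le> (LINT t|M. C)"
      using int_P PC by (intro integral_mono integrable_norm) auto
    finally show ?thesis by (simp add: mult.commute)
  qed
  have err: "norm (s k *\<^sub>R us - s k *\<^sub>R ws k - integral\<^sup>L M (P k)) \<le> 2 * \<epsilon> k" for k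
  proof -
    have "s k *\<^sub>R us - s k *\<^sub>R ws k - integral\<^sup>L M (P k) = s k *\<^sub>R (us - ws k - integral\<^sup>L M (p k))"
      by (simp add: intP scaleR_diff_right)
    then have "norm (s k *\<^sub>R us - s k *\<^sub>R ws k - integral\<^sup>L M (P k)) = s k * norm (us - ws k - integral\<^sup>L M (p k))"
      using s(1)[of k] by simp
    also have "\<dots> \<le> 1 * (2 * \<epsilon> k)" using a1(7)[of k] s[of k] by (intro mult_mono) auto
    finally show ?thesis by simp
  qed
  have normw: "norm (s k *\<^sub>R ws k) \<le> norm us + C * measure M (space M) + 2" for k
  proof -
    have "s k *\<^sub>R ws k = s k *\<^sub>R us - (s k *\<^sub>R us - s k *\<^sub>R ws k - integral\<^sup>L M (P k)) - integral\<^sup>L M (P k)"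
      by simp
    also have "norm \<dots> \<le> norm (s k *\<^sub>R us) + norm (s k *\<^sub>R us - s k *\<^sub>R ws k - integral\<^sup>L M (P k)) + norm (integral\<^sup>L M (P k))"
      by (meson add_right_mono norm_triangle_ineq4 order_trans)
    also have "\<dots> \<le> norm us + 2 * 1 + C * measure M (space M)"
    proof (intro add_mono normP order_trans[OF err])
      show "norm (s k *\<^sub>R us) \<le> norm us" using s[of k] by (simp add: mult_left_le_one_le)
      show "2 * \<epsilon> k \<le> 2 * 1" using \<epsilon>_le[of k] by simp
    qed
    finally show ?thesis by simp
  qed
  define Z where "Z = cball (0::'v) 1 \<times> cball (0::'u) (C * measure M (space M))
      \<times> cball (0::'u) (norm us + C * measure M (space M) + 2) \<times> {0..1::real}"
  define z where "z k = (s k *\<^sub>R ys k, integral\<^sup>L M (P k), s k *\<^sub>R ws k, s k)" for k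
  have zZ: "\<forall>k. z k \<in> Z"
  proof
    fix k
    have "norm (s k *\<^sub>R ys k) \<le> 1" using sy(1)[of k] s(1)[of k] by simp
    then show "z k \<in> Z" using normP[of k] normw[of k] s[of k] unfolding z_def Z_def
      by (simp only: mem_Times_iff fst_conv snd_conv mem_cball dist_0_norm atLeastAtMost_iff) (simp add: less_imp_le)
  qed
  have "seq_compact Z"
    unfolding Z_def by (intro compact_imp_seq_compact compact_Times compact_cball compact_Icc)
  from seq_compactE[OF this zZ] obtain z0 \<rho> where z0: "z0 \<in> Z" and \<rho>: "strict_mono \<rho>" and zlim: "(z \<circ> \<rho>) \<longlonglongrightarrow> z0"
    by blast
  obtain Y I W S where z0_eq: "z0 = (Y, I, W, S)" by (cases z0)
  have Ylim: "(\<lambda>k. s (\<rho> k) *\<^sub>R ys (\<rho> k)) \<longlonglongrightarrow> Y"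
    using tendsto_fst[OF zlim] by (simp add: z_def z0_eq o_def)
  have Ilim: "(\<lambda>k. integral\<^sup>L M (P (\<rho> k))) \<longlonglongrightarrow> I"
    using tendsto_fst[OF tendsto_snd[OF zlim]] by (simp add: z_def z0_eq o_def)
  have Wlim: "(\<lambda>k. s (\<rho> k) *\<^sub>R ws (\<rho> k)) \<longlonglongrightarrow> W"
    using tendsto_fst[OF tendsto_snd[OF tendsto_snd[OF zlim]]] by (simp add: z_def z0_eq o_def)
  have Slim: "(\<lambda>k. s (\<rho> k)) \<longlonglongrightarrow> S"
    using tendsto_snd[OF tendsto_snd[OF tendsto_snd[OF zlim]]] by (simp add: z_def z0_eq o_def)
  have \<epsilon>\<rho>: "(\<lambda>k. \<epsilon> (\<rho> k)) \<longlonglongrightarrow> 0" using LIMSEQ_subseq_LIMSEQ[OF \<epsilon>0 \<rho>] by (simp only: o_def)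
  have small: "x \<longlonglongrightarrow> x0" if "\<And>k. norm (x k - x0) \<le> c * \<epsilon> (q k)" "(\<lambda>k. \<epsilon> (q k)) \<longlonglongrightarrow> 0"
    for x :: "nat \<Rightarrow> 'b::real_normed_vector" and x0 c q
  proof -
    have "(\<lambda>k. c * \<epsilon> (q k)) \<longlonglongrightarrow> 0" using tendsto_mult_left[OF that(2), of c] by simp
    then have "(\<lambda>k. x k - x0) \<longlonglongrightarrow> 0"
      by (rule Lim_null_comparison[rotated]) (use that(1) in simp)
    then show ?thesis by (simp add: LIM_zero_iff)
  qed
  have eqS: "S *\<^sub>R us = I + W"
  proof -
    have "(\<lambda>k. s (\<rho> k) *\<^sub>R us - s (\<rho> k) *\<^sub>R ws (\<rho> k) - integral\<^sup>L M (P (\<rho> k))) \<longlonglongrightarrow> S *\<^sub>R us - W - I"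
      by (intro tendsto_intros Slim Wlim Ilim)
    moreover have "(\<lambda>k. s (\<rho> k) *\<^sub>R us - s (\<rho> k) *\<^sub>R ws (\<rho> k) - integral\<^sup>L M (P (\<rho> k))) \<longlonglongrightarrow> 0"
      by (rule small[OF _ \<epsilon>\<rho>, of _ _ 2]) (use err in simp)
    ultimately have "S *\<^sub>R us - W - I = 0" by (rule LIMSEQ_unique)
    then show ?thesis by (simp add: algebra_simps)
  qed
  have YN: "Y \<in> normal_cone (integral\<^sup>L M y0) K"
  proof (rule normal_coneI[OF _ _ Ylim])
    show "s (\<rho> k) *\<^sub>R ys (\<rho> k) \<in> regular_normal_cone (\<kappa> (\<rho> k)) K" for k
      by (rule regular_normal_cone_scaleR[OF a1(3) s(1)])
    show "(\<lambda>k. \<kappa> (\<rho> k)) \<longlonglongrightarrow> integral\<^sup>L M y0"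
      by (rule small[OF _ \<epsilon>\<rho>, of _ _ 1]) (use a1(4) in simp)
  qed
  have WN: "W \<in> normal_cone ubar Om"
  proof (rule normal_coneI[OF _ _ Wlim])
    show "s (\<rho> k) *\<^sub>R ws (\<rho> k) \<in> regular_normal_cone (w (\<rho> k)) Om" for k
      by (rule regular_normal_cone_scaleR[OF a1(1) s(1)])
    show "(\<lambda>k. w (\<rho> k)) \<longlonglongrightarrow> ubar"
      by (rule small[OF _ \<epsilon>\<rho>, of _ _ 1]) (use a1(2) in simp)
  qed
  have "I \<in> selection_integrals M C (\<lambda>k. P (\<rho> k))"
    by (rule selection_integrals_closed[OF P _ Ilim]) (use PC in blast)
  from selection_integralsD[OF this] obtain g where g: "g \<in> borel_measurable M"
    and gC: "\<forall>t\<in>space M. norm (g t) \<le> C" and gcl: "AE t in M. cluster_point (\<lambda>k. P (\<rho> k) t) (g t)"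
    and gI: "I = integral\<^sup>L M g" by (elim exE conjE)
  have int_g: "integrable M g" by (rule integrable_bounded[OF g]) (use gC in blast)
  have gcod: "AE t in M. g t \<in> coderivative (\<Phi> t) ubar (y0 t) Y"
    using gcl good_AE
  proof eventually_elim
    fix t assume cl: "cluster_point (\<lambda>k. P (\<rho> k) t) (g t)" and gt: "good t"
    obtain q where q: "strict_mono q" "((\<lambda>k. P (\<rho> k) t) \<circ> q) \<longlonglongrightarrow> g t"
      using cl unfolding cluster_point_def by blast
    define \<sigma> where "\<sigma> k = \<rho> (q k)" for k
    have att: "normal_at k (p k) (ys k) (v k) (f k) t" for k using gt by (simp add: good_def)
    have \<epsilon>\<sigma>: "(\<lambda>k. \<epsilon> (\<sigma> k)) \<longlonglongrightarrow> 0"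
      using LIMSEQ_subseq_LIMSEQ[OF \<epsilon>\<rho> q(1)] by (simp only: o_def \<sigma>_def)
    have plim: "(\<lambda>k. s (\<sigma> k) *\<^sub>R p (\<sigma> k) t) \<longlonglongrightarrow> g t"
      using q(2) gt by (simp add: P_def o_def \<sigma>_def)
    have ylim: "(\<lambda>k. s (\<sigma> k) *\<^sub>R ys (\<sigma> k)) \<longlonglongrightarrow> Y"
      using LIMSEQ_subseq_LIMSEQ[OF Ylim q(1)] by (simp only: o_def \<sigma>_def)
    have vlim: "(\<lambda>k. v (\<sigma> k) t) \<longlonglongrightarrow> ubar"
      by (rule small[OF _ \<epsilon>\<sigma>, of _ _ 1]) (use att in \<open>simp add: normal_at_def\<close>)
    have flim: "(\<lambda>k. f (\<sigma> k) t) \<longlonglongrightarrow> y0 t"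
      by (rule small[OF _ \<epsilon>\<sigma>, of _ _ 1]) (use att in \<open>simp add: normal_at_def\<close>)
    have "s (\<sigma> k) *\<^sub>R (p (\<sigma> k) t, - ys (\<sigma> k)) \<in> regular_normal_cone (v (\<sigma> k) t, f (\<sigma> k) t) (gph (\<Phi> t))" for k
      using att by (intro regular_normal_cone_scaleR[OF _ s(1)]) (simp add: normal_at_def)
    moreover have "(\<lambda>k. (v (\<sigma> k) t, f (\<sigma> k) t)) \<longlonglongrightarrow> (ubar, y0 t)"
      by (rule tendsto_Pair[OF vlim flim])
    moreover have "(\<lambda>k. s (\<sigma> k) *\<^sub>R (p (\<sigma> k) t, - ys (\<sigma> k))) \<longlonglongrightarrow> (g t, - Y)"
      using tendsto_Pair[OF plim tendsto_minus[OF ylim]] by simp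
    ultimately have "(g t, - Y) \<in> normal_cone (ubar, y0 t) (gph (\<Phi> t))"
      by (rule normal_coneI)
    then show "g t \<in> coderivative (\<Phi> t) ubar (y0 t) Y" by (simp add: coderivative_def)
  qed
  have Iaum: "I \<in> aumann_integral M (\<lambda>t. coderivative (\<Phi> t) ubar (y0 t) Y)"
    unfolding aumann_integral_def gI using int_g gcod by blast
  have "S \<ge> 0" by (rule LIMSEQ_le_const[OF Slim]) (use s in \<open>auto simp: less_imp_le\<close>)
  show ?thesis
  proof (cases "S = 0")
    case True
    have "(\<lambda>k. norm (s (\<rho> k) *\<^sub>R ys (\<rho> k)) + s (\<rho> k)) \<longlonglongrightarrow> norm Y + S"
      by (intro tendsto_intros Ylim Slim)
    then have "1 \<le> norm Y + S"
      by (rule LIMSEQ_le_const) (use sy(2) s(1) in \<open>auto simp: abs_of_pos\<close>)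
    then have "Y \<noteq> 0" using True by auto
    have "I + W = 0" using eqS True by simp
    then have "W = - I" by (simp only: add_eq_0_iff)
    then have "I = 0" using qual2[OF YN Iaum] WN by simp
    then have "Y = 0" using qual1[OF _ YN] Iaum by simp
    then show ?thesis using \<open>Y \<noteq> 0\<close> by simp
  next
    case False
    then have S: "1 / S > 0" using \<open>S \<ge> 0\<close> by simp
    have Y': "(1 / S) *\<^sub>R Y \<in> normal_cone (integral\<^sup>L M y0) K" by (rule normal_cone_scaleR[OF YN S])
    have I': "(1 / S) *\<^sub>R I \<in> aumann_integral M (\<lambda>t. coderivative (\<Phi> t) ubar (y0 t) ((1 / S) *\<^sub>R Y))"
    proof -
      have "AE t in M. (1 / S) *\<^sub>R g t \<in> coderivative (\<Phi> t) ubar (y0 t) ((1 / S) *\<^sub>R Y)"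
        using gcod by eventually_elim (rule coderivative_scaleR[OF _ S])
      moreover have "integrable M (\<lambda>t. (1 / S) *\<^sub>R g t)" using int_g by simp
      moreover have "(1 / S) *\<^sub>R I = (LINT t|M. (1 / S) *\<^sub>R g t)" by (simp add: gI)
      ultimately show ?thesis unfolding aumann_integral_def by blast
    qed
    have W': "(1 / S) *\<^sub>R W \<in> normal_cone ubar Om" by (rule normal_cone_scaleR[OF WN S])
    have "us = (1 / S) *\<^sub>R I + (1 / S) *\<^sub>R W"
    proof -
      have "(1 / S) *\<^sub>R (S *\<^sub>R us) = (1 / S) *\<^sub>R (I + W)" by (simp only: eqS)
      then show ?thesis using False by (simp add: scaleR_add_right)
    qed
    then have "us \<in> aumann_integral M (\<lambda>t. coderivative (\<Phi> t) ubar (y0 t) ((1 / S) *\<^sub>R Y)) + normal_cone ubar Om"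
      using set_plus_intro[OF I' W'] by (simp only:)
    then show ?thesis by (rule bexI[OF _ Y'])
  qed
qed

end

text \<open>
It remains to bring the data into the form of the local problem. The integrable selection \<open>y0\<close> behind \<open>ybar\<close>
replaces \<open>y\<close>, with which it agrees almost everywhere, and normal regularity turns a coderivative of \<open>F\<close> into a
regular normal of its graph.
\<close>

theorem theorem6p1:
  fixes M :: "'t measure"
    and \<Phi> :: "'t \<Rightarrow> (real ^ 'n) \<times> (real ^ 'q) \<Rightarrow> (real ^ 'm) set"
    and K :: "(real ^ 'm) set"
    and Om :: "((real ^ 'n) \<times> (real ^ 'q)) set"
    and F :: "real ^ 'n \<Rightarrow> (real ^ 'q) set"
    and xbar :: "real ^ 'n" and zbar :: "real ^ 'q"
    and y :: "'t \<Rightarrow> real ^ 'm" and ybar :: "real ^ 'm" and \<rho> :: real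
  assumes "finite_measure M" and "complete_measure M"
    and "set_valued_normal_integrand M \<Phi>"
    and "closed K" and "K \<noteq> {}" and "closed Om" and "Om \<noteq> {}"
    and F: "\<And>x. F x = {z. expected_multifunction M \<Phi> (x, z) \<inter> K \<noteq> {} \<and> (x, z) \<in> Om}"
    and "(xbar, zbar) \<in> gph F"
    and "normally_regular (gph F) (xbar, zbar)"
    and "\<rho> > 0"
    and "\<And>t x z. t \<in> space M \<Longrightarrow> (x, z) \<in> cball (xbar, zbar) \<rho> \<Longrightarrow> convex (\<Phi> t (x, z))"
    and "\<And>t. t \<in> space M \<Longrightarrow> \<Phi> t (xbar, zbar) = {y t}"
    and "ybar \<in> expected_multifunction M \<Phi> (xbar, zbar) \<inter> K"
    and "integrably_Lipschitz_like M \<Phi> (xbar, zbar) y"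
    and "\<And>ys. 0 \<in> aumann_integral M (\<lambda>t. coderivative (\<Phi> t) (xbar, zbar) (y t) ys) \<Longrightarrow>
               ys \<in> normal_cone ybar K \<Longrightarrow> ys = 0"
    and "(\<Union>ys \<in> normal_cone ybar K.
            aumann_integral M (\<lambda>t. coderivative (\<Phi> t) (xbar, zbar) (y t) ys))
          \<inter> uminus ` normal_cone (xbar, zbar) Om = {0}"
  shows "\<forall>zs. \<forall>xs \<in> coderivative F xbar zbar zs. \<exists>ys \<in> normal_cone ybar K.
           (xs, - zs) \<in> aumann_integral M (\<lambda>t. coderivative (\<Phi> t) (xbar, zbar) (y t) ys)
                        + normal_cone (xbar, zbar) Om"
proof -
  interpret finite_measure M by (rule assms(1))
  interpret complete_measure M by (rule assms(2))
  note single = assms(13) and ybar = assms(14) and qual1 = assms(16) and qual2 = assms(17)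
  obtain y0 where y0: "integrable M y0" "AE t in M. y0 t \<in> \<Phi> t (xbar, zbar)" "ybar = integral\<^sup>L M y0"
    using ybar unfolding expected_multifunction_def aumann_integral_def by blast
  obtain l \<eta> \<gamma> T' where l: "l > 0" and \<eta>: "\<eta> > 0" and \<gamma>: "\<gamma> > 0" and T': "T' \<in> sets M"
    and T'0: "emeasure M (space M - T') = 0"
    and lip: "\<forall>t \<in> T'. \<forall>u \<in> cball (xbar, zbar) \<eta>. \<forall>u' \<in> cball (xbar, zbar) \<eta>.
           \<Phi> t u \<inter> cball (y t) \<gamma> \<subseteq> \<Phi> t u' + (\<lambda>b. (l * norm (u - u')) *\<^sub>R b) ` cball 0 1"
    using assms(15) unfolding integrably_Lipschitz_like_def by blast
  define T0 where "T0 = {t \<in> space M. t \<in> T' \<and> y0 t = y t}"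
  have "space M - T' \<in> null_sets M" using T' T'0 by (simp add: null_sets_def)
  then have "AE t in M. t \<notin> space M - T'" by (rule AE_not_in)
  then have good: "AE t in M. t \<in> T' \<and> y0 t = y t"
    using y0(2) AE_space by eventually_elim (use single in auto)
  then have "{t \<in> space M. \<not> (t \<in> T' \<and> y0 t = y t)} \<in> sets M"
    unfolding AE_iff_null_sets by (rule null_setsD2)
  then have "space M - {t \<in> space M. \<not> (t \<in> T' \<and> y0 t = y t)} \<in> sets M" by simp
  also have "space M - {t \<in> space M. \<not> (t \<in> T' \<and> y0 t = y t)} = T0" by (auto simp: T0_def)
  finally have T0: "T0 \<in> sets M" .
  have T0_full: "AE t in M. t \<in> T0" using good AE_space by eventually_elim (simp add: T0_def)
  \<comment> \<open>The two radii ensure the Lipschitz condition on the ball and \<open>3 * l * r \<le> \<gamma>\<close>.\<close>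
  define r where "r = min \<eta> (\<gamma> / (3 * l))"
  have r: "r > 0" using \<eta> \<gamma> l by (simp add: r_def)
  have lr: "3 * l * r \<le> \<gamma>"
  proof -
    have "3 * l * r \<le> 3 * l * (\<gamma> / (3 * l))" using l by (intro mult_left_mono) (simp_all add: r_def)
    then show ?thesis using l by simp
  qed
  interpret L: lipschitz_integrand M \<Phi> "(xbar, zbar)" y0 T0 l \<gamma> r
  proof (intro lipschitz_integrand.intro lipschitz_integrand_axioms.intro)
    show "\<exists>x'\<in>\<Phi> t u'. norm (x' - x) \<le> l * norm (u - u')"
      if t: "t \<in> T0" and u: "u \<in> cball (xbar, zbar) r" and u': "u' \<in> cball (xbar, zbar) r"
        and x: "x \<in> \<Phi> t u" "x \<in> cball (y0 t) \<gamma>" for t u u' x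
    proof -
      have sub: "cball (xbar, zbar) r \<subseteq> cball (xbar, zbar) \<eta>" by (rule subset_cball) (simp add: r_def)
      have tT: "t \<in> T'" "y0 t = y t" using t by (simp_all add: T0_def)
      have "x \<in> \<Phi> t u \<inter> cball (y t) \<gamma>" using x tT(2) by simp
      then have "x \<in> \<Phi> t u' + (\<lambda>b. (l * norm (u - u')) *\<^sub>R b) ` cball 0 1"
        by (rule subsetD[OF bspec[OF bspec[OF bspec[OF lip tT(1)] subsetD[OF sub u]] subsetD[OF sub u']]])
      then obtain x' b where x': "x' \<in> \<Phi> t u'" and b: "norm b \<le> 1" and xx: "x = x' + (l * norm (u - u')) *\<^sub>R b"
        by (auto elim!: set_plus_elim)
      have "norm (x' - x) = l * norm (u - u') * norm b" using l by (simp add: xx)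
      also have "\<dots> \<le> l * norm (u - u') * 1" using b l by (intro mult_left_mono) auto
      finally show ?thesis using x' by auto
    qed
    show "\<Phi> t (xbar, zbar) = {y0 t}" if "t \<in> T0" for t
      using single that by (simp add: T0_def)
  qed (use assms(1-3) T0 T0_full y0(1) l r lr in simp_all)
  have cong: "aumann_integral M (\<lambda>t. coderivative (\<Phi> t) (xbar, zbar) (y0 t) ys)
      = aumann_integral M (\<lambda>t. coderivative (\<Phi> t) (xbar, zbar) (y t) ys)" for ys
  proof (rule aumann_integral_cong_AE)
    show "AE t in M. coderivative (\<Phi> t) (xbar, zbar) (y0 t) ys = coderivative (\<Phi> t) (xbar, zbar) (y t) ys"
      using good by eventually_elim simp
  qed
  have gphF: "gph F = {u \<in> Om. expected_multifunction M \<Phi> u \<inter> K \<noteq> {}}"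
    by (auto simp: gph_def F)
  show ?thesis
  proof (intro allI ballI)
    fix zs xs assume "xs \<in> coderivative F xbar zbar zs"
    then have "(xs, - zs) \<in> normal_cone (xbar, zbar) (gph F)" by (simp add: coderivative_def)
    then have us: "(xs, - zs) \<in> regular_normal_cone (xbar, zbar) {u \<in> Om. expected_multifunction M \<Phi> u \<inter> K \<noteq> {}}"
      using assms(10) unfolding normally_regular_def gphF by simp
    have "\<exists>ys\<in>normal_cone (integral\<^sup>L M y0) K. (xs, - zs) \<in>
        aumann_integral M (\<lambda>t. coderivative (\<Phi> t) (xbar, zbar) (y0 t) ys) + normal_cone (xbar, zbar) Om"
    proof (rule L.normals_of_constraint_system[OF assms(4,6) _ us])
      show "integral\<^sup>L M y0 \<in> K" using ybar y0(3) by simp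
      show "ys = 0" if "0 \<in> aumann_integral M (\<lambda>t. coderivative (\<Phi> t) (xbar, zbar) (y0 t) ys)"
        "ys \<in> normal_cone (integral\<^sup>L M y0) K" for ys
        using that unfolding cong y0(3)[symmetric] by (rule qual1)
      show "q = 0" if "ys \<in> normal_cone (integral\<^sup>L M y0) K"
        "q \<in> aumann_integral M (\<lambda>t. coderivative (\<Phi> t) (xbar, zbar) (y0 t) ys)"
        "- q \<in> normal_cone (xbar, zbar) Om" for ys q
      proof -
        have "q \<in> (\<Union>ys \<in> normal_cone ybar K.
            aumann_integral M (\<lambda>t. coderivative (\<Phi> t) (xbar, zbar) (y t) ys))"
          using that(1,2) unfolding cong y0(3)[symmetric] by (rule UN_I)
        moreover have "q \<in> uminus ` normal_cone (xbar, zbar) Om"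
          using that(3) by (rule image_eqI[rotated]) simp
        ultimately have "q \<in> {0}" unfolding qual2[symmetric] by (rule IntI)
        then show ?thesis by simp
      qed
    qed
    then show "\<exists>ys \<in> normal_cone ybar K.
           (xs, - zs) \<in> aumann_integral M (\<lambda>t. coderivative (\<Phi> t) (xbar, zbar) (y t) ys)
                        + normal_cone (xbar, zbar) Om"
      unfolding cong y0(3) .
  qed
qed

end
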